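(* Let $\mathcal G$ be a second countable étale groupoid. The following conditions are equivalent: (i) $\mathcal G$ is strongly amenable at infinity; (ii) there exists a sequence $(k_n)$ of bounded positive definite continuous kernels on $\mathcal G*_r\mathcal G$ supported in tubes such that (a) for every $n$, the restriction of $k_n$ to the diagonal of $\mathcal G*_r\mathcal G$ is uniformly bounded by $1$; (b) $\lim_n k_n=1$ uniformly on tubes.
   Context: Locally compact spaces are Hausdorff by convention. A locally compact groupoid is a groupoid $\mathcal G$ with a locally compact topology for which the structure maps (range $r$, source $s$, inverse, product) are continuous; the unit space is $X=\mathcal G^{(0)}\subset\mathcal G$, and $\mathcal G^x=r^{-1}(x)$. An étale groupoid is a locally compact groupoid whose range map (hence also source map) is a local homeomorphism from $\mathcal G$ to $\mathcal G^{(0)}$. Amenable groupoid: a locally compact groupoid $\mathcal H$ is amenable if there is a net $(m_i)$, where each $m_i=(m_i^x)_{x\in\mathcal H^{(0)}}$ is a family of probability measures $m_i^x$ on $\mathcal H^x$, such that $x\mapsto m_i^x(f)$ is continuous for all $f\in C_c(\mathcal H)$, and $\lim_i\|\gamma m_i^{s(\gamma)}-m_i^{r(\gamma)}\|_1=0$ uniformly on every compact subset of $\mathcal H$. A fibre space over $X$ is a pair $(Y,p)$ with $Y$ locally compact and $p:Y\to X$ a continuous surjection; it is fibrewise compact if $p^{-1}(K)$ is compact for every compact $K\subset X$. A (left) $\mathcal G$-space is a fibre space $(Y,p)$ over $X=\mathcal G^{(0)}$ with a continuous map $(\gamma,y)\mapsto\gamma y$ from $\{(\gamma,y)\in\mathcal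 G\times Y: s(\gamma)=p(y)\}$ to $Y$ such that $p(\gamma y)=r(\gamma)$, $p(y)y=y$, and $(\gamma_2\gamma_1)y=\gamma_2(\gamma_1y)$ whenever these are defined. The semidirect product groupoid $Y\rtimes\mathcal G$ is the space $\{(y,\gamma)\in Y\times \mathcal G: p(y)=r(\gamma)\}$ (with the topology induced by the product), with unit space $Y$, $r(y,\gamma)=y$, $s(y,\gamma)=\gamma^{-1}y$, $(y,\gamma)(\gamma^{-1}y,\eta)=(y,\gamma\eta)$, $(y,\gamma)^{-1}=(\gamma^{-1}y,\gamma^{-1})$. The $\mathcal G$-space $(Y,p)$ is amenable if the groupoid $Y\rtimes\mathcal G$ is amenable. $\mathcal G$ is strongly amenable at infinity if there exists an amenable fibrewise compact $\mathcal G$-space $(Y,p)$ together with a continuous section $\sigma:X\to Y$ of $p$. Kernels and tubes: $\mathcal G*_r\mathcal G=\{(\gamma,\gamma_1)\in\mathcal G\times\mathcal G: r(\gamma)=r(\gamma_1)\}$. A subset of $\mathcal G*_r\mathcal G$ is a tube if its image under $(\gamma,\gamma_1)\mapsto\gamma^{-1}\gamma_1$ is relatively compact in $\mathcal G$. A function $k:\mathcal G*_r\mathcal G\to\mathbb C$ is a positive definite kernel if for every $x\in X$, $n\in\mathbb N$, $\gamma_1,\dots,\gamma_n\in\mathcal G^x$ and $\alpha_1,\dots,\alpha_n\in\mathbb C$ one has $\sum_{i,j}\overline{\alpha_i}\alpha_jk(\gamma_i,\gamma_j)\ge0$. The kernel is supported in a tube if its support is a tube. *)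

theory Defs
  imports "HOL-Probability.Probability"
begin

section \<open>Topological groupoids\<close>

text \<open>
  The set of arrows is the underlying set of the topology; the unit space is the subset
  \<open>grng G ` arrows G\<close> of the arrows, with the subspace topology. The product \<open>gmult G \<gamma> \<eta>\<close> is only meaningful
  if \<open>gsrc G \<gamma> = grng G \<eta>\<close>.
\<close>

record 'g groupoid =
  gtop :: "'g topology"
  grng :: "'g \<Rightarrow> 'g"
  gsrc :: "'g \<Rightarrow> 'g"
  ginv :: "'g \<Rightarrow> 'g"
  gmult :: "'g \<Rightarrow> 'g \<Rightarrow> 'g"

definition arrows :: "'g groupoid \<Rightarrow> 'g set" where
  "arrows G = topspace (gtop G)"

definition units :: "'g groupoid \<Rightarrow> 'g set" where
  "units G = grng G ` arrows G"

definition unit_space :: "'g groupoid \<Rightarrow> 'g topology" where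
  "unit_space G = subtopology (gtop G) (units G)"

definition fibre :: "'g groupoid \<Rightarrow> 'g \<Rightarrow> 'g set" where
  "fibre G x = {\<gamma> \<in> arrows G. grng G \<gamma> = x}"

definition composable :: "'g groupoid \<Rightarrow> ('g \<times> 'g) set" where
  "composable G = {(\<gamma>, \<eta>). \<gamma> \<in> arrows G \<and> \<eta> \<in> arrows G \<and> gsrc G \<gamma> = grng G \<eta>}"

definition is_groupoid :: "'g groupoid \<Rightarrow> bool" where
  "is_groupoid G \<longleftrightarrow>
     (\<forall>\<gamma>\<in>arrows G. grng G \<gamma> \<in> arrows G \<and> gsrc G \<gamma> \<in> arrows G \<and> ginv G \<gamma> \<in> arrows G) \<and>
     (\<forall>\<gamma>\<in>arrows G. grng G (grng G \<gamma>) = grng G \<gamma> \<and> gsrc G (grng G \<gamma>) = grng G \<gamma> \<and>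
                 grng G (gsrc G \<gamma>) = gsrc G \<gamma> \<and> gsrc G (gsrc G \<gamma>) = gsrc G \<gamma>) \<and>
     (\<forall>(\<gamma>, \<eta>)\<in>composable G. gmult G \<gamma> \<eta> \<in> arrows G \<and>
                 grng G (gmult G \<gamma> \<eta>) = grng G \<gamma> \<and> gsrc G (gmult G \<gamma> \<eta>) = gsrc G \<eta>) \<and>
     (\<forall>\<gamma> \<eta> \<zeta>. (\<gamma>, \<eta>) \<in> composable G \<and> (\<eta>, \<zeta>) \<in> composable G \<longrightarrow>
                 gmult G (gmult G \<gamma> \<eta>) \<zeta> = gmult G \<gamma> (gmult G \<eta> \<zeta>)) \<and>
     (\<forall>\<gamma>\<in>arrows G. gmult G (grng G \<gamma>) \<gamma> = \<gamma> \<and> gmult G \<gamma> (gsrc G \<gamma>) = \<gamma>) \<and>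
     (\<forall>\<gamma>\<in>arrows G. grng G (ginv G \<gamma>) = gsrc G \<gamma> \<and> gsrc G (ginv G \<gamma>) = grng G \<gamma> \<and>
                 gmult G (ginv G \<gamma>) \<gamma> = gsrc G \<gamma> \<and> gmult G \<gamma> (ginv G \<gamma>) = grng G \<gamma>)"

definition locally_compact_groupoid :: "'g groupoid \<Rightarrow> bool" where
  "locally_compact_groupoid G \<longleftrightarrow>
     is_groupoid G \<and>
     locally_compact_space (gtop G) \<and> Hausdorff_space (gtop G) \<and>
     continuous_map (gtop G) (gtop G) (grng G) \<and>
     continuous_map (gtop G) (gtop G) (gsrc G) \<and>
     continuous_map (gtop G) (gtop G) (ginv G) \<and>
     continuous_map (subtopology (prod_topology (gtop G) (gtop G)) (composable G)) (gtop G)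
       (\<lambda>(\<gamma>, \<eta>). gmult G \<gamma> \<eta>)"

definition local_homeomorphism :: "'a topology \<Rightarrow> 'b topology \<Rightarrow> ('a \<Rightarrow> 'b) \<Rightarrow> bool" where
  "local_homeomorphism X Y f \<longleftrightarrow>
     (\<forall>x\<in>topspace X. \<exists>U. openin X U \<and> x \<in> U \<and> openin Y (f ` U) \<and>
        homeomorphic_map (subtopology X U) (subtopology Y (f ` U)) f)"

definition etale_groupoid :: "'g groupoid \<Rightarrow> bool" where
  "etale_groupoid G \<longleftrightarrow>
     locally_compact_groupoid G \<and> local_homeomorphism (gtop G) (unit_space G) (grng G)"


section \<open>Amenable groupoids\<close>

definition fibre_space :: "'g groupoid \<Rightarrow> 'g \<Rightarrow> 'g topology" where
  "fibre_space G x = subtopology (gtop G) (fibre G x)"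

definition fibre_borel :: "'g groupoid \<Rightarrow> 'g \<Rightarrow> 'g measure" where
  "fibre_borel G x = sigma (topspace (fibre_space G x)) {U. openin (fibre_space G x) U}"

text \<open>
  As usual on locally compact spaces, probability measures are Radon: inner regular with respect
  to compact sets. For \<open>Y \<rtimes> G\<close> with \<open>G\<close> second countable etale the fibres are countable discrete and
  this is automatic.
\<close>

definition fibre_prob_measure :: "'g groupoid \<Rightarrow> 'g \<Rightarrow> 'g measure \<Rightarrow> bool" where
  "fibre_prob_measure G x \<mu> \<longleftrightarrow>
     prob_space \<mu> \<and> sets \<mu> = sets (fibre_borel G x) \<and>
     (\<forall>A\<in>sets \<mu>. emeasure \<mu> A = (SUP K\<in>{K. compactin (fibre_space G x) K \<and> K \<subseteq> A}. emeasure \<mu> K))"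

definition Cc :: "'a topology \<Rightarrow> ('a \<Rightarrow> complex) set" where
  "Cc X = {f. continuous_map X euclidean f \<and>
              compactin X (X closure_of {x \<in> topspace X. f x \<noteq> 0})}"

definition continuous_prob_systems :: "'g groupoid \<Rightarrow> ('g \<Rightarrow> 'g measure) set" where
  "continuous_prob_systems G =
     {m. (\<forall>x\<in>units G. fibre_prob_measure G x (m x)) \<and>
         (\<forall>f\<in>Cc (gtop G). continuous_map (unit_space G) euclidean (\<lambda>x. \<integral>\<gamma>. f \<gamma> \<partial>(m x)))}"

definition translate_measure :: "'g groupoid \<Rightarrow> 'g \<Rightarrow> 'g measure \<Rightarrow> 'g measure" where
  "translate_measure G \<gamma> \<mu> = distr \<mu> (fibre_borel G (grng G \<gamma>)) (gmult G \<gamma>)"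

text \<open>The total variation norm of \<open>\<mu> - \<nu>\<close>, for finite measures on the same \<open>\<sigma>\<close>-algebra.\<close>

definition tv_dist :: "'a measure \<Rightarrow> 'a measure \<Rightarrow> real" where
  "tv_dist \<mu> \<nu> =
     (SUP P\<in>{P. finite P \<and> P \<subseteq> sets \<mu> \<and> partition_on (space \<mu>) P}.
        \<Sum>A\<in>P. \<bar>measure \<mu> A - measure \<nu> A\<bar>)"

text \<open>
  A net \<open>(m\<^sub>i)\<close> of continuous systems of probability measures is given by its filter of tails, a proper
  filter on the set of all such systems. Every proper filter there arises from a net, so this
  covers nets over arbitrary directed sets.
\<close>

definition amenable_groupoid :: "'g groupoid \<Rightarrow> bool" where
  "amenable_groupoid G \<longleftrightarrow>
     (\<exists>F. F \<noteq> bot \<and> F \<le> principal (continuous_prob_systems G) \<and>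
        (\<forall>K. compactin (gtop G) K \<longrightarrow>
           uniform_limit K
             (\<lambda>m \<gamma>. tv_dist (translate_measure G \<gamma> (m (gsrc G \<gamma>))) (m (grng G \<gamma>))) (\<lambda>_. 0) F))"


section \<open>Groupoid spaces and amenability at infinity\<close>

definition is_fibre_space :: "'x topology \<Rightarrow> 'y topology \<Rightarrow> ('y \<Rightarrow> 'x) \<Rightarrow> bool" where
  "is_fibre_space X Y p \<longleftrightarrow>
     locally_compact_space Y \<and> Hausdorff_space Y \<and>
     continuous_map Y X p \<and> p ` topspace Y = topspace X"

definition fibrewise_compact :: "'x topology \<Rightarrow> 'y topology \<Rightarrow> ('y \<Rightarrow> 'x) \<Rightarrow> bool" where
  "fibrewise_compact X Y p \<longleftrightarrow>
     (\<forall>K. compactin X K \<longrightarrow> compactin Y {y \<in> topspace Y. p y \<in> K})"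

definition gspace ::
  "'g groupoid \<Rightarrow> 'y topology \<Rightarrow> ('y \<Rightarrow> 'g) \<Rightarrow> ('g \<Rightarrow> 'y \<Rightarrow> 'y) \<Rightarrow> bool" where
  "gspace G Y p act \<longleftrightarrow>
     is_fibre_space (unit_space G) Y p \<and>
     continuous_map (subtopology (prod_topology (gtop G) Y) {(\<gamma>, y). gsrc G \<gamma> = p y}) Y
       (\<lambda>(\<gamma>, y). act \<gamma> y) \<and>
     (\<forall>\<gamma>\<in>arrows G. \<forall>y\<in>topspace Y. gsrc G \<gamma> = p y \<longrightarrow> p (act \<gamma> y) = grng G \<gamma>) \<and>
     (\<forall>y\<in>topspace Y. act (p y) y = y) \<and>
     (\<forall>\<gamma>\<^sub>2 \<gamma>\<^sub>1. \<forall>y\<in>topspace Y. (\<gamma>\<^sub>2, \<gamma>\<^sub>1) \<in> composable G \<and> gsrc G \<gamma>\<^sub>1 = p y \<longrightarrow>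
        act (gmult G \<gamma>\<^sub>2 \<gamma>\<^sub>1) y = act \<gamma>\<^sub>2 (act \<gamma>\<^sub>1 y))"

text \<open>
  The unit space \<open>Y\<close> of \<open>Y \<rtimes> G\<close> appears as the set of units \<open>(y, p y)\<close>, to which it is homeomorphic.
\<close>

definition semidirect ::
  "'g groupoid \<Rightarrow> 'y topology \<Rightarrow> ('y \<Rightarrow> 'g) \<Rightarrow> ('g \<Rightarrow> 'y \<Rightarrow> 'y) \<Rightarrow> ('y \<times> 'g) groupoid" where
  "semidirect G Y p act =
     \<lparr> gtop = subtopology (prod_topology Y (gtop G)) {(y, \<gamma>). p y = grng G \<gamma>},
       grng = (\<lambda>(y, \<gamma>). (y, p y)),
       gsrc = (\<lambda>(y, \<gamma>). (act (ginv G \<gamma>) y, p (act (ginv G \<gamma>) y))),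
       ginv = (\<lambda>(y, \<gamma>). (act (ginv G \<gamma>) y, ginv G \<gamma>)),
       gmult = (\<lambda>(y, \<gamma>) (z, \<eta>). (y, gmult G \<gamma> \<eta>)) \<rparr>"

definition amenable_gspace ::
  "'g groupoid \<Rightarrow> 'y topology \<Rightarrow> ('y \<Rightarrow> 'g) \<Rightarrow> ('g \<Rightarrow> 'y \<Rightarrow> 'y) \<Rightarrow> bool" where
  "amenable_gspace G Y p act \<longleftrightarrow> gspace G Y p act \<and> amenable_groupoid (semidirect G Y p act)"

text \<open>
  HOL cannot quantify over types inside a formula, so the type \<open>'y\<close> of the points of the
  \<open>G\<close>-space \<open>Y\<close> is a parameter. The type \<open>('g \<Rightarrow> real) \<Rightarrow> real\<close> is large enough for \<open>G\<close> with arrows in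
  \<open>'g\<close>: in any \<open>Y\<close> as required, the closure of \<open>G \<sigma>(X)\<close> is again as required, and a Hausdorff space
  with a dense subset of cardinality at most \<open>\<kappa>\<close> has at most \<open>2 ^ (2 ^ \<kappa>)\<close> points.
\<close>

definition strongly_amenable_at_infinity :: "'y itself \<Rightarrow> 'g groupoid \<Rightarrow> bool" where
  "strongly_amenable_at_infinity T G \<longleftrightarrow>
     (\<exists>(Y :: 'y topology) p act \<sigma>.
        amenable_gspace G Y p act \<and> fibrewise_compact (unit_space G) Y p \<and>
        continuous_map (unit_space G) Y \<sigma> \<and> (\<forall>x\<in>units G. p (\<sigma> x) = x))"


section \<open>Kernels and tubes\<close>

definition rprod :: "'g groupoid \<Rightarrow> ('g \<times> 'g) set" where
  "rprod G = {(\<gamma>, \<gamma>\<^sub>1). \<gamma> \<in> arrows G \<and> \<gamma>\<^sub>1 \<in> arrows G \<and> grng G \<gamma> = grng G \<gamma>\<^sub>1}"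

definition rprod_space :: "'g groupoid \<Rightarrow> ('g \<times> 'g) topology" where
  "rprod_space G = subtopology (prod_topology (gtop G) (gtop G)) (rprod G)"

definition relatively_compact_in :: "'a topology \<Rightarrow> 'a set \<Rightarrow> bool" where
  "relatively_compact_in X A \<longleftrightarrow> A \<subseteq> topspace X \<and> compactin X (X closure_of A)"

definition tube :: "'g groupoid \<Rightarrow> ('g \<times> 'g) set \<Rightarrow> bool" where
  "tube G A \<longleftrightarrow>
     A \<subseteq> rprod G \<and> relatively_compact_in (gtop G) ((\<lambda>(\<gamma>, \<gamma>\<^sub>1). gmult G (ginv G \<gamma>) \<gamma>\<^sub>1) ` A)"

definition positive_definite_kernel :: "'g groupoid \<Rightarrow> ('g \<times> 'g \<Rightarrow> complex) \<Rightarrow> bool" where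
  "positive_definite_kernel G k \<longleftrightarrow>
     (\<forall>x\<in>units G. \<forall>(n::nat) (\<gamma> :: nat \<Rightarrow> 'g) (\<alpha> :: nat \<Rightarrow> complex).
        (\<forall>i<n. \<gamma> i \<in> fibre G x) \<longrightarrow>
        (\<Sum>i<n. \<Sum>j<n. cnj (\<alpha> i) * \<alpha> j * k (\<gamma> i, \<gamma> j)) \<in> \<real>\<^sub>\<ge>\<^sub>0)"

definition supported_in_tube :: "'g groupoid \<Rightarrow> ('g \<times> 'g \<Rightarrow> complex) \<Rightarrow> bool" where
  "supported_in_tube G k \<longleftrightarrow> tube G (rprod_space G closure_of {z \<in> rprod G. k z \<noteq> 0})"

end

theory Submission
  imports Defs
begin

text \<open>
  Write a pair \<open>(\<gamma>, \<gamma> c)\<close> of \<open>G *\<^sub>r G\<close> in the coordinates \<open>(\<gamma>, c)\<close> with \<open>s \<gamma> = r c\<close>; a tube is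
  then a set on which \<open>c\<close> stays in a compact set. Both conditions are equivalent to the existence,
  for every compact \<open>K\<close> and every \<open>\<epsilon> > 0\<close>, of a continuous function \<open>a \<gamma> c\<close> vanishing for \<open>c\<close> outside
  a compact set, with \<open>\<Sum>\<^sub>c (a \<gamma> c)\<^sup>2 \<le> 1\<close> and \<open>\<Sum>\<^sub>c a \<gamma> c * a (\<gamma> d) (d\<inverse> c) \<ge> 1 - \<epsilon>\<close> for \<open>d \<in> K\<close>.

  Given an amenable \<open>Y\<close> with section \<open>\<sigma>\<close> and an almost invariant system \<open>m\<close> on \<open>Y \<rtimes> G\<close>, let \<open>a \<gamma> c\<close> be
  the square root of \<open>f c\<close> times the mass of \<open>c\<close> under \<open>m\<close> at the point \<open>\<gamma>\<inverse> \<sigma> (r \<gamma>)\<close>, for a cutoff \<open>f\<close>.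
  The Gram kernels of the vectors \<open>\<zeta> \<mapsto> a \<gamma> (\<gamma>\<inverse> \<zeta>)\<close> are the kernels of (ii).

  Conversely the real part of a positive definite kernel supported in a tube is, on each range
  fibre, a bounded positive matrix with finite rows. A polynomial approximating its square root is,
  up to a cutoff, again supported in a tube, and its rows give \<open>a\<close>.

  Finally, given a sequence \<open>a\<^sub>n\<close>, let \<open>Y\<close> be the space of all sequences of kernels on a single range
  fibre satisfying the same supports and inequalities as the \<open>a\<^sub>n\<close>. These conditions are closed
  and invariant under translation, so \<open>Y\<close> is a fibrewise compact \<open>G\<close>-space; the restrictions of
  the \<open>a\<^sub>n\<close> form a continuous section, and the squares of the kernel entries at the unit form the
  almost invariant systems of measures on \<open>Y \<rtimes> G\<close>.
\<close>

section \<open>Approximate square roots of positive matrices with finite rows\<close>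

text \<open>The intermediate condition mentions neither a space Y nor a sequence, so it serves any
  type of points of Y and can be instantiated along any compact exhaustion. Two obstacles shape the
  rest. First, a square root obtained from operator theory on the separate range fibres would be
  neither visibly continuous nor supported in a tube. An iteration built from sums and compositions
  of kernels keeps control of both, because all matrices involved have finite rows. It starts from 1
  - T, and the identity kernel is supported on the whole unit space, which need not be compact;
  hence supports are only asked to be proper over the unit space until a diagonal cutoff restores
  compactness. Second, Y has to live in a type fixed in advance. It is cut out of the functions with
  values in [-1, 1] on range fibres: compactness comes from an argument of Tychonoff type over a
  varying base point, and measures can be read off a point of Y because that point is itself a
  sequence of kernels satisfying the estimates.\<close>

definition row_finite :: "'i set \<Rightarrow> ('i \<Rightarrow> 'i \<Rightarrow> real) \<Rightarrow> bool" where
  "row_finite I A \<longleftrightarrow> (\<forall>i\<in>I. finite {j \<in> I. A i j \<noteq> 0})"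

definition sym_matrix :: "'i set \<Rightarrow> ('i \<Rightarrow> 'i \<Rightarrow> real) \<Rightarrow> bool" where
  "sym_matrix I A \<longleftrightarrow> (\<forall>i\<in>I. \<forall>j\<in>I. A i j = A j i)"

text \<open>Summing over the nonzero entries of row \<open>i\<close> of \<open>A\<close> gives a
  finite sum for row-finite \<open>A\<close>, whatever \<open>B\<close> is.\<close>

definition mat_comp :: "'i set \<Rightarrow> ('i \<Rightarrow> 'i \<Rightarrow> real) \<Rightarrow> ('i \<Rightarrow> 'i \<Rightarrow> real) \<Rightarrow> 'i \<Rightarrow> 'i \<Rightarrow> real" where
  "mat_comp I A B i k = (\<Sum>j\<in>{j \<in> I. A i j \<noteq> 0}. A i j * B j k)"

text \<open>The operator norm on l2(I) is at most \<open>c\<close>, tested on finite sections only: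
  input supported in \<open>F\<close>, output truncated to \<open>F'\<close>. No space of square
  summable families is involved.\<close>

definition op_bound :: "'i set \<Rightarrow> real \<Rightarrow> ('i \<Rightarrow> 'i \<Rightarrow> real) \<Rightarrow> bool" where
  "op_bound I c A \<longleftrightarrow> (\<forall>v F F'. finite F \<and> F \<subseteq> I \<and> finite F' \<and> F' \<subseteq> I \<longrightarrow>
     L2_set (\<lambda>i. \<Sum>j\<in>F. A i j * v j) F' \<le> c * L2_set v F)"

lemma op_boundD:
  "op_bound I c A \<Longrightarrow> finite F \<Longrightarrow> F \<subseteq> I \<Longrightarrow> finite F' \<Longrightarrow> F' \<subseteq> I \<Longrightarrow>
     L2_set (\<lambda>i. \<Sum>j\<in>F. A i j * v j) F' \<le> c * L2_set v F"
  by (simp add: op_bound_def)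

lemma mat_comp_eq:
  assumes "finite J" "J \<subseteq> I" "{j \<in> I. A i j \<noteq> 0} \<subseteq> J"
  shows "mat_comp I A B i k = (\<Sum>j\<in>J. A i j * B j k)"
  unfolding mat_comp_def using assms by (intro sum.mono_neutral_left) auto

text \<open>The rows of \<open>A\<close> indexed by \<open>F'\<close> meet only a finite set
  \<open>S\<close> of intermediate indices, so \<open>B\<close> is bounded from \<open>F\<close> to
  \<open>S\<close> and then \<open>A\<close> from \<open>S\<close> to \<open>F'\<close>.\<close>

lemma op_bound_comp:
  assumes A: "row_finite I A" "op_bound I a A" and B: "op_bound I b B" and a: "0 \<le> a"
  shows "op_bound I (a * b) (mat_comp I A B)"
  unfolding op_bound_def
proof (intro allI impI)
  fix v :: "'a \<Rightarrow> real" and F F' assume F: "finite F \<and> F \<subseteq> I \<and> finite F' \<and> F' \<subseteq> I"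
  define S where "S = (\<Union>i\<in>F'. {j \<in> I. A i j \<noteq> 0})"
  have S: "finite S" "S \<subseteq> I" using F A(1) by (auto simp: S_def row_finite_def)
  define w where "w j = (\<Sum>k\<in>F. B j k * v k)" for j
  have "(\<Sum>k\<in>F. mat_comp I A B i k * v k) = (\<Sum>j\<in>S. A i j * w j)" if i: "i \<in> F'" for i
  proof -
    have "(\<Sum>k\<in>F. mat_comp I A B i k * v k) = (\<Sum>k\<in>F. \<Sum>j\<in>S. A i j * B j k * v k)"
      using S i by (intro sum.cong refl) (subst mat_comp_eq[of S], auto simp: S_def sum_distrib_right)
    also have "\<dots> = (\<Sum>j\<in>S. A i j * w j)"
      by (subst sum.swap) (simp add: w_def sum_distrib_left mult.assoc)
    finally show ?thesis .
  qed
  then have "L2_set (\<lambda>i. \<Sum>k\<in>F. mat_comp I A B i k * v k) F' = L2_set (\<lambda>i. \<Sum>j\<in>S. A i j * w j) F'"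
    by (intro L2_set_cong) auto
  also have "\<dots> \<le> a * L2_set w S" using op_boundD[OF A(2) S] F by auto
  also have "\<dots> \<le> a * (b * L2_set v F)"
    unfolding w_def using op_boundD[OF B, of F S] F S a by (intro mult_left_mono) auto
  finally show "L2_set (\<lambda>i. \<Sum>k\<in>F. mat_comp I A B i k * v k) F' \<le> a * b * L2_set v F"
    by (simp add: mult.assoc)
qed

lemma op_bound_add:
  assumes "op_bound I a A" "op_bound I b B"
  shows "op_bound I (a + b) (\<lambda>i j. A i j + B i j)"
  unfolding op_bound_def
proof (intro allI impI)
  fix v :: "'a \<Rightarrow> real" and F F' assume F: "finite F \<and> F \<subseteq> I \<and> finite F' \<and> F' \<subseteq> I"
  have "L2_set (\<lambda>i. \<Sum>j\<in>F. (A i j + B i j) * v j) F' =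
    L2_set (\<lambda>i. (\<Sum>j\<in>F. A i j * v j) + (\<Sum>j\<in>F. B i j * v j)) F'"
    by (simp add: distrib_right sum.distrib)
  also have "\<dots> \<le> L2_set (\<lambda>i. \<Sum>j\<in>F. A i j * v j) F' + L2_set (\<lambda>i. \<Sum>j\<in>F. B i j * v j) F'"
    by (rule L2_set_triangle_ineq)
  also have "\<dots> \<le> a * L2_set v F + b * L2_set v F"
    using F assms by (intro add_mono op_boundD) auto
  finally show "L2_set (\<lambda>i. \<Sum>j\<in>F. (A i j + B i j) * v j) F' \<le> (a + b) * L2_set v F"
    by (simp add: algebra_simps)
qed

lemma op_bound_scale:
  assumes "op_bound I a A" "0 \<le> c"
  shows "op_bound I (c * a) (\<lambda>i j. c * A i j)"
  unfolding op_bound_def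
proof (intro allI impI)
  fix v :: "'a \<Rightarrow> real" and F F' assume F: "finite F \<and> F \<subseteq> I \<and> finite F' \<and> F' \<subseteq> I"
  have "L2_set (\<lambda>i. \<Sum>j\<in>F. c * A i j * v j) F' = c * L2_set (\<lambda>i. \<Sum>j\<in>F. A i j * v j) F'"
    by (simp add: L2_set_right_distrib[OF assms(2)] sum_distrib_left mult.assoc)
  also have "\<dots> \<le> c * (a * L2_set v F)"
    using F assms by (intro mult_left_mono op_boundD) auto
  finally show "L2_set (\<lambda>i. \<Sum>j\<in>F. c * A i j * v j) F' \<le> c * a * L2_set v F"
    by (simp add: algebra_simps)
qed

lemma op_bound_cong:
  assumes "op_bound I a A" "\<And>i j. i \<in> I \<Longrightarrow> j \<in> I \<Longrightarrow> A i j = B i j"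
  shows "op_bound I a B"
  unfolding op_bound_def
proof (intro allI impI)
  fix v :: "'a \<Rightarrow> real" and F F' assume F: "finite F \<and> F \<subseteq> I \<and> finite F' \<and> F' \<subseteq> I"
  have "L2_set (\<lambda>i. \<Sum>j\<in>F. B i j * v j) F' = L2_set (\<lambda>i. \<Sum>j\<in>F. A i j * v j) F'"
    using F assms(2) by (intro L2_set_cong sum.cong refl) (auto simp: subset_iff)
  then show "L2_set (\<lambda>i. \<Sum>j\<in>F. B i j * v j) F' \<le> a * L2_set v F"
    using op_boundD[OF assms(1)] F by auto
qed

lemma op_bound_entry:
  assumes "op_bound I c A" "i \<in> I" "k \<in> I"
  shows "\<bar>A i k\<bar> \<le> c"
  using op_boundD[OF assms(1), of "{k}" "{i}" "\<lambda>_. 1"] assms(2,3) by simp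

text \<open>If 0 \<le> T \<le> 1 then T^2 \<le> T as quadratic forms, whence |v - Tv|^2 = |v|^2 - 2
  <v, Tv> + |Tv|^2 \<le> |v|^2. The upper bound T \<le> 1 comes from the absolute row sums.\<close>

lemma contraction_one_minus:
  assumes sym: "sym_matrix I T" and fin: "row_finite I T"
    and psd: "\<And>F v. finite F \<Longrightarrow> F \<subseteq> I \<Longrightarrow> 0 \<le> (\<Sum>i\<in>F. \<Sum>j\<in>F. v i * v j * T i j)"
    and row: "\<And>F i. finite F \<Longrightarrow> F \<subseteq> I \<Longrightarrow> i \<in> I \<Longrightarrow> (\<Sum>j\<in>F. \<bar>T i j\<bar>) \<le> 1"
  shows "op_bound I 1 (\<lambda>i j. (if i = j then 1 else 0) - T i j)"
  unfolding op_bound_def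
proof (intro allI impI)
  fix v :: "'a \<Rightarrow> real" and F F' assume F: "finite F \<and> F \<subseteq> I \<and> finite F' \<and> F' \<subseteq> I"
  define H where "H = F \<union> F' \<union> (\<Union>j\<in>F. {i \<in> I. T j i \<noteq> 0})"
  have H: "finite H" "H \<subseteq> I" using F fin by (auto simp: H_def row_finite_def)
  define v' where "v' i = (if i \<in> F then v i else 0)" for i
  define w where "w i = (\<Sum>j\<in>H. T i j * v' j)" for i
  have TS: "T i j = T j i" if "i \<in> H" "j \<in> H" for i j using sym H that by (auto simp: sym_matrix_def)
  \<comment> \<open>Schur test: split each product by the arithmetic-geometric mean inequality and
    use that rows and columns of a symmetric matrix have the same sums.\<close>
  have up: "(\<Sum>i\<in>H. \<Sum>j\<in>H. x i * x j * T i j) \<le> (\<Sum>i\<in>H. (x i)\<^sup>2)" for x :: "'a \<Rightarrow> real"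
  proof -
    have p: "x i * x j * T i j \<le> \<bar>T i j\<bar> * (x i)\<^sup>2 / 2 + \<bar>T i j\<bar> * (x j)\<^sup>2 / 2" for i j
    proof -
      have "x i * x j * T i j \<le> \<bar>x i * x j * T i j\<bar>" by (rule abs_ge_self)
      also have "\<dots> = \<bar>T i j\<bar> * \<bar>x i * x j\<bar>" by (simp add: abs_mult)
      also have "\<dots> \<le> \<bar>T i j\<bar> * (((x i)\<^sup>2 + (x j)\<^sup>2) / 2)"
      proof (rule mult_left_mono)
        have "0 \<le> (x i - x j)\<^sup>2" "0 \<le> (x i + x j)\<^sup>2" by simp_all
        then show "\<bar>x i * x j\<bar> \<le> ((x i)\<^sup>2 + (x j)\<^sup>2) / 2"
          by (simp add: abs_if power2_eq_square algebra_simps)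
      qed simp
      finally show ?thesis by (simp add: algebra_simps add_divide_distrib)
    qed
    have "(\<Sum>i\<in>H. \<Sum>j\<in>H. x i * x j * T i j) \<le> (\<Sum>i\<in>H. \<Sum>j\<in>H. \<bar>T i j\<bar> * (x i)\<^sup>2 / 2 + \<bar>T i j\<bar> * (x j)\<^sup>2 / 2)"
      by (intro sum_mono p)
    also have "\<dots> = (\<Sum>i\<in>H. \<Sum>j\<in>H. \<bar>T i j\<bar> * (x i)\<^sup>2 / 2) + (\<Sum>i\<in>H. \<Sum>j\<in>H. \<bar>T i j\<bar> * (x j)\<^sup>2 / 2)"
      by (simp add: sum.distrib)
    also have "(\<Sum>i\<in>H. \<Sum>j\<in>H. \<bar>T i j\<bar> * (x j)\<^sup>2 / 2) = (\<Sum>i\<in>H. \<Sum>j\<in>H. \<bar>T i j\<bar> * (x i)\<^sup>2 / 2)"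
      by (subst sum.swap) (intro sum.cong refl, simp add: TS)
    also have "(\<Sum>i\<in>H. \<Sum>j\<in>H. \<bar>T i j\<bar> * (x i)\<^sup>2 / 2) + (\<Sum>i\<in>H. \<Sum>j\<in>H. \<bar>T i j\<bar> * (x i)\<^sup>2 / 2)
      = (\<Sum>i\<in>H. (\<Sum>j\<in>H. \<bar>T i j\<bar>) * (x i)\<^sup>2)"
      by (simp flip: sum_divide_distrib sum_distrib_right)
    also have "\<dots> \<le> (\<Sum>i\<in>H. 1 * (x i)\<^sup>2)"
      using row H by (intro sum_mono mult_right_mono) auto
    finally show ?thesis by simp
  qed
  have wv: "(\<Sum>i\<in>H. \<Sum>j\<in>H. v' i * v' j * T i j) = (\<Sum>i\<in>H. v' i * w i)"
    by (simp add: w_def sum_distrib_left mult_ac)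
  have ww: "(\<Sum>i\<in>H. \<Sum>j\<in>H. w i * v' j * T i j) = (\<Sum>i\<in>H. (w i)\<^sup>2)"
    by (intro sum.cong refl, unfold power2_eq_square, subst (3) w_def) (simp add: sum_distrib_left mult_ac)
  have ww': "(\<Sum>i\<in>H. \<Sum>j\<in>H. v' i * w j * T i j) = (\<Sum>i\<in>H. (w i)\<^sup>2)"
    unfolding ww[symmetric] by (subst sum.swap) (intro sum.cong refl, simp add: TS)
  \<comment> \<open>Positivity tested on \<open>v' - w\<close>, where w = T v', together with
    \<open>up\<close> for \<open>w\<close>, is what yields |Tv|^2 \<le> <v, Tv>.\<close>
  have "0 \<le> (\<Sum>i\<in>H. \<Sum>j\<in>H. (v' i - w i) * (v' j - w j) * T i j)" by (rule psd) (use H in auto)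
  also have "\<dots> = (\<Sum>i\<in>H. \<Sum>j\<in>H. v' i * v' j * T i j) - (\<Sum>i\<in>H. \<Sum>j\<in>H. v' i * w j * T i j)
     - (\<Sum>i\<in>H. \<Sum>j\<in>H. w i * v' j * T i j) + (\<Sum>i\<in>H. \<Sum>j\<in>H. w i * w j * T i j)"
    by (simp add: algebra_simps sum.distrib sum_subtractf)
  also have "\<dots> \<le> (\<Sum>i\<in>H. v' i * w i) - (\<Sum>i\<in>H. (w i)\<^sup>2)"
    using up[of w] unfolding wv ww ww' by simp
  finally have le: "(\<Sum>i\<in>H. (w i)\<^sup>2) \<le> (\<Sum>i\<in>H. v' i * w i)" by simp
  have ge: "0 \<le> (\<Sum>i\<in>H. (w i)\<^sup>2)" by (intro sum_nonneg) simp
  have "(\<Sum>i\<in>H. (v' i - w i)\<^sup>2) = (\<Sum>i\<in>H. (v' i)\<^sup>2) - 2 * (\<Sum>i\<in>H. v' i * w i) + (\<Sum>i\<in>H. (w i)\<^sup>2)"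
    by (simp add: power2_diff sum.distrib sum_subtractf sum_distrib_left mult_ac)
  also have "\<dots> \<le> (\<Sum>i\<in>H. (v' i)\<^sup>2)" using le ge by simp
  finally have main: "(\<Sum>i\<in>H. (v' i - w i)\<^sup>2) \<le> (\<Sum>i\<in>H. (v' i)\<^sup>2)" .
  have w: "w i = (\<Sum>j\<in>F. T i j * v j)" for i
    unfolding w_def v'_def using H by (intro sum.mono_neutral_cong_right) (auto simp: H_def)
  have "(\<Sum>i\<in>F'. (\<Sum>j\<in>F. ((if i = j then 1 else 0) - T i j) * v j)\<^sup>2) = (\<Sum>i\<in>F'. (v' i - w i)\<^sup>2)"
    using F by (intro sum.cong refl)
      (auto simp: left_diff_distrib sum_subtractf w v'_def if_distrib[where f = "\<lambda>x. x * _"] cong: if_cong)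
  also have "\<dots> \<le> (\<Sum>i\<in>H. (v' i - w i)\<^sup>2)"
    using H by (intro sum_mono2) (auto simp: H_def)
  also have "\<dots> \<le> (\<Sum>i\<in>H. (v' i)\<^sup>2)" by (rule main)
  also have "\<dots> = (\<Sum>i\<in>F. (v i)\<^sup>2)"
    using H by (intro sum.mono_neutral_cong_right) (auto simp: H_def v'_def)
  finally show "L2_set (\<lambda>i. \<Sum>j\<in>F. ((if i = j then 1 else 0) - T i j) * v j) F' \<le> 1 * L2_set v F"
    by (simp add: L2_set_def)
qed

text \<open>
  Visser's iteration: if \<open>S = 1 - T\<close> with \<open>0 \<le> T \<le> 1\<close>, then \<open>1 - U\<^sub>m\<close> converges to the square root of
  \<open>T\<close>. The scalar sequence \<open>visser_bound\<close> is the iteration for \<open>S = 1\<close>.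
\<close>

primrec visser :: "'i set \<Rightarrow> ('i \<Rightarrow> 'i \<Rightarrow> real) \<Rightarrow> nat \<Rightarrow> 'i \<Rightarrow> 'i \<Rightarrow> real" where
  "visser I S 0 = (\<lambda>i j. 0)"
| "visser I S (Suc m) = (\<lambda>i k. (S i k + mat_comp I (visser I S m) (visser I S m) i k) / 2)"

primrec visser_bound :: "nat \<Rightarrow> real" where
  "visser_bound 0 = 0"
| "visser_bound (Suc m) = (1 + (visser_bound m)\<^sup>2) / 2"

lemma visser_bound_range: "0 \<le> visser_bound m" "visser_bound m \<le> 1"
proof -
  have "0 \<le> visser_bound m \<and> visser_bound m \<le> 1"
    by (induction m) (auto simp: power_le_one)
  then show "0 \<le> visser_bound m" "visser_bound m \<le> 1" by auto
qed

lemma visser_bound_mono: "visser_bound m \<le> visser_bound (Suc m)"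
proof -
  have "0 \<le> (1 - visser_bound m)\<^sup>2" by simp
  then show ?thesis by (simp add: power2_eq_square algebra_simps)
qed

text \<open>A bounded increasing sequence converges, so its increments vanish. These increments are
  the error bound in \<open>visser_square\<close>.\<close>

lemma visser_bound_diff: "(\<lambda>m. visser_bound (Suc m) - visser_bound m) \<longlonglongrightarrow> 0"
proof -
  have "incseq visser_bound" using visser_bound_mono by (rule incseq_SucI)
  then obtain L where L: "visser_bound \<longlonglongrightarrow> L"
    using visser_bound_range(2) incseq_convergent[of visser_bound 1] by metis
  then have "(\<lambda>m. visser_bound (Suc m)) \<longlonglongrightarrow> L" by (rule LIMSEQ_Suc)
  from tendsto_diff[OF this L] show ?thesis by simp
qed

lemma row_finite_comp:
  assumes "row_finite I A" "row_finite I B" shows "row_finite I (mat_comp I A B)"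
  unfolding row_finite_def
proof
  fix i assume i: "i \<in> I"
  have "{k \<in> I. mat_comp I A B i k \<noteq> 0} \<subseteq> (\<Union>j\<in>{j \<in> I. A i j \<noteq> 0}. {k \<in> I. B j k \<noteq> 0})"
  proof
    fix k assume k: "k \<in> {k \<in> I. mat_comp I A B i k \<noteq> 0}"
    then obtain j where "j \<in> {j \<in> I. A i j \<noteq> 0}" "A i j * B j k \<noteq> 0"
      unfolding mat_comp_def using sum.not_neutral_contains_not_neutral by force
    then show "k \<in> (\<Union>j\<in>{j \<in> I. A i j \<noteq> 0}. {k \<in> I. B j k \<noteq> 0})" using k by auto
  qed
  moreover have "finite (\<Union>j\<in>{j \<in> I. A i j \<noteq> 0}. {k \<in> I. B j k \<noteq> 0})"
    using assms i by (auto simp: row_finite_def)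
  ultimately show "finite {k \<in> I. mat_comp I A B i k \<noteq> 0}" by (rule finite_subset)
qed

lemma sym_matrix_square:
  assumes "row_finite I A" "sym_matrix I A" shows "sym_matrix I (mat_comp I A A)"
  unfolding sym_matrix_def
proof (intro ballI)
  fix i k assume ik: "i \<in> I" "k \<in> I"
  define J where "J = {j \<in> I. A i j \<noteq> 0} \<union> {j \<in> I. A k j \<noteq> 0}"
  have J: "finite J" "J \<subseteq> I" using assms ik by (auto simp: J_def row_finite_def)
  have "mat_comp I A A i k = (\<Sum>j\<in>J. A i j * A j k)" by (rule mat_comp_eq) (use J in \<open>auto simp: J_def\<close>)
  also have "\<dots> = (\<Sum>j\<in>J. A k j * A j i)" 
    using J assms ik by (intro sum.cong refl) (auto simp: sym_matrix_def subset_iff)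
  also have "\<dots> = mat_comp I A A k i" by (rule mat_comp_eq[symmetric]) (use J in \<open>auto simp: J_def\<close>)
  finally show "mat_comp I A A i k = mat_comp I A A k i" .
qed

lemma row_finite_add_scale:
  assumes "row_finite I A" "row_finite I B" shows "row_finite I (\<lambda>i k. (A i k + B i k) / 2)"
  unfolding row_finite_def
proof
  fix i assume i: "i \<in> I"
  have "{j \<in> I. (A i j + B i j) / 2 \<noteq> 0} \<subseteq> {j \<in> I. A i j \<noteq> 0} \<union> {j \<in> I. B i j \<noteq> 0}" by auto
  then show "finite {j \<in> I. (A i j + B i j) / 2 \<noteq> 0}"
    using assms i by (auto simp: row_finite_def intro: finite_subset)
qed

lemma row_finite_visser: "row_finite I S \<Longrightarrow> row_finite I (visser I S m)"
  by (induction m) (auto intro: row_finite_comp row_finite_add_scale, simp add: row_finite_def)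

lemma sym_visser: "row_finite I S \<Longrightarrow> sym_matrix I S \<Longrightarrow> sym_matrix I (visser I S m)"
proof (induction m)
  case (Suc m)
  then have "sym_matrix I (mat_comp I (visser I S m) (visser I S m))"
    by (intro sym_matrix_square row_finite_visser)
  then show ?case using Suc by (auto simp: sym_matrix_def)
qed (simp add: sym_matrix_def)

lemma op_bound_half_sum:
  assumes "op_bound I a A" "op_bound I b B"
  shows "op_bound I ((a + b) / 2) (\<lambda>i k. (A i k + B i k) / 2)"
  using op_bound_scale[OF op_bound_add[OF assms], of "1/2"] by simp

text \<open>The scalar recursion is the triangle inequality and submultiplicativity applied to the
  matrix recursion with |S| \<le> 1.\<close>

lemma op_bound_visser:
  assumes S: "row_finite I S" "op_bound I 1 S"
  shows "op_bound I (visser_bound m) (visser I S m)"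
proof (induction m)
  case 0
  show ?case by (simp add: op_bound_def L2_set_def)
next
  case (Suc m)
  have "op_bound I (visser_bound m * visser_bound m) (mat_comp I (visser I S m) (visser I S m))"
    using S Suc by (intro op_bound_comp row_finite_visser visser_bound_range)
  from op_bound_half_sum[OF S(2) this] show ?case by (simp add: power2_eq_square)
qed

text \<open>Consecutive iterates V, W satisfy W^2 - V^2 = W (W - V) + (W - V) V, while the term S
  cancels. The same identity holds for the scalar sequence, so the norm estimates propagate by
  induction with exactly the scalar increments.\<close>

lemma op_bound_visser_diff:
  assumes S: "row_finite I S" "op_bound I 1 S"
  shows "op_bound I (visser_bound (Suc m) - visser_bound m) (\<lambda>i k. visser I S (Suc m) i k - visser I S m i k)"
proof (induction m)
  case 0
  have "op_bound I (1/2 * 1) (\<lambda>i j. 1/2 * S i j)" using S by (intro op_bound_scale) auto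
  then show ?case by (simp add: mat_comp_def)
next
  case (Suc m)
  define V where "V = visser I S m"
  define W where "W = visser I S (Suc m)"
  define D where "D i k = W i k - V i k" for i k
  have V: "row_finite I V" "op_bound I (visser_bound m) V"
    unfolding V_def using S by (auto intro: row_finite_visser op_bound_visser)
  have W: "row_finite I W" "op_bound I (visser_bound (Suc m)) W"
    unfolding W_def using S by (blast intro: row_finite_visser op_bound_visser)+
  have D: "op_bound I (visser_bound (Suc m) - visser_bound m) D"
    using Suc by (simp add: D_def[abs_def] V_def W_def)
  have rD: "row_finite I D"
    unfolding row_finite_def
  proof
    fix i assume i: "i \<in> I"
    have "{j \<in> I. D i j \<noteq> 0} \<subseteq> {j \<in> I. V i j \<noteq> 0} \<union> {j \<in> I. W i j \<noteq> 0}" by (auto simp: D_def)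
    then show "finite {j \<in> I. D i j \<noteq> 0}"
      using V W i by (auto simp: row_finite_def intro: finite_subset)
  qed
  have ob: "op_bound I ((visser_bound (Suc m) * (visser_bound (Suc m) - visser_bound m) + 
      (visser_bound (Suc m) - visser_bound m) * visser_bound m) / 2)
      (\<lambda>i k. (mat_comp I W D i k + mat_comp I D V i k) / 2)"
    using visser_bound_range[of "Suc m"] visser_bound_mono[of m]
    by (intro op_bound_half_sum op_bound_comp D V W rD) auto
  have eq: "(visser_bound (Suc m) * (visser_bound (Suc m) - visser_bound m) + 
      (visser_bound (Suc m) - visser_bound m) * visser_bound m) / 2 = 
      visser_bound (Suc (Suc m)) - visser_bound (Suc m)"
  proof -
    have "visser_bound (Suc (Suc m)) = (1 + (visser_bound (Suc m))\<^sup>2) / 2"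
      "(visser_bound m)\<^sup>2 = 2 * visser_bound (Suc m) - 1" by (simp_all add: field_simps)
    then show ?thesis by (simp only: power2_eq_square) (simp add: field_simps del: visser_bound.simps)
  qed
  have en: "(mat_comp I W D i k + mat_comp I D V i k) / 2 = visser I S (Suc (Suc m)) i k - visser I S (Suc m) i k"
    if ik: "i \<in> I" "k \<in> I" for i k
  proof -
    define J where "J = {j \<in> I. V i j \<noteq> 0} \<union> {j \<in> I. W i j \<noteq> 0}"
    have J: "finite J" "J \<subseteq> I" using V W ik by (auto simp: J_def row_finite_def)
    have "mat_comp I W D i k = (\<Sum>j\<in>J. W i j * D j k)" "mat_comp I D V i k = (\<Sum>j\<in>J. D i j * V j k)"
      "mat_comp I W W i k = (\<Sum>j\<in>J. W i j * W j k)" "mat_comp I V V i k = (\<Sum>j\<in>J. V i j * V j k)"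
      by (rule mat_comp_eq; use J in \<open>auto simp: J_def D_def\<close>)+
    then have "mat_comp I W D i k + mat_comp I D V i k = mat_comp I W W i k - mat_comp I V V i k"
      by (simp add: D_def algebra_simps sum.distrib sum_subtractf)
    moreover have "visser I S (Suc (Suc m)) i k = (S i k + mat_comp I W W i k) / 2"
      by (simp add: W_def)
    moreover have "visser I S (Suc m) i k = (S i k + mat_comp I V V i k) / 2" by (simp add: V_def)
    ultimately show ?thesis by (simp add: field_simps)
  qed
  show ?case by (rule op_bound_cong[OF ob[unfolded eq]]) (rule en)
qed

text \<open>With V the m-th iterate, (1 - V)^2 - (1 - S) = S - 2 V + V^2, which is twice the
  difference between the next iterate and V. The operator bound for that difference bounds each
  entry.\<close>

lemma visser_square:
  assumes S: "row_finite I S" "op_bound I 1 S" and ik: "i \<in> I" "k \<in> I"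
    and J: "finite J" "J \<subseteq> I" "i \<in> J" "k \<in> J" "{j \<in> I. visser I S m i j \<noteq> 0} \<subseteq> J"
  defines "P \<equiv> \<lambda>i j. (if i = j then 1 else 0) - visser I S m i j"
  shows "\<bar>(\<Sum>j\<in>J. P i j * P j k) - ((if i = k then 1 else 0) - S i k)\<bar> \<le> 2 * (visser_bound (Suc m) - visser_bound m)"
proof -
  define V where "V = visser I S m"
  have "mat_comp I V V i k = (\<Sum>j\<in>J. V i j * V j k)"
    by (rule mat_comp_eq) (use J in \<open>auto simp: V_def\<close>)
  moreover have "P i j * P j k = (if i = j then (if i = k then 1 else 0) else 0) - (if i = j then V i k else 0)
     - (if k = j then V i k else 0) + V i j * V j k" for j
    by (auto simp: P_def V_def algebra_simps)
  then have "(\<Sum>j\<in>J. P i j * P j k) = (if i = k then 1 else 0) - 2 * V i k + (\<Sum>j\<in>J. V i j * V j k)"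
    using J by (simp add: sum.distrib sum_subtractf)
  moreover have "visser I S (Suc m) i k = (S i k + mat_comp I V V i k) / 2" by (simp add: V_def)
  ultimately have "(\<Sum>j\<in>J. P i j * P j k) - ((if i = k then 1 else 0) - S i k) = 2 * (visser I S (Suc m) i k - V i k)"
    by simp
  then show ?thesis using op_bound_entry[OF op_bound_visser_diff[OF S] ik, of m] unfolding V_def
    by (simp add: abs_mult del: visser.simps visser_bound.simps)
qed

section \<open>Bundles of functions on the fibres of a local homeomorphism\<close>

text \<open>Around a witness (z0, e0) the condition holds on a product neighbourhood; since
  \<open>q\<close> is open, every z near z0 has a point of that neighbourhood in its fibre, so a
  witness persists.\<close>

lemma openin_exists_open_map:
  assumes \<pi>: "continuous_map Z X \<pi>" and q: "open_map E X q"
    and f: "continuous_map (subtopology (prod_topology Z E) {(z, e). \<pi> z = q e}) V (\<lambda>(z, e). f z e)"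
    and UO: "openin E U" "openin V W"
  shows "openin Z {z \<in> topspace Z. \<exists>e\<in>U. q e = \<pi> z \<and> f z e \<in> W}"
proof (subst openin_subopen, clarify)
  fix z0 e0 assume z0: "z0 \<in> topspace Z" "e0 \<in> U" "q e0 = \<pi> z0" "f z0 e0 \<in> W"
  let ?S = "subtopology (prod_topology Z E) {(z, e). \<pi> z = q e}"
  have UE: "U \<subseteq> topspace E" using UO(1) by (rule openin_subset)
  have "openin ?S {w \<in> topspace ?S. (case w of (z, e) \<Rightarrow> f z e) \<in> W}"
    using f UO(2) by (rule openin_continuous_map_preimage)
  then obtain R where R: "openin (prod_topology Z E) R"
    "{w \<in> topspace ?S. (case w of (z, e) \<Rightarrow> f z e) \<in> W} = R \<inter> {(z, e). \<pi> z = q e}"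
    by (auto simp: openin_subtopology)
  have "(z0, e0) \<in> {w \<in> topspace ?S. (case w of (z, e) \<Rightarrow> f z e) \<in> W}" using z0 UE by auto
  then have "(z0, e0) \<in> R" using R(2) by blast
  then obtain Z' U' where ZU: "openin Z Z'" "openin E U'" "z0 \<in> Z'" "e0 \<in> U'" "Z' \<times> U' \<subseteq> R"
    using R(1) by (force simp: openin_prod_topology_alt)
  have "openin X (q ` (U \<inter> U'))" using q UO ZU by (auto simp: open_map_def)
  then have o: "openin Z (Z' \<inter> {z \<in> topspace Z. \<pi> z \<in> q ` (U \<inter> U')})"
    using \<pi> ZU by (intro openin_Int openin_continuous_map_preimage)
  show "\<exists>N. openin Z N \<and> z0 \<in> N \<and> N \<subseteq> {z \<in> topspace Z. \<exists>e\<in>U. q e = \<pi> z \<and> f z e \<in> W}"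
  proof (intro exI conjI)
    show "z0 \<in> Z' \<inter> {z \<in> topspace Z. \<pi> z \<in> q ` (U \<inter> U')}"
      using z0 ZU by (auto intro!: image_eqI[of _ _ e0])
    show "Z' \<inter> {z \<in> topspace Z. \<pi> z \<in> q ` (U \<inter> U')} \<subseteq> {z \<in> topspace Z. \<exists>e\<in>U. q e = \<pi> z \<and> f z e \<in> W}"
    proof
      fix z assume "z \<in> Z' \<inter> {z \<in> topspace Z. \<pi> z \<in> q ` (U \<inter> U')}"
      then obtain e where e: "z \<in> Z'" "z \<in> topspace Z" "e \<in> U" "e \<in> U'" "\<pi> z = q e" by auto
      then have "(z, e) \<in> R \<inter> {(z, e). \<pi> z = q e}" using ZU(5) by auto
      then have "f z e \<in> W" unfolding R(2)[symmetric] by auto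
      then show "z \<in> {z \<in> topspace Z. \<exists>e\<in>U. q e = \<pi> z \<and> f z e \<in> W}" using e by auto
    qed
  qed (rule o)
qed

text \<open>The complement is an existential condition of the previous kind. This is why fibrewise
  conditions are closed as soon as the quantified arrow ranges over an open set.\<close>

lemma closedin_forall_open_map:
  assumes "continuous_map Z X \<pi>" "open_map E X q"
    "continuous_map (subtopology (prod_topology Z E) {(z, e). \<pi> z = q e}) V (\<lambda>(z, e). f z e)"
    "openin E U" "closedin V W" "\<And>z e. z \<in> topspace Z \<Longrightarrow> e \<in> U \<Longrightarrow> q e = \<pi> z \<Longrightarrow> f z e \<in> topspace V"
  shows "closedin Z {z \<in> topspace Z. \<forall>e\<in>U. q e = \<pi> z \<longrightarrow> f z e \<in> W}"
proof -
  have "openin Z {z \<in> topspace Z. \<exists>e\<in>U. q e = \<pi> z \<and> f z e \<in> topspace V - W}"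
    using assms by (intro openin_exists_open_map[of Z X \<pi> E q V f]) auto
  moreover have "topspace Z - {z \<in> topspace Z. \<forall>e\<in>U. q e = \<pi> z \<longrightarrow> f z e \<in> W} = 
    {z \<in> topspace Z. \<exists>e\<in>U. q e = \<pi> z \<and> f z e \<in> topspace V - W}"
    using assms(6) by auto
  ultimately show ?thesis by (simp add: closedin_def)
qed

text \<open>
  The bundle over \<open>X\<close> whose fibre at \<open>x\<close> consists of the functions from the fibre of \<open>q : E \<rightarrow> X\<close>
  at \<open>x\<close> to the interval from \<open>- 1\<close> to \<open>1\<close>, with the topology of pointwise convergence along local
  sections of \<open>q\<close>. Its points are represented in the type \<open>'y\<close> through the injection \<open>enc\<close>.
\<close>

locale fun_bundle =
  fixes E :: "'e topology" and X :: "'x topology" and q :: "'e \<Rightarrow> 'x"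
    and enc :: "'x \<times> ('e \<Rightarrow> real) \<Rightarrow> 'y"
  assumes cont_q: "continuous_map E X q" and open_q: "open_map E X q"
    and locally_inj_q: "\<And>e. e \<in> topspace E \<Longrightarrow> \<exists>U. openin E U \<and> e \<in> U \<and> inj_on q U"
    and Hausdorff_X: "Hausdorff_space X" and lc_X: "locally_compact_space X"
    and inj_enc: "inj enc"
begin

text \<open>Values off the fibre over \<open>x\<close> are reset to 0, so that each function on the
  fibre has exactly one representative.\<close>

definition mk :: "'x \<Rightarrow> ('e \<Rightarrow> real) \<Rightarrow> 'y" where
  "mk x \<kappa> = enc (x, \<lambda>e. if e \<in> topspace E \<and> q e = x then \<kappa> e else 0)"

definition px :: "'y \<Rightarrow> 'x" where "px y = fst (inv enc y)"

definition kv :: "'y \<Rightarrow> 'e \<Rightarrow> real" where "kv y = snd (inv enc y)"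

definition D :: "'y set" where
  "D = {mk x \<kappa> |x \<kappa>. x \<in> topspace X \<and> (\<forall>e. \<bar>\<kappa> e\<bar> \<le> 1)}"

lemma px_mk [simp]: "px (mk x \<kappa>) = x"
  by (simp add: px_def mk_def inv_f_f[OF inj_enc])

lemma kv_mk: "kv (mk x \<kappa>) e = (if e \<in> topspace E \<and> q e = x then \<kappa> e else 0)"
  by (simp add: kv_def mk_def inv_f_f[OF inj_enc])

lemma mk_in_D: 
  assumes "x \<in> topspace X" "\<And>e. e \<in> topspace E \<Longrightarrow> q e = x \<Longrightarrow> \<bar>\<kappa> e\<bar> \<le> 1"
  shows "mk x \<kappa> \<in> D"
proof -
  have "mk x \<kappa> = mk x (\<lambda>e. if e \<in> topspace E \<and> q e = x then \<kappa> e else 0)"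
    unfolding mk_def by (intro arg_cong[of _ _ enc]) auto
  then show ?thesis unfolding D_def using assms
    by (intro CollectI exI[of _ x] exI[of _ "\<lambda>e. if e \<in> topspace E \<and> q e = x then \<kappa> e else 0"]) auto
qed

lemma px_in: "y \<in> D \<Longrightarrow> px y \<in> topspace X"
  by (auto simp: D_def)

lemma kv_le: "y \<in> D \<Longrightarrow> \<bar>kv y e\<bar> \<le> 1"
  by (auto simp: D_def kv_mk)

lemma D_eqI:
  assumes "y \<in> D" "y' \<in> D" "px y = px y'" "\<And>e. e \<in> topspace E \<Longrightarrow> q e = px y' \<Longrightarrow> kv y e = kv y' e"
  shows "y = y'"
proof -
  obtain x \<kappa> x' \<kappa>' where y: "y = mk x \<kappa>" "y' = mk x' \<kappa>'" using assms by (auto simp: D_def)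
  have "x = x'" using assms(3) y by simp
  moreover have "\<kappa> e = \<kappa>' e" if "e \<in> topspace E" "q e = x'" for e
    using assms(4)[of e] that y \<open>x = x'\<close> by (simp add: kv_mk)
  ultimately show ?thesis unfolding y mk_def by (intro arg_cong[of _ _ enc]) auto
qed

text \<open>Used with \<open>q\<close> injective on \<open>U\<close>: then at most one point of
  \<open>U\<close> lies over \<open>px y\<close>, and the condition constrains the value along a
  local section. Quantifying over \<open>U\<close> avoids naming the section.\<close>

definition cyl :: "'e set \<Rightarrow> real set \<Rightarrow> 'y set" where
  "cyl U O' = {y \<in> D. \<exists>e\<in>U. q e = px y \<and> kv y e \<in> O'}"

definition SB :: "'y set set" where
  "SB = {{y \<in> D. px y \<in> W} |W. openin X W} \<union> {cyl U O' |U O'. openin E U \<and> open O'}"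

definition BT :: "'y topology" where
  "BT = topology (arbitrary union_of (finite intersection_of (\<lambda>S. S \<in> SB) relative_to D))"

lemma topspace_BT [simp]: "topspace BT = D"
  unfolding BT_def by simp

lemma openin_SB: assumes "S \<in> SB" shows "openin BT S"
proof -
  have "S \<subseteq> D" using assms by (auto simp: SB_def cyl_def)
  then have "(finite intersection_of (\<lambda>S. S \<in> SB) relative_to D) S"
    using assms by (metis finite_intersection_of_inc inf.absorb2 relative_to_inc)
  then show ?thesis unfolding BT_def openin_subbase by (rule arbitrary_union_of_inc)
qed

lemma openin_px: "openin X W \<Longrightarrow> openin BT {y \<in> D. px y \<in> W}"
  by (rule openin_SB) (auto simp: SB_def)

lemma openin_cyl: "openin E U \<Longrightarrow> open O' \<Longrightarrow> openin BT (cyl U O')"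
  by (rule openin_SB) (auto simp: SB_def)

lemma cont_px: "continuous_map BT X px"
  unfolding continuous_map using openin_px px_in by auto

text \<open>A map into the bundle is continuous once its base component and its joint evaluation on
  the fibre product are; the preimage of a cylinder is open by
  \<open>openin_exists_open_map\<close>.\<close>

lemma cont_into_BT:
  assumes f: "f \<in> topspace Z \<rightarrow> D" and p: "continuous_map Z X (\<lambda>z. px (f z))"
    and k: "continuous_map (subtopology (prod_topology Z E) {(z, e). px (f z) = q e}) euclideanreal (\<lambda>(z, e). kv (f z) e)"
  shows "continuous_map Z BT f"
  unfolding BT_def
proof (rule continuous_map_into_topology_subbase)
  show "f z \<in> topspace (topology (arbitrary union_of (finite intersection_of (\<lambda>S. S \<in> SB) relative_to D)))"
    if "z \<in> topspace Z" for z
    using f that by auto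
  fix S assume "S \<in> SB"
  then consider W where "openin X W" "S = {y \<in> D. px y \<in> W}" | U O' where "openin E U" "open O'" "S = cyl U O'"
    unfolding SB_def by blast
  then show "openin Z {z \<in> topspace Z. f z \<in> S}"
  proof cases
    case 1
    have "openin Z {z \<in> topspace Z. px (f z) \<in> W}" using p 1(1) by (rule openin_continuous_map_preimage)
    moreover have "{z \<in> topspace Z. px (f z) \<in> W} = {z \<in> topspace Z. f z \<in> S}" using f 1(2) by auto
    ultimately show ?thesis by simp
  next
    case 2
    have "openin Z {z \<in> topspace Z. \<exists>e\<in>U. q e = px (f z) \<and> kv (f z) e \<in> O'}"
      using 2 by (intro openin_exists_open_map[OF p open_q k]) auto
    moreover have "{z \<in> topspace Z. \<exists>e\<in>U. q e = px (f z) \<and> kv (f z) e \<in> O'} = {z \<in> topspace Z. f z \<in> S}"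
      using f 2(3) by (auto simp: cyl_def)
    ultimately show ?thesis by simp
  qed
qed

text \<open>On a set \<open>U\<close> where \<open>q\<close> is injective, the point of
  \<open>U\<close> witnessing membership in a cylinder must be the evaluation point itself.\<close>

lemma cont_eval:
  "continuous_map (subtopology (prod_topology BT E) {(y, e). px y = q e}) euclideanreal (\<lambda>(y, e). kv y e)"
  unfolding continuous_map
proof (intro conjI allI impI)
  let ?S = "subtopology (prod_topology BT E) {(y, e). px y = q e}"
  fix O' :: "real set" assume "openin euclideanreal O'"
  then have O: "open O'" by simp
  show "openin ?S {w \<in> topspace ?S. (case w of (y, e) \<Rightarrow> kv y e) \<in> O'}"
  proof (subst openin_subopen, clarify)
    fix y e assume w: "(y, e) \<in> topspace ?S" "kv y e \<in> O'"
    then have ye: "y \<in> D" "e \<in> topspace E" "px y = q e" by auto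
    obtain U where U: "openin E U" "e \<in> U" "inj_on q U" using locally_inj_q[OF ye(2)] by blast
    let ?N = "{(y, e). px y = q e} \<inter> (cyl U O' \<times> U)"
    have "openin ?S ?N" using U O openin_cyl by (intro openin_subtopology_Int2) (simp add: openin_prod_Times_iff)
    moreover have "(y, e) \<in> ?N" using ye U w by (auto simp: cyl_def)
    moreover have "?N \<subseteq> {w \<in> topspace ?S. (case w of (y, e) \<Rightarrow> kv y e) \<in> O'}"
    proof
      fix v assume "v \<in> ?N"
      then obtain y' e' e'' where v: "v = (y', e')" "px y' = q e'" "y' \<in> D" "e' \<in> U" "e'' \<in> U" "q e'' = px y'" "kv y' e'' \<in> O'"
        by (auto simp: cyl_def)
      then have "e' = e''" using U(3) by (auto simp: inj_on_def)
      then show "v \<in> {w \<in> topspace ?S. (case w of (y, e) \<Rightarrow> kv y e) \<in> O'}"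
        using v openin_subset[OF U(1)] by auto
    qed
    ultimately show "\<exists>N. openin ?S N \<and> (y, e) \<in> N \<and> N \<subseteq> {w \<in> topspace ?S. (case w of (y, e) \<Rightarrow> kv y e) \<in> O'}"
      by blast
  qed
qed auto

lemma Hausdorff_BT: "Hausdorff_space BT"
  unfolding Hausdorff_space_def
proof (intro allI impI)
  fix y y' assume "y \<in> topspace BT \<and> y' \<in> topspace BT \<and> y \<noteq> y'"
  then have y: "y \<in> D" "y' \<in> D" "y \<noteq> y'" by auto
  show "\<exists>U V. openin BT U \<and> openin BT V \<and> y \<in> U \<and> y' \<in> V \<and> disjnt U V"
  proof (cases "px y = px y'")
    case False
    then obtain U V where UV: "openin X U" "openin X V" "px y \<in> U" "px y' \<in> V" "disjnt U V"
      using Hausdorff_X px_in[OF y(1)] px_in[OF y(2)] unfolding Hausdorff_space_def by metis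
    then show ?thesis using y
      by (intro exI[of _ "{y \<in> D. px y \<in> U}"] exI[of _ "{y \<in> D. px y \<in> V}"]) (auto simp: openin_px disjnt_def)
  next
    case True
    then obtain e where e: "e \<in> topspace E" "q e = px y'" "kv y e \<noteq> kv y' e" using D_eqI y by blast
    obtain U where U: "openin E U" "e \<in> U" "inj_on q U" using locally_inj_q[OF e(1)] by blast
    obtain V W where VW: "open V" "open W" "kv y e \<in> V" "kv y' e \<in> W" "V \<inter> W = {}"
      using e(3) by (meson hausdorff)
    have "disjnt (cyl U V) (cyl U W)"
    proof (rule ccontr)
      assume "\<not> disjnt (cyl U V) (cyl U W)"
      then obtain z e1 e2 where z: "e1 \<in> U" "e2 \<in> U" "q e1 = px z" "q e2 = px z" "kv z e1 \<in> V" "kv z e2 \<in> W"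
        by (auto simp: disjnt_def cyl_def)
      then have "e1 = e2" using U(3) by (auto simp: inj_on_def)
      then show False using z VW(5) by auto
    qed
    moreover have "y \<in> cyl U V" "y' \<in> cyl U W" using y e U VW True by (auto simp: cyl_def)
    ultimately show ?thesis using openin_cyl[OF U(1)] VW(1,2) by blast
  qed
qed

text \<open>Alexander's subbase theorem, localised over the base. For a subbasic cover
  \<open>C\<close>, each x in \<open>L\<close> has a neighbourhood whose preimage is covered by
  finitely many members of \<open>C\<close>; compactness of \<open>L\<close> then finishes.\<close>

lemma compactin_px:
  assumes L: "compactin X L"
  shows "compactin BT {y \<in> D. px y \<in> L}"
proof -
  define P where "P = {y \<in> D. px y \<in> L}"
  define BP where "BP = topology (arbitrary union_of (finite intersection_of (\<lambda>S. S \<in> SB) relative_to P))"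
  have DSB: "D \<in> SB" unfolding SB_def using px_in by (intro UnI1 CollectI exI[of _ "topspace X"]) auto
  have fin: "\<exists>C'. finite C' \<and> C' \<subseteq> C \<and> P \<subseteq> \<Union>C'" if C: "C \<subseteq> SB" "P \<subseteq> \<Union>C" for C
  proof -
    define good where "good x W C' \<longleftrightarrow> openin X W \<and> x \<in> W \<and> finite C' \<and> C' \<subseteq> C \<and> {y \<in> D. px y \<in> W} \<subseteq> \<Union>C'" for x W C'
    have "\<exists>W C'. good x W C'" if x: "x \<in> L" for x
    proof (rule ccontr)
      assume bad: "\<nexists>W C'. good x W C'"
      have xX: "x \<in> topspace X" using x compactin_subset_topspace[OF L] by blast
      \<comment> \<open>If every value at \<open>e\<close> were caught by a cylinder of
        \<open>C\<close> around \<open>e\<close>, compactness of [-1, 1] would leave finitely many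
        such cylinders, and these cover everything over a neighbourhood of \<open>x\<close>, against
        \<open>bad\<close>.\<close>
      have "\<exists>t. \<bar>t\<bar> \<le> 1 \<and> (\<forall>U O'. openin E U \<and> e \<in> U \<and> open O' \<and> t \<in> O' \<longrightarrow> cyl U O' \<notin> C)"
        if e: "e \<in> topspace E" "q e = x" for e
      proof (rule ccontr)
        assume "\<nexists>t. \<bar>t\<bar> \<le> 1 \<and> (\<forall>U O'. openin E U \<and> e \<in> U \<and> open O' \<and> t \<in> O' \<longrightarrow> cyl U O' \<notin> C)"
        then have "\<forall>t\<in>{-1..1::real}. \<exists>U O'. openin E U \<and> e \<in> U \<and> open O' \<and> t \<in> O' \<and> cyl U O' \<in> C"
          by (auto simp: abs_le_iff)
        then obtain U O' where UO: "\<And>t. t \<in> {-1..1::real} \<Longrightarrow> openin E (U t) \<and> e \<in> U t \<and> open (O' t) \<and> t \<in> O' t \<and> cyl (U t) (O' t) \<in> C"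
          by metis
        obtain T where T: "T \<subseteq> {-1..1}" "finite T" "{-1..1} \<subseteq> (\<Union>t\<in>T. O' t)"
          using compactE_image[of "{-1..1::real}" "{-1..1}" O'] UO by (metis UN_I compact_Icc subsetI)
        obtain V where V: "openin E V" "e \<in> V" "inj_on q V" using locally_inj_q[OF e(1)] by blast
        \<comment> \<open>Inserting 0, a point of [-1, 1], makes the index set of the intersection
          visibly nonempty.\<close>
        define W where "W = (\<Inter>t\<in>insert 0 T. q ` (V \<inter> U t))"
        have T0: "insert 0 T \<subseteq> {-1..1}" using T(1) by auto
        have "openin X W" unfolding W_def
        proof (intro openin_INT2)
          fix t assume "t \<in> insert 0 T"
          then have "openin E (V \<inter> U t)" using T0 UO[of t] V(1) by (intro openin_Int) blast+
          then show "openin X (q ` (V \<inter> U t))" using open_q by (simp add: open_map_def)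
        qed (use T(2) in auto)
        moreover have "x \<in> W" unfolding W_def using T0 UO V(2) e(2) by (auto intro!: image_eqI[of _ _ e])
        moreover have "{y \<in> D. px y \<in> W} \<subseteq> \<Union> ((\<lambda>t. cyl (U t) (O' t)) ` T)"
        proof
          fix y assume "y \<in> {y \<in> D. px y \<in> W}"
          then have y: "y \<in> D" "px y \<in> W" by auto
          then obtain e0 where e0: "e0 \<in> V" "px y = q e0" by (auto simp: W_def)
          have "kv y e0 \<in> {-1..1}" using kv_le[OF y(1), of e0] by (auto simp: abs_le_iff)
          then obtain t where t: "t \<in> T" "kv y e0 \<in> O' t" using T(3) by blast
          then obtain e1 where e1: "e1 \<in> V" "e1 \<in> U t" "px y = q e1" using y(2) by (auto simp: W_def)
          have "e1 = e0" using V(3) e0 e1 by (auto simp: inj_on_def)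
          then show "y \<in> \<Union> ((\<lambda>t. cyl (U t) (O' t)) ` T)" using t e1 y(1) by (auto simp: cyl_def)
        qed
        ultimately have "good x W ((\<lambda>t. cyl (U t) (O' t)) ` T)"
          unfolding good_def using T(1,2) UO by auto
        then show False using bad by blast
      qed
      then obtain t where t: "\<And>e. e \<in> topspace E \<Longrightarrow> q e = x \<Longrightarrow> \<bar>t e\<bar> \<le> 1"
        "\<And>e U O'. e \<in> topspace E \<Longrightarrow> q e = x \<Longrightarrow> openin E U \<Longrightarrow> e \<in> U \<Longrightarrow> open O' \<Longrightarrow> t e \<in> O' \<Longrightarrow> cyl U O' \<notin> C"
        by metis
      \<comment> \<open>The uncaught values form a point over \<open>x\<close>. A member of
        \<open>C\<close> containing it is either the preimage of a base set, which alone makes a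
        \<open>good\<close> choice, or a cylinder catching one of the values.\<close>
      define y where "y = mk x t"
      have "y \<in> P" unfolding P_def y_def using mk_in_D[OF xX t(1)] x by auto
      then obtain S where S: "S \<in> C" "y \<in> S" using C(2) by blast
      then have "S \<in> SB" using C(1) by blast
      then consider W where "openin X W" "S = {y \<in> D. px y \<in> W}" | U O' where "openin E U" "open O'" "S = cyl U O'"
        unfolding SB_def by blast
      then show False
      proof cases
        case 1
        then have "good x W {S}" unfolding good_def using S by (auto simp: y_def)
        then show False using bad by blast
      next
        case 2
        then obtain e where e: "e \<in> U" "q e = x" "kv y e \<in> O'" using S(2) by (auto simp: cyl_def y_def)
        then have "e \<in> topspace E" using 2(1) openin_subset by blast
        then show False using t(2)[of e U O'] e 2 S(1) by (auto simp: y_def kv_mk)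
      qed
    qed
    then obtain W C' where WC: "\<And>x. x \<in> L \<Longrightarrow> good x (W x) (C' x)" by metis
    have "\<exists>\<F>. finite \<F> \<and> \<F> \<subseteq> W ` L \<and> L \<subseteq> \<Union>\<F>"
      using compactinD[OF L, of "W ` L"] WC unfolding good_def by blast
    then obtain \<F> where "finite \<F>" "\<F> \<subseteq> W ` L" "L \<subseteq> \<Union>\<F>" by blast
    then obtain J where J: "finite J" "J \<subseteq> L" "L \<subseteq> (\<Union>x\<in>J. W x)" by (metis finite_subset_image)
    have JW: "x \<in> J \<Longrightarrow> good x (W x) (C' x)" for x using J(2) WC by blast
    show ?thesis
    proof (intro exI[of _ "\<Union>x\<in>J. C' x"] conjI)
      show "finite (\<Union>x\<in>J. C' x)" using J(1) JW by (auto simp: good_def)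
      show "(\<Union>x\<in>J. C' x) \<subseteq> C" using JW unfolding good_def by blast
      show "P \<subseteq> \<Union> (\<Union>x\<in>J. C' x)"
      proof
        fix y assume "y \<in> P"
        then have y: "y \<in> D" "px y \<in> L" by (auto simp: P_def)
        then obtain x where "x \<in> J" "px y \<in> W x" using J(3) by blast
        then show "y \<in> \<Union> (\<Union>x\<in>J. C' x)" using JW[of x] y(1) unfolding good_def by blast
      qed
    qed
  qed
  \<comment> \<open>Alexander's theorem is applied to the topology that the subbase generates on
    \<open>P\<close>; the continuous identity into \<open>BT\<close> carries compactness
    over.\<close>
  have "compact_space BP"
    by (rule Alexander_subbase_alt[of P SB]) (use DSB fin in \<open>auto simp: P_def BP_def\<close>)
  moreover have top: "topspace BP = P" by (simp add: BP_def)
  ultimately have "compactin BP P" by (simp add: compact_space_def)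
  moreover have "continuous_map BP BT id"
    unfolding BT_def
  proof (rule continuous_map_into_topology_subbase)
    fix S assume "S \<in> SB"
    then have "(finite intersection_of (\<lambda>S. S \<in> SB) relative_to P) (P \<inter> S)"
      by (intro relative_to_inc finite_intersection_of_inc)
    then have "openin BP (P \<inter> S)" unfolding BP_def openin_subbase by (rule arbitrary_union_of_inc)
    moreover have "P \<inter> S = {x \<in> topspace BP. id x \<in> S}" by (auto simp: top)
    ultimately show "openin BP {x \<in> topspace BP. id x \<in> S}" by simp
  qed (auto simp: top P_def)
  ultimately have "compactin BT (id ` P)" by (rule image_compactin)
  then show ?thesis by (simp add: P_def)
qed

lemma lc_BT: "locally_compact_space BT"
  unfolding locally_compact_space_def
proof
  fix y assume "y \<in> topspace BT"
  then have y: "y \<in> D" by simp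
  obtain U L where "openin X U" "compactin X L" "px y \<in> U" "U \<subseteq> L"
    using lc_X px_in[OF y] unfolding locally_compact_space_def by blast
  then show "\<exists>U K. openin BT U \<and> compactin BT K \<and> y \<in> U \<and> U \<subseteq> K"
    using y by (intro exI[of _ "{y \<in> D. px y \<in> U}"] exI[of _ "{y \<in> D. px y \<in> L}"])
      (auto intro: openin_px compactin_px)
qed

end

section \<open>Topology of etale groupoids\<close>

lemma continuous_map_locally:
  assumes "\<And>z. z \<in> topspace Z \<Longrightarrow> \<exists>N. openin Z N \<and> z \<in> N \<and> continuous_map (subtopology Z N) Y f"
  shows "continuous_map Z Y f"
  unfolding continuous_map
proof (intro conjI allI impI)
  show "f ` topspace Z \<subseteq> topspace Y"
  proof clarify
    fix z assume z: "z \<in> topspace Z"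
    with assms obtain N where N: "openin Z N" "z \<in> N" "continuous_map (subtopology Z N) Y f" by blast
    then show "f z \<in> topspace Y" using z continuous_map_image_subset_topspace[OF N(3)] by auto
  qed
next
  fix U assume U: "openin Y U"
  show "openin Z {x \<in> topspace Z. f x \<in> U}"
  proof (subst openin_subopen, clarify)
    fix z assume z: "z \<in> topspace Z" "f z \<in> U"
    with assms obtain N where N: "openin Z N" "z \<in> N" "continuous_map (subtopology Z N) Y f" by blast
    have "openin (subtopology Z N) {x \<in> topspace (subtopology Z N). f x \<in> U}"
      using N(3) U openin_continuous_map_preimage by blast
    then have "openin Z {x \<in> topspace (subtopology Z N). f x \<in> U}"
      using N(1) openin_trans_full by blast
    then show "\<exists>T. openin Z T \<and> z \<in> T \<and> T \<subseteq> {x \<in> topspace Z. f x \<in> U}"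
      using z N by (intro exI[of _ "{x \<in> topspace (subtopology Z N). f x \<in> U}"]) auto
  qed
qed

lemma openin_prod_topologyD:
  assumes "openin (prod_topology X Y) W" "(x, y) \<in> W"
  obtains U V where "openin X U" "openin Y V" "x \<in> U" "y \<in> V" "U \<times> V \<subseteq> W"
  using assms by (force simp: openin_prod_topology_alt)

locale etale =
  fixes G :: "'g groupoid"
  assumes et: "etale_groupoid G"
begin

abbreviation "T \<equiv> gtop G"
abbreviation "r \<equiv> grng G"
abbreviation "s \<equiv> gsrc G"
abbreviation "iv \<equiv> ginv G"
abbreviation mul (infixl "\<odot>" 70) where "mul \<equiv> gmult G"
abbreviation "Ar \<equiv> arrows G"
abbreviation "Fb \<equiv> fibre G"
abbreviation "CT \<equiv> subtopology (prod_topology T T) (composable G)"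

lemma locally_compact_groupoid_G: "locally_compact_groupoid G"
  using et by (simp add: etale_groupoid_def)

lemma groupoid_G: "is_groupoid G"
  using locally_compact_groupoid_G by (simp add: locally_compact_groupoid_def)

lemma Hausdorff_T: "Hausdorff_space T" and lc_T: "locally_compact_space T"
  using locally_compact_groupoid_G by (simp_all add: locally_compact_groupoid_def)

lemma topspace_T [simp]: "topspace T = Ar"
  by (simp add: arrows_def)

lemma arrow_maps_in [simp]:
  assumes "\<gamma> \<in> Ar"
  shows "r \<gamma> \<in> Ar" "s \<gamma> \<in> Ar" "iv \<gamma> \<in> Ar"
  using groupoid_G assms by (auto simp: is_groupoid_def)

lemma range_source_simps [simp]:
  assumes "\<gamma> \<in> Ar"
  shows "r (r \<gamma>) = r \<gamma>" "s (r \<gamma>) = r \<gamma>" "r (s \<gamma>) = s \<gamma>" "s (s \<gamma>) = s \<gamma>"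
    "r (iv \<gamma>) = s \<gamma>" "s (iv \<gamma>) = r \<gamma>"
  using groupoid_G assms by (auto simp: is_groupoid_def)

lemma units_eq: "units G = {x \<in> Ar. r x = x}"
  unfolding units_def by (force simp: image_iff)

lemma units_eq': "x \<in> units G \<longleftrightarrow> x \<in> Ar \<and> r x = x \<and> s x = x"
  unfolding units_def by (force simp: image_iff)

lemma units_subset: "units G \<subseteq> Ar"
  by (auto simp: units_eq)

lemma range_source_units [simp]: "\<gamma> \<in> Ar \<Longrightarrow> r \<gamma> \<in> units G" "\<gamma> \<in> Ar \<Longrightarrow> s \<gamma> \<in> units G"
  by (auto simp: units_eq)

lemma mul_in [simp]:
  assumes "\<gamma> \<in> Ar" "\<eta> \<in> Ar" "s \<gamma> = r \<eta>"
  shows "\<gamma> \<odot> \<eta> \<in> Ar" "r (\<gamma> \<odot> \<eta>) = r \<gamma>" "s (\<gamma> \<odot> \<eta>) = s \<eta>"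
proof -
  have "(\<gamma>, \<eta>) \<in> composable G" using assms by (simp add: composable_def)
  moreover have "\<forall>(\<gamma>, \<eta>)\<in>composable G. gmult G \<gamma> \<eta> \<in> arrows G \<and>
                 grng G (gmult G \<gamma> \<eta>) = grng G \<gamma> \<and> gsrc G (gmult G \<gamma> \<eta>) = gsrc G \<eta>"
    using groupoid_G unfolding is_groupoid_def by (elim conjE)
  ultimately show "\<gamma> \<odot> \<eta> \<in> Ar" "r (\<gamma> \<odot> \<eta>) = r \<gamma>" "s (\<gamma> \<odot> \<eta>) = s \<eta>" by auto
qed

lemma mul_assoc:
  assumes "\<gamma> \<in> Ar" "\<eta> \<in> Ar" "\<zeta> \<in> Ar" "s \<gamma> = r \<eta>" "s \<eta> = r \<zeta>"
  shows "\<gamma> \<odot> \<eta> \<odot> \<zeta> = \<gamma> \<odot> (\<eta> \<odot> \<zeta>)"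
  using groupoid_G assms unfolding is_groupoid_def by (simp add: composable_def)

lemma mul_unit [simp]:
  assumes "\<gamma> \<in> Ar"
  shows "r \<gamma> \<odot> \<gamma> = \<gamma>" "\<gamma> \<odot> s \<gamma> = \<gamma>" "iv \<gamma> \<odot> \<gamma> = s \<gamma>" "\<gamma> \<odot> iv \<gamma> = r \<gamma>"
  using groupoid_G assms unfolding is_groupoid_def by auto

lemma mul_unit' [simp]:
  assumes "\<gamma> \<in> Ar"
  shows "r \<gamma> = x \<Longrightarrow> x \<odot> \<gamma> = \<gamma>" "s \<gamma> = x \<Longrightarrow> \<gamma> \<odot> x = \<gamma>"
  using assms by auto

lemma mul_cancel [simp]:
  assumes "\<gamma> \<in> Ar" "\<eta> \<in> Ar"
  shows "s \<gamma> = r \<eta> \<Longrightarrow> iv \<gamma> \<odot> (\<gamma> \<odot> \<eta>) = \<eta>" "r \<gamma> = r \<eta> \<Longrightarrow> \<gamma> \<odot> (iv \<gamma> \<odot> \<eta>) = \<eta>"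
  using assms by (simp_all flip: mul_assoc)

lemma inv_inv [simp]: assumes "\<gamma> \<in> Ar" shows "iv (iv \<gamma>) = \<gamma>"
proof -
  have "iv (iv \<gamma>) = iv (iv \<gamma>) \<odot> (iv \<gamma> \<odot> \<gamma>)" using assms by simp
  also have "\<dots> = \<gamma>" using assms by (subst mul_cancel) auto
  finally show ?thesis .
qed

lemma inv_mul:
  assumes "\<gamma> \<in> Ar" "\<eta> \<in> Ar" "s \<gamma> = r \<eta>"
  shows "iv (\<gamma> \<odot> \<eta>) = iv \<eta> \<odot> iv \<gamma>"
proof -
  have "(\<gamma> \<odot> \<eta>) \<odot> (iv \<eta> \<odot> iv \<gamma>) = r \<gamma>"
    using assms by (simp add: mul_assoc)
  then have "iv (\<gamma> \<odot> \<eta>) \<odot> ((\<gamma> \<odot> \<eta>) \<odot> (iv \<eta> \<odot> iv \<gamma>)) = iv (\<gamma> \<odot> \<eta>)"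
    using assms by simp
  then show ?thesis using assms by (subst (asm) mul_cancel) auto
qed

lemma inv_unit [simp]: "x \<in> units G \<Longrightarrow> iv x = x"
  by (metis mul_unit(2,3) range_source_simps(6) arrow_maps_in(3) units_eq')

lemma inv_mul_mul:
  assumes "\<gamma> \<in> Ar" "\<eta> \<in> Ar" "c \<in> Ar" "s \<gamma> = r \<eta>" "s \<gamma> = r c"
  shows "iv (\<gamma> \<odot> \<eta>) \<odot> (\<gamma> \<odot> c) = iv \<eta> \<odot> c"
  using assms by (simp add: inv_mul mul_assoc)

lemma fibre_iff [simp]: "c \<in> Fb x \<longleftrightarrow> c \<in> Ar \<and> r c = x"
  by (simp add: fibre_def)

lemma bij_translate:
  assumes "\<gamma> \<in> Ar"
  shows "bij_betw (\<lambda>c. \<gamma> \<odot> c) (Fb (s \<gamma>)) (Fb (r \<gamma>))"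
  by (rule bij_betwI[where g = "\<lambda>c. iv \<gamma> \<odot> c"]) (use assms in auto)

lemma composable_iff [simp]: "(\<gamma>, \<eta>) \<in> composable G \<longleftrightarrow> \<gamma> \<in> Ar \<and> \<eta> \<in> Ar \<and> s \<gamma> = r \<eta>"
  by (auto simp: composable_def)

lemma topspace_CT [simp]: "topspace CT = composable G"
  by (auto simp: composable_def)

lemma composable_subset: "composable G \<subseteq> Ar \<times> Ar"
  by (auto simp: composable_def)

lemma cont_r: "continuous_map T T r" and cont_s: "continuous_map T T s"
  and cont_iv: "continuous_map T T iv"
  and cont_mul: "continuous_map CT T (\<lambda>(\<gamma>, \<eta>). \<gamma> \<odot> \<eta>)"
  using locally_compact_groupoid_G by (simp_all add: locally_compact_groupoid_def)

lemma cont_r': "continuous_map Z T f \<Longrightarrow> continuous_map Z T (\<lambda>z. r (f z))"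
  and cont_s': "continuous_map Z T f \<Longrightarrow> continuous_map Z T (\<lambda>z. s (f z))"
  and cont_iv': "continuous_map Z T f \<Longrightarrow> continuous_map Z T (\<lambda>z. iv (f z))"
  using continuous_map_compose[OF _ cont_r] continuous_map_compose[OF _ cont_s]
    continuous_map_compose[OF _ cont_iv] by (auto simp: o_def)

lemma cont_in_Ar: "continuous_map Z T f \<Longrightarrow> z \<in> topspace Z \<Longrightarrow> f z \<in> Ar"
  using continuous_map_image_subset_topspace by fastforce

lemma cont_into_CT:
  assumes "continuous_map Z T f" "continuous_map Z T g" "\<And>z. z \<in> topspace Z \<Longrightarrow> s (f z) = r (g z)"
  shows "continuous_map Z CT (\<lambda>z. (f z, g z))"
  using assms cont_in_Ar[OF assms(1)] cont_in_Ar[OF assms(2)]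
  by (auto simp: continuous_map_in_subtopology continuous_map_pairedI)

lemma cont_mul':
  assumes "continuous_map Z T f" "continuous_map Z T g" "\<And>z. z \<in> topspace Z \<Longrightarrow> s (f z) = r (g z)"
  shows "continuous_map Z T (\<lambda>z. f z \<odot> g z)"
  using continuous_map_compose[OF cont_into_CT[OF assms] cont_mul] by (simp add: o_def)

lemma cont_CT_apply:
  assumes "continuous_map CT Y (\<lambda>(\<gamma>, c). a \<gamma> c)" "continuous_map Z T f" "continuous_map Z T g"
    "\<And>z. z \<in> topspace Z \<Longrightarrow> s (f z) = r (g z)"
  shows "continuous_map Z Y (\<lambda>z. a (f z) (g z))"
  using continuous_map_compose[OF cont_into_CT[OF assms(2-4)] assms(1)] by (simp add: o_def)

lemma topspace_unit_space [simp]: "topspace (unit_space G) = units G"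
  using units_subset by (auto simp: unit_space_def)

lemma cont_unit_space_iff:
  "continuous_map Z (unit_space G) q \<longleftrightarrow> continuous_map Z T q \<and> (\<forall>z\<in>topspace Z. q z \<in> units G)"
  by (auto simp: unit_space_def continuous_map_in_subtopology)

lemma etale_nbhd:
  assumes "\<gamma> \<in> Ar"
  obtains U where "openin T U" "\<gamma> \<in> U" "inj_on r U" "openin (unit_space G) (r ` U)"
    "homeomorphic_map (subtopology T U) (subtopology (unit_space G) (r ` U)) r"
proof -
  have "local_homeomorphism T (unit_space G) r" using et by (simp add: etale_groupoid_def)
  then obtain U where U: "openin T U" "\<gamma> \<in> U" "openin (unit_space G) (r ` U)"
    "homeomorphic_map (subtopology T U) (subtopology (unit_space G) (r ` U)) r"
    using assms unfolding local_homeomorphism_def by fastforce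
  moreover have "inj_on r U"
    using homeomorphic_imp_injective_map[OF U(4)] openin_subset[OF U(1)] by (simp add: Int_absorb1)
  ultimately show thesis using that by blast
qed

lemma open_map_r: "open_map T (unit_space G) r"
  unfolding open_map_def
proof (intro allI impI)
  fix V assume V: "openin T V"
  show "openin (unit_space G) (r ` V)"
  proof (subst openin_subopen, clarify)
    fix \<gamma> assume \<gamma>: "\<gamma> \<in> V"
    then have "\<gamma> \<in> Ar" using V openin_subset by fastforce
    then obtain U where U: "openin T U" "\<gamma> \<in> U" "openin (unit_space G) (r ` U)"
      "homeomorphic_map (subtopology T U) (subtopology (unit_space G) (r ` U)) r"
      using etale_nbhd by blast
    have "openin (subtopology T U) (U \<inter> V)" using V by (simp add: openin_subtopology_Int2)
    then have "openin (subtopology (unit_space G) (r ` U)) (r ` (U \<inter> V))"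
      using homeomorphic_imp_open_map[OF U(4)] by (simp add: open_map_def)
    then have "openin (unit_space G) (r ` (U \<inter> V))" using U(3) openin_trans_full by blast
    then show "\<exists>T. openin (unit_space G) T \<and> r \<gamma> \<in> T \<and> T \<subseteq> r ` V"
      using U \<gamma> by (intro exI[of _ "r ` (U \<inter> V)"]) auto
  qed
qed

text \<open>Near a unit, let r be injective on \<open>U\<close>. If \<gamma> and
  \<open>r \<gamma>\<close> both lie in \<open>U\<close>, they have the same range, so \<gamma>
  equals \<open>r \<gamma>\<close> and is a unit.\<close>

lemma openin_units: "openin T (units G)"
proof (subst openin_subopen, clarify)
  fix x assume x: "x \<in> units G"
  then have "x \<in> Ar" using units_subset by blast
  then obtain U where U: "openin T U" "x \<in> U" "inj_on r U" using etale_nbhd by metis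
  let ?V = "U \<inter> {\<gamma> \<in> topspace T. r \<gamma> \<in> U}"
  have "openin T ?V" using U cont_r by (intro openin_Int openin_continuous_map_preimage) auto
  moreover have "x \<in> ?V" using x U by (auto simp: units_eq)
  moreover have "?V \<subseteq> units G" using U(3) by (auto simp: units_eq inj_on_def)
  ultimately show "\<exists>V. openin T V \<and> x \<in> V \<and> V \<subseteq> units G" by blast
qed

lemma closedin_units: "closedin T (units G)"
proof -
  have "closedin T {\<gamma> \<in> topspace T. (\<lambda>\<gamma>. r \<gamma>) \<gamma> = id \<gamma>}"
    using closedin_continuous_maps_eq[OF Hausdorff_T cont_r continuous_map_id] by simp
  then show ?thesis by (simp add: units_eq)
qed

lemma Hausdorff_unit_space: "Hausdorff_space (unit_space G)"
  and lc_unit_space: "locally_compact_space (unit_space G)"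
  unfolding unit_space_def
  using Hausdorff_T lc_T openin_units
  by (auto intro: Hausdorff_space_subtopology locally_compact_space_open_subset)

lemma compactin_unit_space: "compactin (unit_space G) L \<longleftrightarrow> compactin T L \<and> L \<subseteq> units G"
  by (simp add: unit_space_def compactin_subtopology)

lemma local_section:
  assumes "\<gamma> \<in> Ar" "openin T V" "\<gamma> \<in> V"
  obtains U \<tau> where "openin T U" "\<gamma> \<in> U" "U \<subseteq> V" "inj_on r U" "openin (unit_space G) (r ` U)"
    "continuous_map (subtopology (unit_space G) (r ` U)) T \<tau>"
    "\<And>c. c \<in> U \<Longrightarrow> \<tau> (r c) = c"
proof -
  obtain U where U: "openin T U" "\<gamma> \<in> U" "inj_on r U" "openin (unit_space G) (r ` U)"
    "homeomorphic_map (subtopology T U) (subtopology (unit_space G) (r ` U)) r"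
    using assms etale_nbhd by metis
  then obtain \<tau> where \<tau>: "homeomorphic_maps (subtopology T U) (subtopology (unit_space G) (r ` U)) r \<tau>"
    using homeomorphic_map_maps by blast
  let ?U = "U \<inter> V"
  have UA: "U \<subseteq> Ar" using U(1) openin_subset by fastforce
  have o: "openin T ?U" using U assms by blast
  show thesis
  proof (rule that[of ?U \<tau>])
    show "openin (unit_space G) (r ` ?U)" using o open_map_r by (simp add: open_map_def)
    have "continuous_map (subtopology (unit_space G) (r ` U)) T \<tau>"
      using \<tau> by (simp add: homeomorphic_maps_def continuous_map_in_subtopology)
    then show "continuous_map (subtopology (unit_space G) (r ` ?U)) T \<tau>"
      by (rule continuous_map_from_subtopology_mono) auto
    show "\<tau> (r c) = c" if "c \<in> ?U" for c
      using \<tau> that UA by (auto simp: homeomorphic_maps_def)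
  qed (use o U assms in \<open>auto simp: inj_on_def\<close>)
qed

end

lemma continuous_map_fst_snd_subtopology:
  "continuous_map (subtopology (prod_topology X Y) S) X fst"
  "continuous_map (subtopology (prod_topology X Y) S) Y snd"
  by (auto intro: continuous_map_from_subtopology continuous_map_fst continuous_map_snd)

lemma compactin_pointwise_cover:
  assumes K: "compactin X K" and W: "\<And>x. x \<in> K \<Longrightarrow> openin X (W x)" "\<And>x. x \<in> K \<Longrightarrow> x \<in> W x"
  shows "\<exists>J. finite J \<and> J \<subseteq> K \<and> K \<subseteq> (\<Union>x\<in>J. W x)"
proof -
  have "\<exists>\<F>. finite \<F> \<and> \<F> \<subseteq> W ` K \<and> K \<subseteq> \<Union>\<F>"
    using compactinD[OF K, of "W ` K"] W by blast
  then obtain \<F> where F: "finite \<F>" "\<F> \<subseteq> W ` K" "K \<subseteq> \<Union>\<F>" by blast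
  then obtain J where "finite J" "J \<subseteq> K" "\<F> = W ` J" by (meson finite_subset_image)
  with F show ?thesis by blast
qed

section \<open>Sets proper over the unit space and finite sums along range fibres\<close>

context etale
begin

text \<open>
  Sets on which the range map is proper. Unlike compact sets they may contain all units, which the
  support of the identity kernel requires.
\<close>

definition rproper :: "'g set \<Rightarrow> bool" where
  "rproper A \<longleftrightarrow> closedin T A \<and> (\<forall>L. compactin (unit_space G) L \<longrightarrow> compactin T {c \<in> A. r c \<in> L})"

lemma rproper_subset: "rproper A \<Longrightarrow> A \<subseteq> Ar"
  using closedin_subset by (fastforce simp: rproper_def)

lemma cont_r_unit_space: "continuous_map T (unit_space G) r"
  using cont_r by (auto simp: cont_unit_space_iff)

lemma cont_s_unit_space: "continuous_map T (unit_space G) s"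
  using cont_s by (auto simp: cont_unit_space_iff)

lemma closedin_preimage_r: 
  assumes "closedin (unit_space G) L" shows "closedin T {c \<in> Ar. r c \<in> L}"
  using closedin_continuous_map_preimage[OF cont_r_unit_space assms] by simp

lemma compactin_closedin_T: "compactin T C \<Longrightarrow> closedin T C"
  using Hausdorff_T compactin_imp_closedin by blast

lemma compactin_closedin_unit_space: "compactin (unit_space G) C \<Longrightarrow> closedin (unit_space G) C"
  using Hausdorff_unit_space compactin_imp_closedin by blast

lemma rproper_compact: assumes "compactin T C" shows "rproper C"
  unfolding rproper_def
proof (intro conjI allI impI compactin_closedin_T assms)
  fix L assume "compactin (unit_space G) L"
  then have "closedin T {c \<in> Ar. r c \<in> L}" by (intro closedin_preimage_r compactin_closedin_unit_space)
  then have "compactin T ({c \<in> Ar. r c \<in> L} \<inter> C)" using assms by (simp add: closed_Int_compactin)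
  moreover have "{c \<in> Ar. r c \<in> L} \<inter> C = {c \<in> C. r c \<in> L}" using compactin_subset_topspace[OF assms] by auto
  ultimately show "compactin T {c \<in> C. r c \<in> L}" by simp
qed

lemma rproper_units: "rproper (units G)"
  unfolding rproper_def
proof (intro conjI allI impI closedin_units)
  fix L assume "compactin (unit_space G) L"
  moreover from this have "{c \<in> units G. r c \<in> L} = L" by (auto simp: units_eq compactin_unit_space)
  ultimately show "compactin T {c \<in> units G. r c \<in> L}" by (simp add: compactin_unit_space)
qed

lemma rproper_Un: "rproper A \<Longrightarrow> rproper B \<Longrightarrow> rproper (A \<union> B)"
  unfolding rproper_def
proof (intro conjI allI impI)
  fix L assume *: "closedin T A \<and> (\<forall>L. compactin (unit_space G) L \<longrightarrow> compactin T {c \<in> A. r c \<in> L})"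
    "closedin T B \<and> (\<forall>L. compactin (unit_space G) L \<longrightarrow> compactin T {c \<in> B. r c \<in> L})"
    "compactin (unit_space G) L"
  have "{c \<in> A \<union> B. r c \<in> L} = {c \<in> A. r c \<in> L} \<union> {c \<in> B. r c \<in> L}" by auto
  with * show "compactin T {c \<in> A \<union> B. r c \<in> L}" by (simp add: compactin_Un)
qed auto

definition prod_set :: "'g set \<Rightarrow> 'g set \<Rightarrow> 'g set" where
  "prod_set A B = {a \<odot> b |a b. a \<in> A \<and> b \<in> B \<and> s a = r b}"

lemma prod_setI: "a \<in> A \<Longrightarrow> b \<in> B \<Longrightarrow> s a = r b \<Longrightarrow> a \<odot> b \<in> prod_set A B"
  by (auto simp: prod_set_def)

lemma closedin_composable: "closedin (prod_topology T T) (composable G)"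
proof -
  have "continuous_map (prod_topology T T) T (\<lambda>z. s (fst z))"
    "continuous_map (prod_topology T T) T (\<lambda>z. r (snd z))"
    by (intro cont_s' cont_r' continuous_map_fst continuous_map_snd)+
  from closedin_continuous_maps_eq[OF Hausdorff_T this] 
  have "closedin (prod_topology T T) {z \<in> Ar \<times> Ar. s (fst z) = r (snd z)}" by simp
  moreover have "{z \<in> Ar \<times> Ar. s (fst z) = r (snd z)} = composable G" by auto
  ultimately show ?thesis by simp
qed

lemma compactin_prod_set:
  assumes "compactin T A" "compactin T B" shows "compactin T (prod_set A B)"
proof -
  have "compactin (prod_topology T T) (composable G \<inter> A \<times> B)"
    using assms by (intro closed_Int_compactin closedin_composable) (simp add: compactin_Times)
  then have "compactin CT (composable G \<inter> A \<times> B)" by (simp add: compactin_subtopology)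
  from image_compactin[OF this cont_mul] 
  have "compactin T ((\<lambda>(\<gamma>, \<eta>). \<gamma> \<odot> \<eta>) ` (composable G \<inter> A \<times> B))" .
  moreover have "(\<lambda>(\<gamma>, \<eta>). \<gamma> \<odot> \<eta>) ` (composable G \<inter> A \<times> B) = prod_set A B"
    using compactin_subset_topspace[OF assms(1)] compactin_subset_topspace[OF assms(2)]
    by (force simp: prod_set_def image_iff)
  ultimately show ?thesis by simp
qed

text \<open>Near \<open>x\<close> the set \<open>A\<close> is contained in finitely many disjoint
  continuous sheets. A sheet may leave \<open>A\<close> away from \<open>x\<close>, so only an
  inclusion is required.\<close>

definition local_triv :: "'g set \<Rightarrow> 'g \<Rightarrow> 'g set \<Rightarrow> 'g set \<Rightarrow> ('g \<Rightarrow> 'g \<Rightarrow> 'g) \<Rightarrow> bool" where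
  "local_triv A x I W \<tau> \<longleftrightarrow> finite I \<and> I = A \<inter> Fb x \<and> openin (unit_space G) W \<and> x \<in> W \<and>
    (\<forall>c\<in>I. continuous_map (subtopology (unit_space G) W) T (\<tau> c)) \<and>
    (\<forall>c\<in>I. \<forall>y\<in>W. \<tau> c y \<in> Fb y) \<and>
    (\<forall>y\<in>W. inj_on (\<lambda>c. \<tau> c y) I \<and> A \<inter> Fb y \<subseteq> (\<lambda>c. \<tau> c y) ` I)"

text \<open>The fibre of \<open>A\<close> at \<open>x\<close> is compact and meets each r-injective
  open set in at most one point, hence is finite; local sections through its points give the sheets.
  Properness rules out further points of \<open>A\<close> over a small neighbourhood of
  \<open>x\<close>.\<close>

lemma local_triv_exists:
  assumes A: "rproper A" and x: "x \<in> units G"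
  shows "\<exists>I W \<tau>. local_triv A x I W \<tau>"
proof -
  have AA: "A \<subseteq> Ar" using A by (rule rproper_subset)
  define I where "I = A \<inter> Fb x"
  define Q where "Q c U \<tau> \<longleftrightarrow> openin T U \<and> c \<in> U \<and> inj_on r U \<and> openin (unit_space G) (r ` U) \<and>
    continuous_map (subtopology (unit_space G) (r ` U)) T \<tau> \<and> (\<forall>c\<in>U. \<tau> (r c) = c)" for c U \<tau>
  have "\<exists>U \<tau>. Q c U \<tau>" if "c \<in> I" for c
  proof -
    have "c \<in> Ar" using that by (simp add: I_def)
    moreover have "openin T Ar" using openin_topspace[of T] by simp
    ultimately show ?thesis 
      by (rule_tac local_section[of c Ar]) (auto simp: Q_def)
  qed
  then obtain U \<tau> where Q: "\<And>c. c \<in> I \<Longrightarrow> Q c (U c) (\<tau> c)" by metis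
  then have U: "\<And>c. c \<in> I \<Longrightarrow> openin T (U c)" "\<And>c. c \<in> I \<Longrightarrow> c \<in> U c"
    "\<And>c. c \<in> I \<Longrightarrow> inj_on r (U c)" "\<And>c. c \<in> I \<Longrightarrow> openin (unit_space G) (r ` U c)"
    "\<And>c. c \<in> I \<Longrightarrow> continuous_map (subtopology (unit_space G) (r ` U c)) T (\<tau> c)"
    "\<And>c d. c \<in> I \<Longrightarrow> d \<in> U c \<Longrightarrow> \<tau> c (r d) = d"
    unfolding Q_def by blast+
  have UA: "U c \<subseteq> Ar" if "c \<in> I" for c using openin_subset[OF U(1)[OF that]] by simp
  have "compactin (unit_space G) {x}" using x by simp
  then have "compactin T {c \<in> A. r c \<in> {x}}" using A unfolding rproper_def by blast
  moreover have "{c \<in> A. r c \<in> {x}} = I" using AA by (auto simp: I_def)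
  ultimately have "compactin T I" by simp
  then obtain J where J: "finite J" "J \<subseteq> I" "I \<subseteq> (\<Union>c\<in>J. U c)"
    using compactin_pointwise_cover[of T I U] U(1,2) by blast
  \<comment> \<open>Each \<open>U d\<close> contains a single point over \<open>x\<close>, so a
    subcover has to use every point of \<open>I\<close>.\<close>
  have "I \<subseteq> J"
  proof
    fix c assume c: "c \<in> I"
    then obtain d where d: "d \<in> J" "c \<in> U d" using J by blast
    then have "d \<in> I" using J by blast
    then have "d \<in> U d" "r c = r d" using U(2) c by (auto simp: I_def)
    then show "c \<in> J" using U(3)[OF \<open>d \<in> I\<close>] d by (auto simp: inj_on_def)
  qed
  then have fin: "finite I" using J finite_subset by blast
  obtain W0 L0 where L0: "openin (unit_space G) W0" "compactin (unit_space G) L0" "x \<in> W0" "W0 \<subseteq> L0"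
    using lc_unit_space x unfolding locally_compact_space_def by auto
  define A0 where "A0 = {c \<in> A. r c \<in> L0}"
  have A0: "compactin T A0" using A L0 by (simp add: rproper_def A0_def)
  have "compactin T ((topspace T - (\<Union>c\<in>I. U c)) \<inter> A0)"
    by (intro closed_Int_compactin A0 closedin_diff closedin_topspace openin_Union) (use U in auto)
  then have "compactin (unit_space G) (r ` ((topspace T - (\<Union>c\<in>I. U c)) \<inter> A0))"
    using cont_r_unit_space image_compactin by blast
  then have B: "closedin (unit_space G) (r ` ((topspace T - (\<Union>c\<in>I. U c)) \<inter> A0))"
    by (rule compactin_closedin_unit_space)
  \<comment> \<open>\<open>B\<close> is the set of base points over which \<open>A\<close> has a
    point outside the sheets. It is closed, as the image of a compact set, and misses
    \<open>x\<close>; deleting it forces all of \<open>A\<close> near \<open>x\<close> into the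
    sheets.\<close>
  define B where "B = r ` ((topspace T - (\<Union>c\<in>I. U c)) \<inter> A0)"
  have xB: "x \<notin> B"
  proof
    assume "x \<in> B"
    then obtain c where c: "c \<in> Ar" "c \<notin> (\<Union>c\<in>I. U c)" "c \<in> A0" "r c = x" by (auto simp: B_def)
    then have "c \<in> I" by (auto simp: I_def A0_def)
    then show False using U(2) c by blast
  qed
  \<comment> \<open>Intersecting with the whole unit space covers the case of an empty
    fibre.\<close>
  define W1 where "W1 = topspace (unit_space G) \<inter> \<Inter> ((\<lambda>c. r ` U c) ` I)"
  have W1: "openin (unit_space G) W1" unfolding W1_def using fin U(4) 
    by (cases "I = {}") (auto intro!: openin_Int openin_INT2 openin_topspace simp del: topspace_unit_space)
  have W1sub: "W1 \<subseteq> r ` U c" if "c \<in> I" for c using that by (auto simp: W1_def)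
  have xW1: "x \<in> W1" using x U(2) I_def by (force simp: W1_def)
  have cW1: "continuous_map (subtopology (unit_space G) W1) T (\<tau> c)" if "c \<in> I" for c
    using continuous_map_from_subtopology_mono[OF U(5)[OF that] W1sub[OF that]] .
  \<comment> \<open>Two sections agree on a relatively closed set, so sheets that are distinct at
    \<open>x\<close> remain distinct nearby.\<close>
  have ne: "openin (unit_space G) {y \<in> W1. \<tau> c y \<noteq> \<tau> d y}" if "c \<in> I" "d \<in> I" for c d
  proof -
    have "closedin (subtopology (unit_space G) W1) {y \<in> topspace (subtopology (unit_space G) W1). \<tau> c y = \<tau> d y}"
      using Hausdorff_T cW1 that by (intro closedin_continuous_maps_eq)
    then have "openin (subtopology (unit_space G) W1) (topspace (subtopology (unit_space G) W1) - {y \<in> topspace (subtopology (unit_space G) W1). \<tau> c y = \<tau> d y})"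
      by blast
    moreover have "topspace (subtopology (unit_space G) W1) - {y \<in> topspace (subtopology (unit_space G) W1). \<tau> c y = \<tau> d y} = {y \<in> W1. \<tau> c y \<noteq> \<tau> d y}"
      using openin_subset[OF W1] by auto
    ultimately show ?thesis using W1 openin_trans_full by metis
  qed
  define W2 where "W2 = W1 \<inter> \<Inter> ((\<lambda>(c, d). {y \<in> W1. \<tau> c y \<noteq> \<tau> d y}) ` {(c, d) \<in> I \<times> I. c \<noteq> d})"
  have finII: "finite {(c, d) \<in> I \<times> I. c \<noteq> d}" using fin by (auto intro: finite_subset[of _ "I \<times> I"])
  have W2: "openin (unit_space G) W2"
  proof (cases "{(c, d) \<in> I \<times> I. c \<noteq> d} = {}")
    case True then show ?thesis unfolding W2_def using W1 by (simp only: True) simp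
  next
    case False then show ?thesis unfolding W2_def using W1 ne finII by (intro openin_Int openin_INT2) auto
  qed
  have \<tau>x: "\<tau> c x = c" if "c \<in> I" for c using U(6)[OF that U(2)[OF that]] that by (simp add: I_def)
  have xW2: "x \<in> W2" using xW1 by (auto simp: W2_def \<tau>x)
  define W where "W = W0 \<inter> W2 \<inter> (topspace (unit_space G) - B)"
  have "local_triv A x I W \<tau>"
    unfolding local_triv_def
  proof (intro conjI ballI)
    show "openin (unit_space G) W" unfolding W_def B_def
      using L0 W2 B by (intro openin_Int openin_diff openin_topspace)
    show "x \<in> W" using L0 xW2 xB x by (simp add: W_def)
    show "continuous_map (subtopology (unit_space G) W) T (\<tau> c)" if "c \<in> I" for c
      by (rule continuous_map_from_subtopology_mono[OF cW1[OF that]]) (auto simp: W_def W2_def)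
    show "\<tau> c y \<in> Fb y" if c: "c \<in> I" and y: "y \<in> W" for c y
    proof -
      have "y \<in> r ` U c" using y W1sub[OF c] by (auto simp: W_def W2_def)
      then obtain d where "d \<in> U c" "y = r d" by blast
      then show ?thesis using U(6)[OF c] UA[OF c] by auto
    qed
    show "inj_on (\<lambda>c. \<tau> c y) I" if "y \<in> W" for y
      using that by (auto simp: W_def W2_def inj_on_def)
    show "A \<inter> Fb y \<subseteq> (\<lambda>c. \<tau> c y) ` I" if y: "y \<in> W" for y
    proof
      fix d assume d: "d \<in> A \<inter> Fb y"
      then have "d \<in> A0" using y L0 by (auto simp: W_def A0_def)
      moreover have "r d \<notin> B" using y d by (auto simp: W_def)
      ultimately obtain c where "c \<in> I" "d \<in> U c" using d by (auto simp: B_def)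
      then show "d \<in> (\<lambda>c. \<tau> c y) ` I" using U(6) d by (auto intro!: image_eqI[of _ _ c])
    qed
  qed (use fin I_def in auto)
  then show ?thesis by blast
qed

lemma finite_fibre_rproper: 
  assumes "rproper A" shows "finite (A \<inter> Fb x)"
proof (cases "x \<in> units G")
  case True then show ?thesis using local_triv_exists[OF assms] by (auto simp: local_triv_def)
next
  case False then have "A \<inter> Fb x = {}" by (auto simp: units_eq)
  then show ?thesis by (metis finite.emptyI)
qed

text \<open>Over a local trivialisation the sum runs over a fixed finite set of sheets, hence is a
  finite sum of continuous functions; where a sheet has left \<open>A\<close>, its term vanishes by
  \<open>supp\<close>. All continuity of sums over varying fibres goes through this lemma.\<close>

lemma fibre_sum_continuous:
  fixes F :: "'z \<Rightarrow> 'g \<Rightarrow> 'b::real_normed_vector"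
  assumes A: "rproper A" and q: "continuous_map Z (unit_space G) q"
    and F: "continuous_map (subtopology (prod_topology Z T) {(z, c). q z = r c}) euclidean (\<lambda>(z, c). F z c)"
    and supp: "\<And>z c. z \<in> topspace Z \<Longrightarrow> c \<in> Fb (q z) \<Longrightarrow> c \<notin> A \<Longrightarrow> F z c = 0"
  shows "continuous_map Z euclidean (\<lambda>z. \<Sum>c\<in>A \<inter> Fb (q z). F z c)"
proof (rule continuous_map_locally)
  fix z0 assume z0: "z0 \<in> topspace Z"
  then have "q z0 \<in> units G" using q by (simp add: cont_unit_space_iff)
  from local_triv_exists[OF A this] obtain I W \<tau> where "local_triv A (q z0) I W \<tau>" by blast
  then have I: "finite I" "openin (unit_space G) W" "q z0 \<in> W"
    "\<And>c. c \<in> I \<Longrightarrow> continuous_map (subtopology (unit_space G) W) T (\<tau> c)"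
    "\<And>c y. c \<in> I \<Longrightarrow> y \<in> W \<Longrightarrow> \<tau> c y \<in> Fb y"
    "\<And>y. y \<in> W \<Longrightarrow> inj_on (\<lambda>c. \<tau> c y) I"
    "\<And>y. y \<in> W \<Longrightarrow> A \<inter> Fb y \<subseteq> (\<lambda>c. \<tau> c y) ` I"
    unfolding local_triv_def by blast+
  define N where "N = {z \<in> topspace Z. q z \<in> W}"
  have N: "openin Z N" unfolding N_def using q I by (intro openin_continuous_map_preimage)
  have "continuous_map (subtopology Z N) (unit_space G) q" using q by (rule continuous_map_from_subtopology)
  then have qN: "continuous_map (subtopology Z N) (subtopology (unit_space G) W) q"
    by (auto simp: continuous_map_in_subtopology N_def)
  have c: "continuous_map (subtopology Z N) euclidean (\<lambda>z. F z (\<tau> c (q z)))" if c: "c \<in> I" for c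
  proof -
    have "continuous_map (subtopology Z N) T (\<lambda>z. \<tau> c (q z))"
      using continuous_map_compose[OF qN I(4)[OF c]] by (simp add: o_def)
    then have "continuous_map (subtopology Z N) (subtopology (prod_topology Z T) {(z, c). q z = r c}) (\<lambda>z. (z, \<tau> c (q z)))"
      using I(5)[OF c] by (auto simp: continuous_map_in_subtopology N_def intro!: continuous_map_pairedI)
    from continuous_map_compose[OF this F] show ?thesis by (simp add: o_def)
  qed
  have "continuous_map (subtopology Z N) euclidean (\<lambda>z. \<Sum>c\<in>I. F z (\<tau> c (q z)))"
    using c I(1) by (intro continuous_map_sum) auto
  moreover have "(\<Sum>c\<in>I. F z (\<tau> c (q z))) = (\<Sum>c\<in>A \<inter> Fb (q z). F z c)" if z: "z \<in> topspace (subtopology Z N)" for z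
  proof -
    have zz: "z \<in> topspace Z" "q z \<in> W" using z by (auto simp: N_def)
    have "(\<Sum>c\<in>I. F z (\<tau> c (q z))) = (\<Sum>c\<in>(\<lambda>c. \<tau> c (q z)) ` I. F z c)"
      using I(6)[OF zz(2)] by (simp add: sum.reindex)
    also have "\<dots> = (\<Sum>c\<in>A \<inter> Fb (q z). F z c)"
    proof (rule sum.mono_neutral_right)
      show "\<forall>d\<in>(\<lambda>c. \<tau> c (q z)) ` I - A \<inter> Fb (q z). F z d = 0"
      proof
        fix d assume d: "d \<in> (\<lambda>c. \<tau> c (q z)) ` I - A \<inter> Fb (q z)"
        then have "d \<in> Fb (q z)" using I(5)[OF _ zz(2)] by blast
        then show "F z d = 0" using d supp[OF zz(1), of d] by blast
      qed
    qed (use I(1) I(7)[OF zz(2)] in auto)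
    finally show ?thesis .
  qed
  ultimately have "continuous_map (subtopology Z N) euclidean (\<lambda>z. \<Sum>c\<in>A \<inter> Fb (q z). F z c)"
    by (rule continuous_map_eq)
  then show "\<exists>N. openin Z N \<and> z0 \<in> N \<and> continuous_map (subtopology Z N) euclidean (\<lambda>z. \<Sum>c\<in>A \<inter> Fb (q z). F z c)"
    using N z0 I(3) by (intro exI[of _ N]) (auto simp: N_def)
qed

text \<open>The number of sheets bounds the fibre size locally, and finitely many trivialisations
  cover the compact image of \<open>C\<close>. The bound enters the Schur test for kernels supported
  in a tube.\<close>

lemma bounded_fibre_card:
  assumes C: "compactin T C"
  shows "\<exists>N. \<forall>x. card (C \<inter> Fb x) \<le> N"
proof -
  have A: "rproper C" using C by (rule rproper_compact)
  have "\<exists>W n. openin (unit_space G) W \<and> x \<in> W \<and> (\<forall>y\<in>W. card (C \<inter> Fb y) \<le> n)" if "x \<in> units G" for x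
  proof -
    from local_triv_exists[OF A that] obtain I W \<tau> where "local_triv C x I W \<tau>" by blast
    then have I: "finite I" "openin (unit_space G) W" "x \<in> W"
      "\<And>y. y \<in> W \<Longrightarrow> C \<inter> Fb y \<subseteq> (\<lambda>c. \<tau> c y) ` I"
      unfolding local_triv_def by blast+
    have "card (C \<inter> Fb y) \<le> card I" if "y \<in> W" for y
      using card_mono[OF _ I(4)[OF that]] card_image_le[OF I(1)] I(1) by (meson finite_imageI le_trans)
    with I show ?thesis by blast
  qed
  then obtain W n where W: "\<And>x. x \<in> units G \<Longrightarrow> openin (unit_space G) (W x)" "\<And>x. x \<in> units G \<Longrightarrow> x \<in> W x"
    "\<And>x y. x \<in> units G \<Longrightarrow> y \<in> W x \<Longrightarrow> card (C \<inter> Fb y) \<le> n x"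
    by metis
  have CA: "C \<subseteq> Ar" using compactin_subset_topspace[OF C] by simp
  have "compactin (unit_space G) (r ` C)" using C cont_r_unit_space image_compactin by blast
  moreover have rC: "r ` C \<subseteq> units G" using CA by auto
  ultimately obtain J where J: "finite J" "J \<subseteq> r ` C" "r ` C \<subseteq> (\<Union>x\<in>J. W x)"
    using compactin_pointwise_cover[of "unit_space G" "r ` C" W] W(1,2) by blast
  have "card (C \<inter> Fb y) \<le> (\<Sum>x\<in>J. n x)" for y
  proof (cases "y \<in> r ` C")
    case True
    then obtain x where x: "x \<in> J" "y \<in> W x" using J by blast
    then have "x \<in> units G" using J rC by blast
    then have "card (C \<inter> Fb y) \<le> n x" using W(3) x by blast
    also have "\<dots> \<le> (\<Sum>x\<in>J. n x)" using x J by (intro member_le_sum) auto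
    finally show ?thesis .
  next
    case False
    then have "C \<inter> Fb y = {}" by auto
    then show ?thesis by (metis card.empty le0)
  qed
  then show ?thesis by blast
qed

lemma compact_Urysohn_open:
  assumes K: "compactin T K" and V: "openin T V" "K \<subseteq> V"
  shows "\<exists>(f :: 'g \<Rightarrow> real) C. continuous_map T euclideanreal f \<and> (\<forall>c\<in>Ar. 0 \<le> f c \<and> f c \<le> 1) \<and>
    (\<forall>c\<in>K. f c = 1) \<and> compactin T C \<and> (\<forall>c\<in>Ar. c \<notin> C \<or> c \<notin> V \<longrightarrow> f c = 0) \<and> K \<subseteq> C"
proof -
  obtain U C where U: "openin T U" "compactin T C" "K \<subseteq> U" "U \<subseteq> C"
    using lc_T Hausdorff_T K locally_compact_space_compact_closed_compact by metis
  have "completely_regular_space T"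
    using lc_T Hausdorff_T locally_compact_regular_imp_completely_regular_space by blast
  moreover have "closedin T (topspace T - (U \<inter> V))" using U V by blast
  moreover have "disjnt K (topspace T - (U \<inter> V))" using U V by (auto simp: disjnt_def)
  ultimately obtain f where f: "continuous_map T (top_of_set {0..1::real}) f" "f ` (topspace T - (U \<inter> V)) \<subseteq> {0}" "f ` K \<subseteq> {1}"
    using Urysohn_completely_regular_compact_closed[of "0::real" 1 T K "topspace T - (U \<inter> V)"] K by auto
  show ?thesis
  proof (intro exI[of _ f] exI[of _ C] conjI ballI impI)
    show "continuous_map T euclideanreal f" using f(1) continuous_map_into_fulltopology by blast
    have "f c \<in> {0..1}" if "c \<in> Ar" for c
      using f(1) that by (auto simp: continuous_map_in_subtopology)
    then show "0 \<le> f c" "f c \<le> 1" if "c \<in> Ar" for c using that by auto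
    show "f c = 1" if "c \<in> K" for c using f(3) that by auto
    show "f c = 0" if "c \<in> Ar" "c \<notin> C \<or> c \<notin> V" for c using f(2) U that by auto
  qed (use U in auto)
qed

lemma compact_Urysohn:
  assumes K: "compactin T K"
  shows "\<exists>(f :: 'g \<Rightarrow> real) C. continuous_map T euclideanreal f \<and> (\<forall>c\<in>Ar. 0 \<le> f c \<and> f c \<le> 1) \<and>
    (\<forall>c\<in>K. f c = 1) \<and> compactin T C \<and> (\<forall>c\<in>Ar. c \<notin> C \<longrightarrow> f c = 0) \<and> K \<subseteq> C"
  using compact_Urysohn_open[OF K openin_topspace compactin_subset_topspace[OF K]] by blast

text \<open>The last clause provides open sets between consecutive members: the conditions defining
  Y have to be indexed by open sets of arrows in order to be closed.\<close>

lemma compact_exhaustion: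
  assumes "second_countable T"
  shows "\<exists>K :: nat \<Rightarrow> 'g set. (\<forall>n. compactin T (K n)) \<and>
    (\<forall>C. compactin T C \<longrightarrow> (\<exists>n0. \<forall>n\<ge>n0. C \<subseteq> K n)) \<and>
    (\<forall>n. \<exists>U. openin T U \<and> K n \<subseteq> U \<and> U \<subseteq> K (Suc n))"
proof -
  obtain \<B> where B: "countable \<B>" "\<And>V. V \<in> \<B> \<Longrightarrow> openin T V"
    "\<And>U x. openin T U \<Longrightarrow> x \<in> U \<Longrightarrow> \<exists>V \<in> \<B>. x \<in> V \<and> V \<subseteq> U"
    using assms unfolding second_countable_def by metis
  \<comment> \<open>The empty set is added so that the countable family can be enumerated even if it
    has no other member.\<close>
  define \<C> where "\<C> = insert {} {V \<in> \<B>. \<exists>C. compactin T C \<and> V \<subseteq> C}"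
  have cC: "countable \<C>" "\<C> \<noteq> {}" using B(1) by (auto simp: \<C>_def)
  define V where "V = from_nat_into \<C>"
  have V: "range V = \<C>" unfolding V_def using cC by (simp add: range_from_nat_into)
  have oV: "openin T (V n)" for n using V B(2) by (metis (no_types, lifting) \<C>_def insertE mem_Collect_eq openin_empty rangeI)
  have "\<exists>C. compactin T C \<and> V n \<subseteq> C" for n
    using V rangeI[of V n] unfolding \<C>_def by auto
  then obtain D where D: "\<And>n. compactin T (D n)" "\<And>n. V n \<subseteq> D n" by metis
  have cov: "\<exists>n. x \<in> V n" if "x \<in> Ar" for x
  proof -
    have "\<exists>U C. openin T U \<and> compactin T C \<and> x \<in> U \<and> U \<subseteq> C"
      using lc_T that unfolding locally_compact_space_def by simp
    then obtain U C where "openin T U" "compactin T C" "x \<in> U" "U \<subseteq> C" by blast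
    then obtain W where "W \<in> \<B>" "x \<in> W" "W \<subseteq> C" using B(3)[of U x] by blast
    then have "W \<in> \<C>" using \<open>compactin T C\<close> by (auto simp: \<C>_def)
    then show ?thesis using V \<open>x \<in> W\<close> by (metis image_iff)
  qed
  have step: "\<exists>K'. compactin T K' \<and> (\<exists>U. openin T U \<and> K \<subseteq> U \<and> U \<subseteq> K')" if "compactin T K" for K
    using lc_T Hausdorff_T that locally_compact_space_compact_closed_compact by metis
  define nx where "nx K = (SOME K'. compactin T K' \<and> (\<exists>U. openin T U \<and> K \<subseteq> U \<and> U \<subseteq> K'))" for K
  have nx: "compactin T (nx K)" "\<exists>U. openin T U \<and> K \<subseteq> U \<and> U \<subseteq> nx K" if "compactin T K" for K
    using someI_ex[OF step[OF that]] by (auto simp: nx_def)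
  define K where "K = rec_nat {} (\<lambda>n k. nx (k \<union> D n))"
  have K: "K 0 = {}" "K (Suc n) = nx (K n \<union> D n)" for n by (simp_all add: K_def)
  have cK: "compactin T (K n)" for n
    by (induction n) (auto simp: K intro!: nx compactin_Un D)
  have sK: "\<exists>U. openin T U \<and> K n \<union> D n \<subseteq> U \<and> U \<subseteq> K (Suc n)" for n
    unfolding K(2) by (intro nx compactin_Un cK D)
  have mono: "K m \<subseteq> K n" if "m \<le> n" for m n
    using that by (rule lift_Suc_mono_le[rotated]) (use sK in blast)
  show ?thesis
  proof (rule exI[of _ K], intro conjI allI impI)
    show "compactin T (K n)" for n by (rule cK)
    show "\<exists>U. openin T U \<and> K n \<subseteq> U \<and> U \<subseteq> K (Suc n)" for n
    proof -
      obtain U where "openin T U" "K n \<union> D n \<subseteq> U" "U \<subseteq> K (Suc n)" using sK[of n] by blast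
      then show ?thesis by (intro exI[of _ U]) simp
    qed
    fix C assume C: "compactin T C"
    then have CA: "C \<subseteq> Ar" using compactin_subset_topspace by fastforce
    have "C \<subseteq> \<Union> (range V)" using CA cov by blast
    moreover have "openin T U" if "U \<in> range V" for U using oV that by auto
    ultimately obtain \<F> where F: "finite \<F>" "\<F> \<subseteq> range V" "C \<subseteq> \<Union>\<F>"
      using compactinD[OF C, of "range V"] by (auto simp: Ball_def)
    then obtain J where J: "finite J" "\<F> = V ` J" by (meson finite_subset_image)
    obtain N where N: "\<And>j. j \<in> J \<Longrightarrow> j < N" using J(1) by (auto simp: finite_nat_set_iff_bounded)
    have "C \<subseteq> K n" if "n \<ge> N" for n
    proof
      fix c assume "c \<in> C"
      then obtain j where j: "j \<in> J" "c \<in> V j" using F J by blast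
      then have "c \<in> K (Suc j)" using sK[of j] D by blast
      then show "c \<in> K n" using mono[of "Suc j" n] N[OF j(1)] that by auto
    qed
    then show "\<exists>n0. \<forall>n\<ge>n0. C \<subseteq> K n" by blast
  qed
qed

end

section \<open>Kernels and almost invariant functions\<close>

context etale
begin

abbreviation "RT \<equiv> rprod_space G"

lemma rprod_iff [simp]: "(\<gamma>, \<eta>) \<in> rprod G \<longleftrightarrow> \<gamma> \<in> Ar \<and> \<eta> \<in> Ar \<and> r \<gamma> = r \<eta>"
  by (auto simp: rprod_def)

lemma topspace_RT [simp]: "topspace RT = rprod G"
  by (auto simp: rprod_space_def rprod_def)

lemma cont_RT_fst: "continuous_map RT T fst" and cont_RT_snd: "continuous_map RT T snd"
  by (auto simp: rprod_space_def intro: continuous_map_fst_snd_subtopology)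

lemma cont_RT_apply:
  assumes "continuous_map RT Y k" "continuous_map Z T f" "continuous_map Z T g"
    "\<And>z. z \<in> topspace Z \<Longrightarrow> r (f z) = r (g z)"
  shows "continuous_map Z Y (\<lambda>z. k (f z, g z))"
proof -
  have "continuous_map Z RT (\<lambda>z. (f z, g z))"
    using assms cont_in_Ar[OF assms(2)] cont_in_Ar[OF assms(3)]
    by (auto simp: rprod_space_def continuous_map_in_subtopology continuous_map_pairedI)
  from continuous_map_compose[OF this assms(1)] show ?thesis by (simp add: o_def)
qed

definition diff_map :: "'g \<times> 'g \<Rightarrow> 'g" where
  "diff_map z = iv (fst z) \<odot> snd z"

lemma cont_diff_map: "continuous_map RT T diff_map"
  unfolding diff_map_def[abs_def] by (intro cont_mul' cont_iv' cont_RT_fst cont_RT_snd) auto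

lemma tube_iff: "tube G A \<longleftrightarrow> A \<subseteq> rprod G \<and> (\<exists>D. compactin T D \<and> diff_map ` A \<subseteq> D)"
proof -
  have eq: "(\<lambda>(\<gamma>, \<gamma>\<^sub>1). iv \<gamma> \<odot> \<gamma>\<^sub>1) ` A = diff_map ` A" by (force simp: diff_map_def image_iff split_beta)
  show ?thesis
  proof
    assume t: "tube G A"
    then have A: "A \<subseteq> rprod G" "compactin T (T closure_of (diff_map ` A))" "diff_map ` A \<subseteq> topspace T"
      by (auto simp: tube_def eq relatively_compact_in_def)
    moreover have "diff_map ` A \<subseteq> T closure_of (diff_map ` A)" using A(3) by (rule closure_of_subset)
    ultimately show "A \<subseteq> rprod G \<and> (\<exists>D. compactin T D \<and> diff_map ` A \<subseteq> D)" by blast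
  next
    assume "A \<subseteq> rprod G \<and> (\<exists>D. compactin T D \<and> diff_map ` A \<subseteq> D)"
    then obtain D where D: "A \<subseteq> rprod G" "compactin T D" "diff_map ` A \<subseteq> D" by blast
    then have "T closure_of (diff_map ` A) \<subseteq> D"
      by (intro closure_of_minimal compactin_closedin_T)
    then have "compactin T (T closure_of (diff_map ` A))"
      using D(2) by (meson closed_compactin closedin_closure_of)
    then show "tube G A"
      using D compactin_subset_topspace[OF D(2)] unfolding tube_def eq relatively_compact_in_def by blast
  qed
qed

text \<open>A compact set is closed and \<open>diff_map\<close> is continuous, so passing to the
  closure of the nonvanishing set does not enlarge the bound on differences.\<close>

lemma supported_in_tube_iff:
  "supported_in_tube G k \<longleftrightarrow> (\<exists>D. compactin T D \<and> (\<forall>z\<in>rprod G. k z \<noteq> 0 \<longrightarrow> diff_map z \<in> D))"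
proof
  assume "supported_in_tube G k"
  then obtain D where D: "compactin T D" "diff_map ` (RT closure_of {z \<in> rprod G. k z \<noteq> 0}) \<subseteq> D"
    unfolding supported_in_tube_def tube_iff by blast
  moreover have "{z \<in> rprod G. k z \<noteq> 0} \<subseteq> RT closure_of {z \<in> rprod G. k z \<noteq> 0}"
    by (intro closure_of_subset) auto
  ultimately show "\<exists>D. compactin T D \<and> (\<forall>z\<in>rprod G. k z \<noteq> 0 \<longrightarrow> diff_map z \<in> D)" by blast
next
  assume "\<exists>D. compactin T D \<and> (\<forall>z\<in>rprod G. k z \<noteq> 0 \<longrightarrow> diff_map z \<in> D)"
  then obtain D where D: "compactin T D" "\<forall>z\<in>rprod G. k z \<noteq> 0 \<longrightarrow> diff_map z \<in> D" by blast
  have "closedin RT {z \<in> topspace RT. diff_map z \<in> D}"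
    using cont_diff_map compactin_closedin_T[OF D(1)] by (rule closedin_continuous_map_preimage)
  then have "RT closure_of {z \<in> rprod G. k z \<noteq> 0} \<subseteq> {z \<in> topspace RT. diff_map z \<in> D}"
    by (intro closure_of_minimal) (use D(2) in auto)
  then show "supported_in_tube G k"
    unfolding supported_in_tube_def tube_iff using D(1) by auto
qed

section \<open>Almost invariant functions and their Gram kernels\<close>

text \<open>The row of \<gamma> is \<zeta> \<mapsto>
  \<open>a \<gamma> (iv \<gamma> \<odot> \<zeta>)\<close> on the range fibre. The last sum is the
  inner product of the rows of \<gamma> and \<open>\<gamma> \<odot> d\<close>, since
  \<open>iv (\<gamma> \<odot> d) \<odot> (\<gamma> \<odot> c)\<close> equals
  \<open>iv d \<odot> c\<close>.\<close>

definition almost_inv :: "('g \<Rightarrow> 'g \<Rightarrow> real) \<Rightarrow> 'g set \<Rightarrow> 'g set \<Rightarrow> real \<Rightarrow> bool" where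
  "almost_inv a C K \<epsilon> \<longleftrightarrow> compactin T C \<and> continuous_map CT euclidean (\<lambda>(\<gamma>, c). a \<gamma> c) \<and>
    (\<forall>\<gamma>\<in>Ar. \<forall>c\<in>Fb (s \<gamma>) - C. a \<gamma> c = 0) \<and>
    (\<forall>\<gamma>\<in>Ar. (\<Sum>c\<in>C \<inter> Fb (s \<gamma>). (a \<gamma> c)\<^sup>2) \<le> 1) \<and>
    (\<forall>\<gamma>\<in>Ar. \<forall>d\<in>K. s \<gamma> = r d \<longrightarrow> 1 - \<epsilon> \<le> (\<Sum>c\<in>C \<inter> Fb (s \<gamma>). a \<gamma> c * a (\<gamma> \<odot> d) (iv d \<odot> c)))"

definition almost_inv_families :: bool where
  "almost_inv_families \<longleftrightarrow> (\<forall>K \<epsilon>. compactin T K \<and> 0 < \<epsilon> \<longrightarrow> (\<exists>a C. almost_inv a C K \<epsilon>))"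

lemma almost_inv_zero:
  "almost_inv a C K \<epsilon> \<Longrightarrow> \<gamma> \<in> Ar \<Longrightarrow> c \<in> Fb (s \<gamma>) \<Longrightarrow> c \<notin> C \<Longrightarrow> a \<gamma> c = 0"
  by (auto simp: almost_inv_def)

lemma almost_inv_ge:
  "almost_inv a C K \<epsilon> \<Longrightarrow> \<gamma> \<in> Ar \<Longrightarrow> d \<in> K \<Longrightarrow> s \<gamma> = r d \<Longrightarrow>
    1 - \<epsilon> \<le> (\<Sum>c\<in>C \<inter> Fb (s \<gamma>). a \<gamma> c * a (\<gamma> \<odot> d) (iv d \<odot> c))"
  unfolding almost_inv_def by blast

text \<open>Left translation by \<gamma> is a bijection between the fibres over
  \<open>s \<gamma>\<close> and \<open>r \<gamma>\<close>. Letting \<open>J\<close> be any finite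
  superset of the translated support allows sums attached to several arrows to share one index
  set.\<close>

lemma sum_translate:
  fixes f :: "'g \<Rightarrow> 'b::real_algebra"
  assumes \<gamma>: "\<gamma> \<in> Ar" and J: "finite J" "J \<subseteq> Fb (r \<gamma>)" "(\<lambda>c. \<gamma> \<odot> c) ` (B \<inter> Fb (s \<gamma>)) \<subseteq> J"
    and supp: "\<And>c. c \<in> Fb (s \<gamma>) \<Longrightarrow> c \<notin> B \<Longrightarrow> f (\<gamma> \<odot> c) = 0"
  shows "(\<Sum>c\<in>B \<inter> Fb (s \<gamma>). f (\<gamma> \<odot> c)) = (\<Sum>\<zeta>\<in>J. f \<zeta>)"
proof -
  have inj: "inj_on (\<lambda>c. \<gamma> \<odot> c) (B \<inter> Fb (s \<gamma>))"
    using bij_betw_imp_inj_on[OF bij_translate[OF \<gamma>]] by (rule inj_on_subset) auto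
  have "(\<Sum>c\<in>B \<inter> Fb (s \<gamma>). f (\<gamma> \<odot> c)) = (\<Sum>\<zeta>\<in>(\<lambda>c. \<gamma> \<odot> c) ` (B \<inter> Fb (s \<gamma>)). f \<zeta>)"
    using inj by (simp add: sum.reindex)
  also have "\<dots> = (\<Sum>\<zeta>\<in>J. f \<zeta>)"
  proof (rule sum.mono_neutral_left[OF J(1) J(3)], rule)
    fix \<zeta> assume \<zeta>: "\<zeta> \<in> J - (\<lambda>c. \<gamma> \<odot> c) ` (B \<inter> Fb (s \<gamma>))"
    then have z: "\<zeta> \<in> Ar" "r \<zeta> = r \<gamma>" using J(2) by auto
    define c where "c = iv \<gamma> \<odot> \<zeta>"
    have c: "c \<in> Fb (s \<gamma>)" "\<gamma> \<odot> c = \<zeta>" using z \<gamma> by (auto simp: c_def)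
    then have "c \<notin> B" using \<zeta> by auto
    then show "f \<zeta> = 0" using supp[OF c(1)] c(2) by simp
  qed
  finally show ?thesis .
qed

lemma compact_inverse: "compactin T C \<Longrightarrow> compactin T (iv ` C)"
  using cont_iv image_compactin by blast

text \<open>The Gram kernel of the vectors \<open>\<zeta> \<mapsto> a \<gamma> (\<gamma>\<inverse> \<zeta>)\<close> on a range fibre.\<close>

definition gram :: "('g \<Rightarrow> 'g \<Rightarrow> real) \<Rightarrow> 'g set \<Rightarrow> 'g \<times> 'g \<Rightarrow> real" where
  "gram a C z = (\<Sum>c\<in>C \<inter> Fb (s (fst z)). a (fst z) c * a (snd z) (iv (snd z) \<odot> (fst z \<odot> c)))"

text \<open>The definition of \<open>gram\<close> sums over the support of the first row only; here
  both rows appear symmetrically over a common finite set.\<close>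

lemma gram_eq:
  assumes a: "almost_inv a C K \<epsilon>" and z: "\<gamma> \<in> Ar" "\<eta> \<in> Ar" "r \<gamma> = r \<eta>"
    and J: "finite J" "J \<subseteq> Fb (r \<gamma>)" "(\<lambda>c. \<gamma> \<odot> c) ` (C \<inter> Fb (s \<gamma>)) \<subseteq> J"
  shows "gram a C (\<gamma>, \<eta>) = (\<Sum>\<zeta>\<in>J. a \<gamma> (iv \<gamma> \<odot> \<zeta>) * a \<eta> (iv \<eta> \<odot> \<zeta>))"
proof -
  have "gram a C (\<gamma>, \<eta>) = (\<Sum>c\<in>C \<inter> Fb (s \<gamma>). (\<lambda>\<zeta>. a \<gamma> (iv \<gamma> \<odot> \<zeta>) * a \<eta> (iv \<eta> \<odot> \<zeta>)) (\<gamma> \<odot> c))"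
    unfolding gram_def using z by (intro sum.cong) auto
  also have "\<dots> = (\<Sum>\<zeta>\<in>J. a \<gamma> (iv \<gamma> \<odot> \<zeta>) * a \<eta> (iv \<eta> \<odot> \<zeta>))"
    by (rule sum_translate[OF z(1) J]) (use a z in \<open>auto simp: almost_inv_def\<close>)
  finally show ?thesis .
qed

lemma finite_C: "almost_inv a C K \<epsilon> \<Longrightarrow> finite (C \<inter> Fb x)"
  unfolding almost_inv_def by (intro finite_fibre_rproper rproper_compact) blast

lemma gram_diag: 
  assumes "almost_inv a C K \<epsilon>" "\<gamma> \<in> Ar"
  shows "gram a C (\<gamma>, \<gamma>) = (\<Sum>c\<in>C \<inter> Fb (s \<gamma>). (a \<gamma> c)\<^sup>2)"
    "0 \<le> gram a C (\<gamma>, \<gamma>)" "gram a C (\<gamma>, \<gamma>) \<le> 1"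
proof -
  show *: "gram a C (\<gamma>, \<gamma>) = (\<Sum>c\<in>C \<inter> Fb (s \<gamma>). (a \<gamma> c)\<^sup>2)"
    unfolding gram_def using assms(2) by (intro sum.cong) (auto simp: power2_eq_square)
  show "0 \<le> gram a C (\<gamma>, \<gamma>)" unfolding * by (intro sum_nonneg) auto
  show "gram a C (\<gamma>, \<gamma>) \<le> 1" unfolding * using assms by (auto simp: almost_inv_def)
qed

lemma gram_bound:
  assumes a: "almost_inv a C K \<epsilon>" and z: "\<gamma> \<in> Ar" "\<eta> \<in> Ar" "r \<gamma> = r \<eta>"
  shows "\<bar>gram a C (\<gamma>, \<eta>)\<bar> \<le> 1"
proof -
  \<comment> \<open>A finite set holding the supports of both rows, so that the three Gram entries
    become sums over the same set.\<close>
  define J where "J = (\<lambda>c. \<gamma> \<odot> c) ` (C \<inter> Fb (s \<gamma>)) \<union> (\<lambda>c. \<eta> \<odot> c) ` (C \<inter> Fb (s \<eta>))"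
  have J: "finite J" "J \<subseteq> Fb (r \<gamma>)" "J \<subseteq> Fb (r \<eta>)"
    using finite_C[OF a] z by (auto simp: J_def)
  define f where "f \<zeta> = a \<gamma> (iv \<gamma> \<odot> \<zeta>)" for \<zeta>
  define g where "g \<zeta> = a \<eta> (iv \<eta> \<odot> \<zeta>)" for \<zeta>
  have 1: "gram a C (\<gamma>, \<eta>) = (\<Sum>\<zeta>\<in>J. f \<zeta> * g \<zeta>)"
    "gram a C (\<gamma>, \<gamma>) = (\<Sum>\<zeta>\<in>J. f \<zeta> * f \<zeta>)" "gram a C (\<eta>, \<eta>) = (\<Sum>\<zeta>\<in>J. g \<zeta> * g \<zeta>)"
    unfolding f_def g_def by (rule gram_eq[OF a]; use z J in \<open>auto simp: J_def\<close>)+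
  have "\<bar>f \<zeta> * g \<zeta>\<bar> \<le> (f \<zeta> * f \<zeta> + g \<zeta> * g \<zeta>) / 2" for \<zeta>
  proof -
    have "0 \<le> (f \<zeta> - g \<zeta>)\<^sup>2" "0 \<le> (f \<zeta> + g \<zeta>)\<^sup>2" by simp_all
    then show ?thesis by (simp add: abs_if power2_eq_square algebra_simps)
  qed
  then have "\<bar>gram a C (\<gamma>, \<eta>)\<bar> \<le> (\<Sum>\<zeta>\<in>J. (f \<zeta> * f \<zeta> + g \<zeta> * g \<zeta>) / 2)"
    unfolding 1(1) by (intro order_trans[OF sum_abs] sum_mono)
  also have "\<dots> = (gram a C (\<gamma>, \<gamma>) + gram a C (\<eta>, \<eta>)) / 2"
    by (simp add: 1(2,3) sum.distrib flip: sum_divide_distrib)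
  also have "\<dots> \<le> 1" using gram_diag(3)[OF a z(1)] gram_diag(3)[OF a z(2)] by simp
  finally show ?thesis .
qed

lemma gram_continuous:
  assumes a: "almost_inv a C K \<epsilon>"
  shows "continuous_map RT euclidean (gram a C)"
proof -
  have ca: "continuous_map CT euclidean (\<lambda>(\<gamma>, c). a \<gamma> c)" and C: "compactin T C" using a by (auto simp: almost_inv_def)
  let ?S = "subtopology (prod_topology RT T) {(z, c). s (fst z) = r c}"
  have c1: "continuous_map ?S T (\<lambda>w. fst (fst w))" "continuous_map ?S T (\<lambda>w. snd (fst w))" "continuous_map ?S T snd"
    using continuous_map_compose[OF _ cont_RT_fst, of ?S fst] continuous_map_compose[OF _ cont_RT_snd, of ?S fst]
    by (auto simp: o_def intro: continuous_map_fst_snd_subtopology)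
  have mm: "continuous_map ?S T (\<lambda>w. fst (fst w) \<odot> snd w)"
    using c1 by (intro cont_mul') auto
  have c2: "continuous_map ?S T (\<lambda>w. iv (snd (fst w)) \<odot> (fst (fst w) \<odot> snd w))"
    by (intro cont_mul' cont_iv' c1 mm) auto
  have "continuous_map ?S euclidean (\<lambda>w. a (fst (fst w)) (snd w) * a (snd (fst w)) (iv (snd (fst w)) \<odot> (fst (fst w) \<odot> snd w)))"
    by (intro continuous_map_real_mult cont_CT_apply[OF ca] c1 c2) auto
  then have "continuous_map RT euclidean (\<lambda>z. \<Sum>c\<in>C \<inter> Fb (s (fst z)). a (fst z) c * a (snd z) (iv (snd z) \<odot> (fst z \<odot> c)))"
    by (intro fibre_sum_continuous rproper_compact C)
      (use a in \<open>auto simp: cont_unit_space_iff case_prod_beta' almost_inv_def intro: cont_s' cont_RT_fst\<close>)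
  then show ?thesis by (simp add: gram_def[abs_def])
qed

text \<open>Over a common finite set \<open>J\<close> the form is the sum over \<zeta> of the
  squared modulus of the combination of the rows at \<zeta>.\<close>

lemma gram_positive_definite:
  assumes a: "almost_inv a C K \<epsilon>"
  shows "positive_definite_kernel G (\<lambda>z. complex_of_real (gram a C z))"
  unfolding positive_definite_kernel_def
proof (intro ballI allI impI)
  fix x and n :: nat and \<gamma> :: "nat \<Rightarrow> 'g" and \<alpha> :: "nat \<Rightarrow> complex"
  assume x: "x \<in> units G" and \<gamma>: "\<forall>i<n. \<gamma> i \<in> Fb x"
  define J where "J = (\<Union>i<n. (\<lambda>c. \<gamma> i \<odot> c) ` (C \<inter> Fb (s (\<gamma> i))))"
  have J: "finite J" using finite_C[OF a] by (auto simp: J_def)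
  have J2: "J \<subseteq> Fb x" using \<gamma> by (auto simp: J_def)
  define f where "f i \<zeta> = complex_of_real (a (\<gamma> i) (iv (\<gamma> i) \<odot> \<zeta>))" for i \<zeta>
  have g: "complex_of_real (gram a C (\<gamma> i, \<gamma> j)) = (\<Sum>\<zeta>\<in>J. f i \<zeta> * f j \<zeta>)" if "i < n" "j < n" for i j
  proof -
    have "gram a C (\<gamma> i, \<gamma> j) = (\<Sum>\<zeta>\<in>J. a (\<gamma> i) (iv (\<gamma> i) \<odot> \<zeta>) * a (\<gamma> j) (iv (\<gamma> j) \<odot> \<zeta>))"
      using that \<gamma> J2 by (intro gram_eq[OF a] J) (auto simp: J_def)
    then show ?thesis by (simp add: f_def)
  qed
  have "(\<Sum>i<n. \<Sum>j<n. cnj (\<alpha> i) * \<alpha> j * complex_of_real (gram a C (\<gamma> i, \<gamma> j)))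
    = (\<Sum>i<n. \<Sum>j<n. \<Sum>\<zeta>\<in>J. cnj (\<alpha> i * f i \<zeta>) * (\<alpha> j * f j \<zeta>))"
    by (intro sum.cong refl) (simp add: g sum_distrib_left f_def mult_ac)
  also have "\<dots> = (\<Sum>\<zeta>\<in>J. \<Sum>i<n. \<Sum>j<n. cnj (\<alpha> i * f i \<zeta>) * (\<alpha> j * f j \<zeta>))"
    by (subst sum.swap[of _ J "{..<n}"], subst (2) sum.swap, simp)
  also have "\<dots> = (\<Sum>\<zeta>\<in>J. cnj (\<Sum>i<n. \<alpha> i * f i \<zeta>) * (\<Sum>j<n. \<alpha> j * f j \<zeta>))"
    by (simp add: sum_product)
  also have "\<dots> = complex_of_real (\<Sum>\<zeta>\<in>J. (cmod (\<Sum>i<n. \<alpha> i * f i \<zeta>))\<^sup>2)"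
    by (simp only: of_real_sum complex_norm_square mult.commute)
  also have "\<dots> \<in> \<real>\<^sub>\<ge>\<^sub>0"
    by (simp only: nonneg_Reals_of_real_iff) (intro sum_nonneg, simp)
  finally show "(\<Sum>i<n. \<Sum>j<n. cnj (\<alpha> i) * \<alpha> j * complex_of_real (gram a C (\<gamma> i, \<gamma> j))) \<in> \<real>\<^sub>\<ge>\<^sub>0" .
qed

text \<open>A nonzero term has \<open>c\<close> and d =
  \<open>iv \<eta> \<odot> (\<gamma> \<odot> c)\<close> both in \<open>C\<close>, and then
  \<open>iv \<gamma> \<odot> \<eta>\<close> is \<open>c \<odot> iv d\<close>. So differences stay in
  the compact product of \<open>C\<close> with its inverse.\<close>

lemma gram_supported:
  assumes a: "almost_inv a C K \<epsilon>"
  shows "supported_in_tube G (\<lambda>z. complex_of_real (gram a C z))"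
  unfolding supported_in_tube_iff
proof (intro exI conjI ballI impI)
  have C: "compactin T C" using a by (auto simp: almost_inv_def)
  then show "compactin T (prod_set C (iv ` C))" by (intro compactin_prod_set compact_inverse)
  fix z assume z: "z \<in> rprod G" "complex_of_real (gram a C z) \<noteq> 0"
  obtain \<gamma> \<eta> where ge: "z = (\<gamma>, \<eta>)" "\<gamma> \<in> Ar" "\<eta> \<in> Ar" "r \<gamma> = r \<eta>" using z by (cases z) auto
  have "gram a C z \<noteq> 0" using z by simp
  then obtain c where c: "c \<in> C \<inter> Fb (s \<gamma>)" "a \<eta> (iv \<eta> \<odot> (\<gamma> \<odot> c)) \<noteq> 0"
    unfolding gram_def ge fst_conv snd_conv by (elim sum.not_neutral_contains_not_neutral) auto
  define d where "d = iv \<eta> \<odot> (\<gamma> \<odot> c)"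
  have cc: "c \<in> Ar" "r c = s \<gamma>" using c by auto
  have d: "d \<in> Ar" "r d = s \<eta>" "s d = s c" using cc ge by (auto simp: d_def)
  then have "d \<in> C" using almost_inv_zero[OF a ge(3), of d] c(2) by (auto simp: d_def)
  have "iv d = iv c \<odot> (iv \<gamma> \<odot> \<eta>)" unfolding d_def using cc ge by (simp add: inv_mul mul_assoc)
  then have "diff_map z = c \<odot> iv d" using cc ge by (simp add: diff_map_def)
  then show "diff_map z \<in> prod_set C (iv ` C)"
    using c \<open>d \<in> C\<close> d by (auto intro!: prod_setI)
qed

theorem kernels_of_almost_inv:
  assumes sc: "second_countable T" and fam: almost_inv_families
  shows "\<exists>k :: nat \<Rightarrow> 'g \<times> 'g \<Rightarrow> complex.
               (\<forall>n. bounded (k n ` rprod G) \<and> positive_definite_kernel G (k n) \<and>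
                    continuous_map (rprod_space G) euclidean (k n) \<and> supported_in_tube G (k n)) \<and>
               (\<forall>n. \<forall>\<gamma>\<in>arrows G. norm (k n (\<gamma>, \<gamma>)) \<le> 1) \<and>
               (\<forall>A. tube G A \<longrightarrow> uniform_limit A k (\<lambda>_. 1) sequentially)"
proof -
  obtain K :: "nat \<Rightarrow> 'g set" where "\<forall>n. compactin T (K n)" "\<forall>C. compactin T C \<longrightarrow> (\<exists>n0. \<forall>n\<ge>n0. C \<subseteq> K n)"
    using compact_exhaustion[OF sc] by (elim exE conjE) (rule that)
  then have K: "\<And>n. compactin T (K n)" "\<And>C. compactin T C \<Longrightarrow> \<exists>n0. \<forall>n\<ge>n0. C \<subseteq> K n"
    by auto
  define e where "e n = inverse (real (Suc n))" for n
  have "\<exists>a C. almost_inv a C (K n) (e n)" for n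
    using fam K(1) unfolding almost_inv_families_def e_def by simp
  then obtain a C where a: "\<And>n. almost_inv (a n) (C n) (K n) (e n)" by metis
  define k where "k n z = complex_of_real (gram (a n) (C n) z)" for n z
  show ?thesis
  proof (rule exI[of _ k], intro conjI allI ballI impI)
    show "bounded (k n ` rprod G)" for n
      unfolding bounded_iff k_def using gram_bound[OF a] by (intro exI[of _ 1]) (auto simp: rprod_def)
    show "positive_definite_kernel G (k n)" for n
      unfolding k_def[abs_def] by (rule gram_positive_definite[OF a])
    show "supported_in_tube G (k n)" for n
      unfolding k_def[abs_def] by (rule gram_supported[OF a])
    have "continuous_map euclidean euclidean complex_of_real"
      by (simp add: continuous_on_of_real continuous_on_id)
    from continuous_map_compose[OF gram_continuous[OF a] this]
    show "continuous_map RT euclidean (k n)" for n unfolding k_def[abs_def] o_def by blast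
    show "norm (k n (\<gamma>, \<gamma>)) \<le> 1" if "\<gamma> \<in> Ar" for n \<gamma>
      using gram_bound[OF a, of \<gamma> \<gamma> n] that by (simp add: k_def)
    fix A assume "tube G A"
    then obtain D where D: "A \<subseteq> rprod G" "compactin T D" "diff_map ` A \<subseteq> D" unfolding tube_iff by blast
    obtain n0 where n0: "\<And>n. n \<ge> n0 \<Longrightarrow> D \<subseteq> K n" using K(2)[OF D(2)] by blast
    \<comment> \<open>A pair in the tube has the form (\<gamma>, \<gamma> d) with \<open>d\<close>
      in \<open>K n\<close>; almost invariance bounds the real kernel below by 1 -
      \<open>e n\<close>, and \<open>gram_bound\<close> bounds it above by 1.\<close>
    have dist: "dist (k n z) 1 \<le> e n" if n: "n \<ge> n0" and z: "z \<in> A" for n z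
    proof -
      obtain \<gamma> \<eta> where ge: "z = (\<gamma>, \<eta>)" "\<gamma> \<in> Ar" "\<eta> \<in> Ar" "r \<gamma> = r \<eta>" using z D(1) by (cases z) auto
      define d where "d = iv \<gamma> \<odot> \<eta>"
      have "diff_map z \<in> K n" using n0[OF n] D(3) z by blast
      then have d: "d \<in> K n" "d \<in> Ar" "r d = s \<gamma>" "\<gamma> \<odot> d = \<eta>"
        using ge by (auto simp: d_def diff_map_def)
      have "gram (a n) (C n) z = (\<Sum>c\<in>C n \<inter> Fb (s \<gamma>). a n \<gamma> c * a n (\<gamma> \<odot> d) (iv d \<odot> c))"
        unfolding gram_def ge using d ge
        by (intro sum.cong) (auto simp: inv_mul_mul simp flip: d(4))
      moreover have "1 - e n \<le> (\<Sum>c\<in>C n \<inter> Fb (s \<gamma>). a n \<gamma> c * a n (\<gamma> \<odot> d) (iv d \<odot> c))"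
        using almost_inv_ge[OF a ge(2) d(1)] d(3) by simp
      moreover have "\<bar>gram (a n) (C n) z\<bar> \<le> 1" using gram_bound[OF a] ge by simp
      ultimately have "\<bar>gram (a n) (C n) z - 1\<bar> \<le> e n" by simp
      moreover have "dist (k n z) 1 = \<bar>gram (a n) (C n) z - 1\<bar>"
        unfolding dist_norm k_def by (metis norm_of_real of_real_1 of_real_diff)
      ultimately show ?thesis by simp
    qed
    show "uniform_limit A k (\<lambda>_. 1) sequentially"
    proof (rule uniform_limitI)
      fix \<epsilon> :: real assume "0 < \<epsilon>"
      then have "\<forall>\<^sub>F n in sequentially. e n < \<epsilon>"
        unfolding e_def using LIMSEQ_inverse_real_of_nat by (rule order_tendstoD(2)[rotated])
      moreover have "\<forall>\<^sub>F n in sequentially. n \<ge> n0" by (rule eventually_ge_at_top)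
      ultimately show "\<forall>\<^sub>F n in sequentially. \<forall>z\<in>A. dist (k n z) 1 < \<epsilon>"
        by eventually_elim (use dist in force)
    qed
  qed
qed

section \<open>Kernels with support proper over the unit space, and their compositions\<close>

text \<open>These kernels include the identity and are closed under linear combination and
  composition, and their rows are finite.\<close>

definition proper_kernel :: "('g \<Rightarrow> 'g \<Rightarrow> real) \<Rightarrow> 'g set \<Rightarrow> bool" where
  "proper_kernel A B \<longleftrightarrow> rproper B \<and> continuous_map RT euclidean (\<lambda>(\<gamma>, \<eta>). A \<gamma> \<eta>) \<and>
    (\<forall>\<gamma>\<in>Ar. \<forall>c\<in>Fb (s \<gamma>) - B. A \<gamma> (\<gamma> \<odot> c) = 0)"

text \<open>Closedness follows from properness: near an arrow outside \<open>D\<close> whose range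
  lies in a compact neighbourhood \<open>L\<close>, only the compact part of \<open>D\<close> over
  \<open>L\<close> has to be removed.\<close>

lemma rproperI:
  assumes D: "D \<subseteq> Ar" "\<And>L. compactin (unit_space G) L \<Longrightarrow> compactin T {c \<in> D. r c \<in> L}"
  shows "rproper D"
  unfolding rproper_def
proof (intro conjI allI impI D(2))
  have "openin T (Ar - D)"
  proof (subst openin_subopen, rule)
    fix c assume c: "c \<in> Ar - D"
    then have "r c \<in> topspace (unit_space G)" by simp
    then obtain W L where W: "openin (unit_space G) W" "compactin (unit_space G) L" "r c \<in> W" "W \<subseteq> L"
      using lc_unit_space unfolding locally_compact_space_def by blast
    let ?U = "{c \<in> topspace T. r c \<in> W} - {c \<in> D. r c \<in> L}"
    have "openin T ?U" using W(1) cont_r_unit_space compactin_closedin_T[OF D(2)[OF W(2)]]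
      by (intro openin_diff openin_continuous_map_preimage)
    then show "\<exists>U. openin T U \<and> c \<in> U \<and> U \<subseteq> Ar - D"
      using c W by (intro exI[of _ ?U]) auto
  qed
  then show "closedin T D" using D(1) by (simp add: closedin_def)
qed

text \<open>A product has the range of its first factor. Over a compact \<open>L\<close> the first
  factor therefore runs in a compact set, whose sources then confine the second factor to a compact
  set.\<close>

lemma rproper_prod_set:
  assumes A: "rproper A" and B: "rproper B" shows "rproper (prod_set A B)"
proof (rule rproperI)
  note AA = rproper_subset[OF A] and BA = rproper_subset[OF B]
  show "prod_set A B \<subseteq> Ar" using AA BA by (auto simp: prod_set_def subset_iff)
  fix L assume L: "compactin (unit_space G) L"
  define AL where "AL = {c \<in> A. r c \<in> L}"
  have AL: "compactin T AL" using A L by (simp add: rproper_def AL_def)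
  then have "compactin (unit_space G) (s ` AL)" using cont_s_unit_space image_compactin by blast
  then have "compactin T {c \<in> B. r c \<in> s ` AL}" using B by (simp add: rproper_def)
  then have "compactin T (prod_set AL {c \<in> B. r c \<in> s ` AL})" by (intro compactin_prod_set AL)
  moreover have "prod_set AL {c \<in> B. r c \<in> s ` AL} = {c \<in> prod_set A B. r c \<in> L}"
  proof (intro subset_antisym subsetI)
    fix c assume "c \<in> prod_set AL {c \<in> B. r c \<in> s ` AL}"
    then obtain a b where ab: "c = a \<odot> b" "a \<in> A" "r a \<in> L" "b \<in> B" "s a = r b"
      unfolding prod_set_def AL_def by blast
    moreover from ab AA BA have "a \<in> Ar" "b \<in> Ar" by auto
    ultimately show "c \<in> {c \<in> prod_set A B. r c \<in> L}" using prod_setI[of a A b B] by simp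
  next
    fix c assume "c \<in> {c \<in> prod_set A B. r c \<in> L}"
    then obtain a b where ab: "c = a \<odot> b" "a \<in> A" "r (a \<odot> b) \<in> L" "b \<in> B" "s a = r b"
      unfolding prod_set_def by blast
    moreover from ab AA BA have "a \<in> Ar" "b \<in> Ar" by auto
    ultimately have a: "a \<in> AL" by (simp add: AL_def)
    have b: "b \<in> {c \<in> B. r c \<in> s ` AL}" using ab(4) imageI[OF a, of s] ab(5) by simp
    show "c \<in> prod_set AL {c \<in> B. r c \<in> s ` AL}" unfolding ab(1) by (rule prod_setI[OF a b ab(5)])
  qed
  ultimately show "compactin T {c \<in> prod_set A B. r c \<in> L}" by simp
qed

lemma proper_kernel_zero:
  "proper_kernel A B \<Longrightarrow> \<gamma> \<in> Ar \<Longrightarrow> c \<in> Fb (s \<gamma>) \<Longrightarrow> c \<notin> B \<Longrightarrow> A \<gamma> (\<gamma> \<odot> c) = 0"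
  unfolding proper_kernel_def by blast

lemma proper_kernel_lin:
  assumes "proper_kernel A B" "proper_kernel A' B'"
  shows "proper_kernel (\<lambda>\<gamma> \<eta>. x * A \<gamma> \<eta> + y * A' \<gamma> \<eta>) (B \<union> B')"
proof -
  have "continuous_map RT euclidean (\<lambda>z. x * (case z of (\<gamma>, \<eta>) \<Rightarrow> A \<gamma> \<eta>) + y * (case z of (\<gamma>, \<eta>) \<Rightarrow> A' \<gamma> \<eta>))"
    using assms unfolding proper_kernel_def
    by (intro continuous_map_add continuous_map_real_mult continuous_map_const[THEN iffD2]) auto
  then have "continuous_map RT euclidean (\<lambda>(\<gamma>, \<eta>). x * A \<gamma> \<eta> + y * A' \<gamma> \<eta>)"
    by (simp add: case_prod_beta')
  then show ?thesis using assms by (simp add: proper_kernel_def rproper_Un)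
qed

text \<open>Two arrows with equal range coincide exactly if their difference is a unit, and the unit
  space is both open and closed.\<close>

lemma proper_kernel_identity: "proper_kernel (\<lambda>\<gamma> \<eta>. if \<gamma> = \<eta> then 1 else 0) (units G)"
proof -
  have eq: "\<gamma> = \<eta> \<longleftrightarrow> diff_map (\<gamma>, \<eta>) \<in> units G" if "(\<gamma>, \<eta>) \<in> rprod G" for \<gamma> \<eta>
  proof
    assume "diff_map (\<gamma>, \<eta>) \<in> units G"
    then have "r (iv \<gamma> \<odot> \<eta>) = iv \<gamma> \<odot> \<eta>" using that by (simp add: diff_map_def units_eq)
    then have "iv \<gamma> \<odot> \<eta> = s \<gamma>" using that by simp
    then have "\<gamma> \<odot> (iv \<gamma> \<odot> \<eta>) = \<gamma>" using that by simp
    then show "\<gamma> = \<eta>" using that by simp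
  qed (use that in \<open>auto simp: diff_map_def\<close>)
  have "continuous_map RT euclidean (\<lambda>z. if diff_map z \<in> units G then 1 else (0::real))"
  proof (rule continuous_map_locally)
    fix z assume z: "z \<in> topspace RT"
    let ?N1 = "{z \<in> topspace RT. diff_map z \<in> units G}" and ?N2 = "{z \<in> topspace RT. diff_map z \<in> topspace T - units G}"
    have o: "openin RT ?N1" "openin RT ?N2"
      by (rule openin_continuous_map_preimage[OF cont_diff_map openin_units],
          rule openin_continuous_map_preimage[OF cont_diff_map openin_diff[OF openin_topspace closedin_units]])
    show "\<exists>N. openin RT N \<and> z \<in> N \<and> continuous_map (subtopology RT N) euclidean (\<lambda>z. if diff_map z \<in> units G then 1 else (0::real))"
    proof (cases "diff_map z \<in> units G")
      case True
      have "continuous_map (subtopology RT ?N1) euclidean (\<lambda>z. if diff_map z \<in> units G then 1 else (0::real))"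
        by (rule continuous_map_eq[of _ _ "\<lambda>_. 1"]) auto
      then show ?thesis using True z o(1) by blast
    next
      case False
      have "continuous_map (subtopology RT ?N2) euclidean (\<lambda>z. if diff_map z \<in> units G then 1 else (0::real))"
        by (rule continuous_map_eq[of _ _ "\<lambda>_. 0"]) auto
      moreover have "z \<in> ?N2" using False z continuous_map_image_subset_topspace[OF cont_diff_map] by auto
      ultimately show ?thesis using o(2) by blast
    qed
  qed
  then have "continuous_map RT euclidean (\<lambda>(\<gamma>, \<eta>). if \<gamma> = \<eta> then 1 else (0::real))"
  proof (rule continuous_map_eq)
    fix z assume "z \<in> topspace RT"
    then obtain \<gamma> \<eta> where z: "z = (\<gamma>, \<eta>)" "(\<gamma>, \<eta>) \<in> rprod G" by (cases z) auto
    show "(if diff_map z \<in> units G then 1 else 0) = (case z of (\<gamma>, \<eta>) \<Rightarrow> if \<gamma> = \<eta> then 1 else (0::real))"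
      using eq[OF z(2)] by (simp add: z(1))
  qed
  moreover have "\<gamma> \<odot> c \<noteq> \<gamma>" if "\<gamma> \<in> Ar" "c \<in> Fb (s \<gamma>) - units G" for \<gamma> c
  proof
    assume "\<gamma> \<odot> c = \<gamma>"
    then have "iv \<gamma> \<odot> (\<gamma> \<odot> c) = s \<gamma>" using that by simp
    then have "c = s \<gamma>" using that by simp
    then show False using that by auto
  qed
  ultimately show ?thesis using rproper_units unfolding proper_kernel_def by metis
qed

lemma proper_kernel_rows:
  assumes A: "proper_kernel A B" and \<gamma>: "\<gamma> \<in> Ar"
  shows "{\<eta> \<in> Fb (r \<gamma>). A \<gamma> \<eta> \<noteq> 0} \<subseteq> (\<lambda>c. \<gamma> \<odot> c) ` (B \<inter> Fb (s \<gamma>))"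
proof
  fix \<eta> assume e: "\<eta> \<in> {\<eta> \<in> Fb (r \<gamma>). A \<gamma> \<eta> \<noteq> 0}"
  define c where "c = iv \<gamma> \<odot> \<eta>"
  have c: "c \<in> Fb (s \<gamma>)" "\<gamma> \<odot> c = \<eta>" using e \<gamma> by (auto simp: c_def)
  then have "c \<in> B" using proper_kernel_zero[OF A \<gamma>, of c] e by auto
  then show "\<eta> \<in> (\<lambda>c. \<gamma> \<odot> c) ` (B \<inter> Fb (s \<gamma>))" using c by blast
qed

lemma proper_kernel_rows_finite:
  assumes A: "proper_kernel A B" and \<gamma>: "\<gamma> \<in> Ar"
  shows "finite ((\<lambda>c. \<gamma> \<odot> c) ` (B \<inter> Fb (s \<gamma>)))" "(\<lambda>c. \<gamma> \<odot> c) ` (B \<inter> Fb (s \<gamma>)) \<subseteq> Fb (r \<gamma>)"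
  using A finite_fibre_rproper[of B] \<gamma> by (auto simp: proper_kernel_def)

lemma proper_kernel_row_finite:
  assumes A: "proper_kernel A B" shows "row_finite (Fb x) A"
  unfolding row_finite_def
proof
  fix \<gamma> assume "\<gamma> \<in> Fb x"
  then have g: "\<gamma> \<in> Ar" "x = r \<gamma>" by auto
  show "finite {j \<in> Fb x. A \<gamma> j \<noteq> 0}"
    unfolding g(2) using proper_kernel_rows[OF A g(1)] proper_kernel_rows_finite(1)[OF A g(1)] by (rule finite_subset)
qed

lemma mat_comp_fibre_sum:
  assumes A: "proper_kernel A B" and \<gamma>: "\<gamma> \<in> Ar"
  shows "mat_comp (Fb (r \<gamma>)) A A' \<gamma> \<eta> = (\<Sum>c\<in>B \<inter> Fb (s \<gamma>). A \<gamma> (\<gamma> \<odot> c) * A' (\<gamma> \<odot> c) \<eta>)"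
proof -
  let ?J = "(\<lambda>c. \<gamma> \<odot> c) ` (B \<inter> Fb (s \<gamma>))"
  have "mat_comp (Fb (r \<gamma>)) A A' \<gamma> \<eta> = (\<Sum>\<zeta>\<in>?J. A \<gamma> \<zeta> * A' \<zeta> \<eta>)"
    by (intro mat_comp_eq proper_kernel_rows[OF A \<gamma>] proper_kernel_rows_finite[OF A \<gamma>])
  also have "\<dots> = (\<Sum>c\<in>B \<inter> Fb (s \<gamma>). A \<gamma> (\<gamma> \<odot> c) * A' (\<gamma> \<odot> c) \<eta>)"
    using proper_kernel_rows_finite[OF A \<gamma>] proper_kernel_zero[OF A \<gamma>]
    by (intro sum_translate[symmetric, OF \<gamma>]) auto
  finally show ?thesis .
qed

text \<open>A nonzero contribution to the entry (\<gamma>, \<gamma> c) through \<gamma> b factors c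
  as b times \<open>iv b \<odot> c\<close>, with factors in \<open>B\<close> and \<open>B'\<close>.
  For continuity the composition is rewritten as a fibre sum over \<open>B\<close>.\<close>

lemma proper_kernel_comp:
  assumes A: "proper_kernel A B" and A': "proper_kernel A' B'"
  shows "proper_kernel (\<lambda>\<gamma> \<eta>. mat_comp (Fb (r \<gamma>)) A A' \<gamma> \<eta>) (prod_set B B')"
  unfolding proper_kernel_def
proof (intro conjI ballI)
  have B: "rproper B" and B': "rproper B'" 
    and cA: "continuous_map RT euclidean (\<lambda>(\<gamma>, \<eta>). A \<gamma> \<eta>)" 
    and cA': "continuous_map RT euclidean (\<lambda>(\<gamma>, \<eta>). A' \<gamma> \<eta>)" 
    and sA: "\<And>\<gamma> c. \<gamma> \<in> Ar \<Longrightarrow> c \<in> Fb (s \<gamma>) - B \<Longrightarrow> A \<gamma> (\<gamma> \<odot> c) = 0"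
    and sA': "\<And>\<gamma> c. \<gamma> \<in> Ar \<Longrightarrow> c \<in> Fb (s \<gamma>) - B' \<Longrightarrow> A' \<gamma> (\<gamma> \<odot> c) = 0"
    using A A' by (auto simp: proper_kernel_def)
  show "rproper (prod_set B B')" using B B' by (rule rproper_prod_set)
  let ?S = "subtopology (prod_topology RT T) {(z, c). s (fst z) = r c}"
  have c1: "continuous_map ?S T (\<lambda>w. fst (fst w))" "continuous_map ?S T (\<lambda>w. snd (fst w))" "continuous_map ?S T snd"
    using continuous_map_compose[OF _ cont_RT_fst, of ?S fst] continuous_map_compose[OF _ cont_RT_snd, of ?S fst]
    by (auto simp: o_def intro: continuous_map_fst_snd_subtopology)
  have mm: "continuous_map ?S T (\<lambda>w. fst (fst w) \<odot> snd w)"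
    using c1 by (intro cont_mul') auto
  have "continuous_map ?S euclidean (\<lambda>w. A (fst (fst w)) (fst (fst w) \<odot> snd w))"
    using cont_RT_apply[OF cA c1(1) mm] by auto
  moreover have "continuous_map ?S euclidean (\<lambda>w. A' (fst (fst w) \<odot> snd w) (snd (fst w)))"
    using cont_RT_apply[OF cA' mm c1(2)] by auto
  ultimately have "continuous_map ?S euclidean (\<lambda>w. A (fst (fst w)) (fst (fst w) \<odot> snd w) * A' (fst (fst w) \<odot> snd w) (snd (fst w)))"
    by (rule continuous_map_real_mult)
  then have "continuous_map RT euclidean (\<lambda>z. \<Sum>c\<in>B \<inter> Fb (s (fst z)). A (fst z) (fst z \<odot> c) * A' (fst z \<odot> c) (snd z))"
    by (intro fibre_sum_continuous B)
      (use sA in \<open>auto simp: cont_unit_space_iff case_prod_beta' rprod_def intro: cont_s' cont_RT_fst\<close>)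
  then show "continuous_map RT euclidean (\<lambda>(\<gamma>, \<eta>). mat_comp (Fb (r \<gamma>)) A A' \<gamma> \<eta>)"
  proof (rule continuous_map_eq)
    fix z assume "z \<in> topspace RT"
    then obtain \<gamma> \<eta> where "z = (\<gamma>, \<eta>)" "\<gamma> \<in> Ar" by (cases z) auto
    then show "(\<Sum>c\<in>B \<inter> Fb (s (fst z)). A (fst z) (fst z \<odot> c) * A' (fst z \<odot> c) (snd z)) =
        (case z of (\<gamma>, \<eta>) \<Rightarrow> mat_comp (Fb (r \<gamma>)) A A' \<gamma> \<eta>)"
      by (simp add: mat_comp_fibre_sum[OF A])
  qed
  fix \<gamma> c assume g: "\<gamma> \<in> Ar" "c \<in> Fb (s \<gamma>) - prod_set B B'"
  have "A \<gamma> (\<gamma> \<odot> b) * A' (\<gamma> \<odot> b) (\<gamma> \<odot> c) = 0" if b: "b \<in> B \<inter> Fb (s \<gamma>)" for b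
  proof -
    define d where "d = iv b \<odot> c"
    have d: "d \<in> Fb (s b)" "b \<odot> d = c" using b g by (auto simp: d_def)
    then have "d \<notin> B'" using b g prod_setI[of b B d B'] by auto
    then have "A' (\<gamma> \<odot> b) ((\<gamma> \<odot> b) \<odot> d) = 0" using sA' b g d by auto
    moreover have "(\<gamma> \<odot> b) \<odot> d = \<gamma> \<odot> c" using b g d by (simp add: mul_assoc)
    ultimately show ?thesis by simp
  qed
  then show "mat_comp (Fb (r \<gamma>)) A A' \<gamma> (\<gamma> \<odot> c) = 0"
    unfolding mat_comp_fibre_sum[OF A g(1)] by (intro sum.neutral) blast
qed

lemma proper_kernel_visser:
  assumes S: "proper_kernel S B"
  shows "\<exists>B'. proper_kernel (\<lambda>\<gamma> \<eta>. visser (Fb (r \<gamma>)) S m \<gamma> \<eta>) B'"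
proof (induction m)
  case 0
  have "proper_kernel (\<lambda>\<gamma> \<eta>. 0 * S \<gamma> \<eta> + 0 * S \<gamma> \<eta>) (B \<union> B)" by (rule proper_kernel_lin[OF S S])
  then show ?case by auto
next
  case (Suc m)
  then obtain B' where B': "proper_kernel (\<lambda>\<gamma> \<eta>. visser (Fb (r \<gamma>)) S m \<gamma> \<eta>) B'" by blast
  define V where "V \<gamma> \<eta> = visser (Fb (r \<gamma>)) S m \<gamma> \<eta>" for \<gamma> \<eta>
  \<comment> \<open>The index fibre varies with the row, but every intermediate arrow has the same
    range as \<gamma>, so freezing the fibre or letting it follow the row gives the same
    product.\<close>
  have eq: "mat_comp (Fb (r \<gamma>)) (visser (Fb (r \<gamma>)) S m) (visser (Fb (r \<gamma>)) S m) \<gamma> \<eta> = mat_comp (Fb (r \<gamma>)) V V \<gamma> \<eta>" for \<gamma> \<eta>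
    unfolding mat_comp_def V_def by (intro sum.cong) auto
  have "proper_kernel V B'" using B' by (simp add: V_def[abs_def])
  from proper_kernel_lin[OF S proper_kernel_comp[OF this this], of "1/2" "1/2"]
  have "proper_kernel (\<lambda>\<gamma> \<eta>. visser (Fb (r \<gamma>)) S (Suc m) \<gamma> \<eta>) (B \<union> prod_set B' B')"
    by (simp add: eq add_divide_distrib)
  then show ?case by blast
qed

section \<open>Approximate square roots of positive definite kernels supported in tubes\<close>

lemma positive_definite_kernelD:
  fixes n :: nat
  assumes "positive_definite_kernel G k" "x \<in> units G" "\<And>i. i < n \<Longrightarrow> h i \<in> Fb x"
  shows "(\<Sum>i<n. \<Sum>j<n. cnj (\<alpha> i) * \<alpha> j * k (h i, h j)) \<in> \<real>\<^sub>\<ge>\<^sub>0"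
  using assms(1)[unfolded positive_definite_kernel_def, rule_format, OF assms(2), of n h \<alpha>] assms(3) by simp

text \<open>With coefficients 1 and i the form contains i (k(\<gamma>, \<eta>) - k(\<eta>,
  \<gamma>)) besides real diagonal terms; its imaginary part, which must vanish, is the difference
  of the two real parts.\<close>

lemma Re_kernel_sym:
  assumes k: "positive_definite_kernel G k" and g: "\<gamma> \<in> Ar" "\<eta> \<in> Ar" "r \<gamma> = r \<eta>"
  shows "Re (k (\<gamma>, \<eta>)) = Re (k (\<eta>, \<gamma>))"
proof -
  define h where "h i = (if i = (0::nat) then \<gamma> else \<eta>)" for i
  define \<alpha> where "\<alpha> i = (if i = (0::nat) then 1 else \<i>)" for i
  have x: "r \<gamma> \<in> units G" using g by simp
  have "(\<Sum>i<2. \<Sum>j<2. cnj (\<alpha> i) * \<alpha> j * k (h i, h j)) \<in> \<real>\<^sub>\<ge>\<^sub>0"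
    using g by (intro positive_definite_kernelD[OF k x]) (auto simp: h_def)
  moreover have "k (\<gamma>, \<gamma>) \<in> \<real>\<^sub>\<ge>\<^sub>0" "k (\<eta>, \<eta>) \<in> \<real>\<^sub>\<ge>\<^sub>0"
    using positive_definite_kernelD[OF k x, of "Suc 0" "\<lambda>_. \<gamma>" "\<lambda>_. 1"]
      positive_definite_kernelD[OF k x, of "Suc 0" "\<lambda>_. \<eta>" "\<lambda>_. 1"] g by auto
  ultimately show ?thesis
    by (simp add: numeral_2_eq_2 h_def \<alpha>_def complex_nonneg_Reals_iff)
qed

lemma Re_kernel_psd:
  assumes k: "positive_definite_kernel G k" and F: "finite F" "F \<subseteq> Fb x" and x: "x \<in> units G"
  shows "0 \<le> (\<Sum>i\<in>F. \<Sum>j\<in>F. v i * v j * Re (k (i, j)))"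
proof -
  obtain h where h: "bij_betw h {..<card F} F"
    using ex_bij_betw_nat_finite[OF F(1)] by (auto simp: atLeast0LessThan)
  have hF: "\<forall>i<card F. h i \<in> Fb x" using h F(2) unfolding bij_betw_def by blast
  define \<alpha> where "\<alpha> i = complex_of_real (v (h i))" for i
  have "(\<Sum>i<card F. \<Sum>j<card F. cnj (\<alpha> i) * \<alpha> j * k (h i, h j)) \<in> \<real>\<^sub>\<ge>\<^sub>0"
    using hF by (intro positive_definite_kernelD[OF k(1) x]) blast
  then have "0 \<le> Re (\<Sum>i<card F. \<Sum>j<card F. cnj (\<alpha> i) * \<alpha> j * k (h i, h j))"
    by (simp add: complex_nonneg_Reals_iff)
  also have "\<dots> = (\<Sum>i<card F. \<Sum>j<card F. v (h i) * v (h j) * Re (k (h i, h j)))"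
    by (simp add: \<alpha>_def flip: of_real_mult)
  also have "\<dots> = (\<Sum>i<card F. \<Sum>j\<in>F. v (h i) * v j * Re (k (h i, j)))"
    by (intro sum.cong refl sum.reindex_bij_betw[OF h])
  also have "\<dots> = (\<Sum>i\<in>F. \<Sum>j\<in>F. v i * v j * Re (k (i, j)))"
    by (intro sum.reindex_bij_betw[OF h, of "\<lambda>i. \<Sum>j\<in>F. v i * v j * Re (k (i, j))"])
  finally show ?thesis .
qed

lemma Re_kernel_diag_nonneg:
  assumes k: "positive_definite_kernel G k" and g: "\<gamma> \<in> Ar"
  shows "0 \<le> Re (k (\<gamma>, \<gamma>))"
  using Re_kernel_psd[OF k, of "{\<gamma>}" "r \<gamma>" "\<lambda>_. 1"] g by simp

text \<open>After division by \<open>L\<close> the real part of the kernel becomes a matrix T with 0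
  \<le> T \<le> 1. The approximate root is sqrt L (1 - V) for an iterate V started from S = 1 - T;
  iterates of proper kernels are proper.\<close>

lemma kernel_square_root:
  assumes k: "positive_definite_kernel G k" "continuous_map RT euclidean k" "supported_in_tube G k" "bounded (k ` rprod G)"
    and \<delta>: "0 < \<delta>"
  shows "\<exists>P B. proper_kernel P B \<and> (\<forall>x. sym_matrix (Fb x) P) \<and>
    (\<forall>\<gamma>\<in>Ar. \<forall>\<eta>\<in>Fb (r \<gamma>). \<bar>(\<Sum>c\<in>B \<inter> Fb (s \<gamma>). P \<gamma> (\<gamma> \<odot> c) * P \<eta> (\<gamma> \<odot> c)) - Re (k (\<gamma>, \<eta>))\<bar> \<le> \<delta>)"
proof -
  obtain C where C: "compactin T C" "\<And>z. z \<in> rprod G \<Longrightarrow> k z \<noteq> 0 \<Longrightarrow> diff_map z \<in> C"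
    using k(3) unfolding supported_in_tube_iff by blast
  obtain M where M: "0 < M" "\<And>z. z \<in> rprod G \<Longrightarrow> norm (k z) \<le> M"
    using k(4) unfolding bounded_pos by blast
  obtain N where N: "\<And>x. card (C \<inter> Fb x) \<le> N" using bounded_fibre_card[OF C(1)] by blast
  \<comment> \<open>\<open>M\<close> bounds the entries and \<open>N\<close> the number of nonzero
    entries of a row, so rows of the quotient by \<open>L\<close> have absolute sum at most 1. The
    summand 1 keeps \<open>L\<close> positive when \<open>N\<close> is 0.\<close>
  define L where "L = M * real N + 1"
  have L: "0 < L" using M by (simp add: L_def add_nonneg_pos)
  define \<kappa> where "\<kappa> \<gamma> \<eta> = Re (k (\<gamma>, \<eta>))" for \<gamma> \<eta>
  have pk: "proper_kernel \<kappa> C"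
    unfolding proper_kernel_def
  proof (intro conjI ballI rproper_compact C(1))
    have "continuous_map RT euclidean (Re \<circ> k)"
      using k(2) by (rule continuous_map_compose) (simp add: continuous_on_Re continuous_on_id)
    then show "continuous_map RT euclidean (\<lambda>(\<gamma>, \<eta>). \<kappa> \<gamma> \<eta>)"
      by (simp add: \<kappa>_def o_def case_prod_beta')
    show "\<kappa> \<gamma> (\<gamma> \<odot> c) = 0" if "\<gamma> \<in> Ar" "c \<in> Fb (s \<gamma>) - C" for \<gamma> c
    proof (rule ccontr)
      assume "\<kappa> \<gamma> (\<gamma> \<odot> c) \<noteq> 0"
      then have "k (\<gamma>, \<gamma> \<odot> c) \<noteq> 0" by (auto simp: \<kappa>_def)
      then have "diff_map (\<gamma>, \<gamma> \<odot> c) \<in> C" using that by (intro C(2)) auto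
      then show False using that by (simp add: diff_map_def)
    qed
  qed
  define Tm where "Tm \<gamma> \<eta> = \<kappa> \<gamma> \<eta> / L" for \<gamma> \<eta>
  define S where "S \<gamma> \<eta> = (if \<gamma> = \<eta> then 1 else 0) - Tm \<gamma> \<eta>" for \<gamma> \<eta>
  have "proper_kernel (\<lambda>\<gamma> \<eta>. 1 * (if \<gamma> = \<eta> then 1 else 0) + (- 1 / L) * \<kappa> \<gamma> \<eta>) (units G \<union> C)"
    by (rule proper_kernel_lin[OF proper_kernel_identity pk])
  then have pS: "proper_kernel S (units G \<union> C)" by (simp add: S_def[abs_def] Tm_def)
  have "proper_kernel (\<lambda>\<gamma> \<eta>. (1/L) * \<kappa> \<gamma> \<eta> + 0 * \<kappa> \<gamma> \<eta>) (C \<union> C)"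
    by (rule proper_kernel_lin[OF pk pk])
  then have pT: "proper_kernel Tm C" by (simp add: Tm_def[abs_def])
  have symT: "sym_matrix (Fb x) Tm" for x
    using Re_kernel_sym[OF k(1)] by (simp add: sym_matrix_def Tm_def \<kappa>_def)
  have symS: "sym_matrix (Fb x) S" for x
    using symT[of x] by (simp add: sym_matrix_def S_def)
  have rfS: "row_finite (Fb x) S" for x using pS by (rule proper_kernel_row_finite)
  have obS: "op_bound (Fb x) 1 S" if x: "x \<in> units G" for x
    unfolding S_def[abs_def]
  proof (rule contraction_one_minus[OF symT proper_kernel_row_finite[OF pT]])
    fix F assume F: "finite F" "F \<subseteq> Fb x"
    show "0 \<le> (\<Sum>i\<in>F. \<Sum>j\<in>F. v i * v j * Tm i j)" for v
    proof -
      have "(\<Sum>i\<in>F. \<Sum>j\<in>F. v i * v j * Tm i j) = (\<Sum>i\<in>F. \<Sum>j\<in>F. v i * v j * Re (k (i, j))) / L"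
        by (simp add: Tm_def \<kappa>_def sum_divide_distrib)
      then show ?thesis using Re_kernel_psd[OF k(1) F x] L by simp
    qed
    fix \<gamma> assume g: "\<gamma> \<in> Fb x"
    let ?J = "(\<lambda>c. \<gamma> \<odot> c) ` (C \<inter> Fb (s \<gamma>))"
    have gA: "\<gamma> \<in> Ar" "x = r \<gamma>" using g by auto
    have fJ: "finite ?J" using proper_kernel_rows_finite(1)[OF pT gA(1)] .
    have "(\<Sum>j\<in>F. \<bar>Tm \<gamma> j\<bar>) = (\<Sum>j\<in>F \<inter> ?J. \<bar>Tm \<gamma> j\<bar>)"
    proof (rule sum.mono_neutral_right[OF F(1)], blast, rule)
      fix i assume i: "i \<in> F - F \<inter> ?J"
      then have "i \<in> Fb (r \<gamma>)" using F gA by blast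
      then show "\<bar>Tm \<gamma> i\<bar> = 0" using proper_kernel_rows[OF pT gA(1)] i by fastforce
    qed
    also have "\<dots> \<le> (\<Sum>j\<in>F \<inter> ?J. M / L)"
    proof (rule sum_mono)
      fix j assume "j \<in> F \<inter> ?J"
      then have "j \<in> Fb (r \<gamma>)" using F gA by blast
      then have "(\<gamma>, j) \<in> rprod G" using gA by auto
      then have "\<bar>\<kappa> \<gamma> j\<bar> \<le> M" 
        using M(2)[of "(\<gamma>, j)"] abs_Re_le_cmod[of "k (\<gamma>, j)"] unfolding \<kappa>_def by linarith
      then show "\<bar>Tm \<gamma> j\<bar> \<le> M / L" using L by (simp add: Tm_def divide_right_mono)
    qed
    also have "\<dots> = real (card (F \<inter> ?J)) * (M / L)" by simp
    also have "\<dots> \<le> real N * (M / L)"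
    proof -
      have "card (F \<inter> ?J) \<le> card ?J" using fJ by (intro card_mono) auto
      also have "\<dots> \<le> card (C \<inter> Fb (s \<gamma>))" by (intro card_image_le finite_fibre_rproper rproper_compact C(1))
      also have "\<dots> \<le> N" by (rule N)
      finally show ?thesis using M(1) L by (intro mult_right_mono) auto
    qed
    also have "\<dots> \<le> 1" using L by (simp add: L_def mult.commute)
    finally show "(\<Sum>j\<in>F. \<bar>Tm \<gamma> j\<bar>) \<le> 1" .
  qed
  have "\<forall>\<^sub>F m in sequentially. visser_bound (Suc m) - visser_bound m < \<delta> / (2 * L)"
    using visser_bound_diff \<delta> L by (intro order_tendstoD(2)) auto
  then have "\<exists>m. visser_bound (Suc m) - visser_bound m < \<delta> / (2 * L)"
    by (rule eventually_happens'[OF sequentially_bot])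
  \<comment> \<open>The square misses T by at most twice the increment, and undoing the
    normalisation multiplies this by \<open>L\<close>; hence the threshold \<delta> / (2 L).\<close>
  then obtain m where m: "visser_bound (Suc m) - visser_bound m < \<delta> / (2 * L)" by blast
  obtain B' where B': "proper_kernel (\<lambda>\<gamma> \<eta>. visser (Fb (r \<gamma>)) S m \<gamma> \<eta>) B'"
    using proper_kernel_visser[OF pS] by blast
  define P where "P \<gamma> \<eta> = sqrt L * (if \<gamma> = \<eta> then 1 else 0) + (- sqrt L) * visser (Fb (r \<gamma>)) S m \<gamma> \<eta>" for \<gamma> \<eta>
  define B where "B = units G \<union> B'"
  have pP: "proper_kernel P B"
    unfolding P_def[abs_def] B_def by (rule proper_kernel_lin[OF proper_kernel_identity B'])
  have symP: "sym_matrix (Fb x) P" for x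
    using sym_visser[OF rfS symS, of x m] by (auto simp: sym_matrix_def P_def)
  show ?thesis
  proof (intro exI[of _ P] exI[of _ B] conjI allI ballI pP symP)
    fix \<gamma> \<eta> assume g: "\<gamma> \<in> Ar" and e: "\<eta> \<in> Fb (r \<gamma>)"
    let ?I = "Fb (r \<gamma>)"
    \<comment> \<open>The points \<gamma> and \<eta> are added because \<open>visser_square\<close>
      needs both diagonal positions inside the summation set.\<close>
    define J where "J = (\<lambda>c. \<gamma> \<odot> c) ` (B \<inter> Fb (s \<gamma>)) \<union> {\<gamma>, \<eta>}"
    have J: "finite J" "J \<subseteq> ?I" using proper_kernel_rows_finite[OF pP g] g e by (auto simp: J_def)
    have "(\<Sum>c\<in>B \<inter> Fb (s \<gamma>). P \<gamma> (\<gamma> \<odot> c) * P \<eta> (\<gamma> \<odot> c)) = (\<Sum>\<zeta>\<in>J. P \<gamma> \<zeta> * P \<eta> \<zeta>)"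
      using J proper_kernel_zero[OF pP g] by (intro sum_translate[OF g]) (auto simp: J_def)
    also have "\<dots> = (\<Sum>\<zeta>\<in>J. P \<gamma> \<zeta> * P \<zeta> \<eta>)"
      using symP[of "r \<gamma>"] J e by (intro sum.cong refl) (auto simp: sym_matrix_def)
    also have "\<dots> = L * (\<Sum>\<zeta>\<in>J. ((if \<gamma> = \<zeta> then 1 else 0) - visser ?I S m \<gamma> \<zeta>) * ((if \<zeta> = \<eta> then 1 else 0) - visser ?I S m \<zeta> \<eta>))"
      unfolding sum_distrib_left
    proof (intro sum.cong refl)
      fix \<zeta> assume "\<zeta> \<in> J"
      then have "r \<zeta> = r \<gamma>" using J by auto
      have gen: "(sqrt L * u + - sqrt L * v) * (sqrt L * u' + - sqrt L * v') = L * ((u - v) * (u' - v'))" for u v u' v'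
      proof -
        have "(sqrt L * u + - sqrt L * v) * (sqrt L * u' + - sqrt L * v') = (sqrt L * sqrt L) * ((u - v) * (u' - v'))"
          by algebra
        also have "sqrt L * sqrt L = L" using L by simp
        finally show ?thesis .
      qed
      show "P \<gamma> \<zeta> * P \<zeta> \<eta> = L * (((if \<gamma> = \<zeta> then 1 else 0) - visser ?I S m \<gamma> \<zeta>) * ((if \<zeta> = \<eta> then 1 else 0) - visser ?I S m \<zeta> \<eta>))"
        unfolding P_def \<open>r \<zeta> = r \<gamma>\<close> by (rule gen)
    qed
    finally have eq: "(\<Sum>c\<in>B \<inter> Fb (s \<gamma>). P \<gamma> (\<gamma> \<odot> c) * P \<eta> (\<gamma> \<odot> c)) = \<dots>" .
    let ?Q = "\<Sum>\<zeta>\<in>J. ((if \<gamma> = \<zeta> then 1 else 0) - visser ?I S m \<gamma> \<zeta>) * ((if \<zeta> = \<eta> then 1 else 0) - visser ?I S m \<zeta> \<eta>)"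
    have sub: "{j \<in> ?I. visser ?I S m \<gamma> j \<noteq> 0} \<subseteq> J"
      using proper_kernel_rows[OF B' g] by (auto simp: J_def B_def)
    have "\<bar>?Q - ((if \<gamma> = \<eta> then 1 else 0) - S \<gamma> \<eta>)\<bar> \<le> 2 * (visser_bound (Suc m) - visser_bound m)"
      using g e J sub by (intro visser_square rfS obS) (auto simp: J_def)
    also have "\<dots> \<le> 2 * (\<delta> / (2 * L))" using m by (intro mult_left_mono) (auto simp del: visser_bound.simps)
    also have "\<dots> = \<delta> / L" by simp
    finally have "\<bar>?Q - \<kappa> \<gamma> \<eta> / L\<bar> \<le> \<delta> / L" by (simp add: S_def Tm_def)
    then have "L * \<bar>?Q - \<kappa> \<gamma> \<eta> / L\<bar> \<le> \<delta>" using L by (simp add: pos_le_divide_eq mult.commute)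
    moreover have "L * \<bar>?Q - \<kappa> \<gamma> \<eta> / L\<bar> = \<bar>L * ?Q - \<kappa> \<gamma> \<eta>\<bar>"
      using L by (simp add: abs_mult_pos' right_diff_distrib)
    ultimately show "\<bar>(\<Sum>c\<in>B \<inter> Fb (s \<gamma>). P \<gamma> (\<gamma> \<odot> c) * P \<eta> (\<gamma> \<odot> c)) - Re (k (\<gamma>, \<eta>))\<bar> \<le> \<delta>"
      unfolding eq \<kappa>_def by simp
  qed
qed

theorem almost_inv_of_kernels:
  assumes k: "\<And>n::nat. bounded (k n ` rprod G)" "\<And>n. positive_definite_kernel G (k n)"
      "\<And>n. continuous_map RT euclidean (k n)" "\<And>n. supported_in_tube G (k n)"
      "\<And>n \<gamma>. \<gamma> \<in> Ar \<Longrightarrow> norm (k n (\<gamma>, \<gamma>)) \<le> 1"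
      "\<And>A. tube G A \<Longrightarrow> uniform_limit A k (\<lambda>_. 1) sequentially"
  shows almost_inv_families
  unfolding almost_inv_families_def
proof (intro allI impI)
  fix K and \<epsilon> :: real assume Ke: "compactin T K \<and> 0 < \<epsilon>"
  then have K: "compactin T K" and KA: "K \<subseteq> Ar" using compactin_subset_topspace[of T K] by simp_all
  \<comment> \<open>The final estimate loses 5 \<delta> in all; the minimum with 1 keeps \<delta> at
    most 1/5, so that the factors in the product estimate remain nonnegative.\<close>
  define \<delta> where "\<delta> = min \<epsilon> 1 / 5"
  have \<delta>: "0 < \<delta>" "\<delta> \<le> 1/5" "5 * \<delta> \<le> \<epsilon>" using Ke by (auto simp: \<delta>_def)
  \<comment> \<open>Differences of diagonal pairs are units: those at \<gamma> and at \<gamma> d lie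
    in r(K) and s(K). Adding these sets makes the kernel close to 1 at both diagonal entries as
    well.\<close>
  define K' where "K' = K \<union> r ` K \<union> s ` K"
  have K': "compactin T K'" unfolding K'_def using K cont_r cont_s by (intro compactin_Un image_compactin)
  define A where "A = {z \<in> rprod G. diff_map z \<in> K'}"
  have "tube G A" unfolding tube_iff A_def using K' by (intro conjI exI[of _ K']) auto
  then have "\<forall>\<^sub>F n in sequentially. \<forall>z\<in>A. dist (k n z) 1 < \<delta>"
    using k(6) \<delta>(1) by (simp add: uniform_limit_iff)
  then have "\<exists>n. \<forall>z\<in>A. dist (k n z) 1 < \<delta>" by (rule eventually_happens'[OF sequentially_bot])
  then obtain n where n: "\<And>z. z \<in> A \<Longrightarrow> dist (k n z) 1 < \<delta>" by blast
  define \<kappa> where "\<kappa> \<gamma> \<eta> = Re (k n (\<gamma>, \<eta>))" for \<gamma> \<eta>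
  have near: "1 - \<delta> \<le> \<kappa> \<gamma> \<eta>" if "(\<gamma>, \<eta>) \<in> A" for \<gamma> \<eta>
  proof -
    have "\<bar>Re (k n (\<gamma>, \<eta>) - 1)\<bar> \<le> \<delta>"
      using n[OF that] abs_Re_le_cmod[of "k n (\<gamma>, \<eta>) - 1"] by (simp add: dist_norm)
    then show ?thesis by (simp add: \<kappa>_def)
  qed
  have diag: "0 \<le> \<kappa> \<gamma> \<gamma>" "\<kappa> \<gamma> \<gamma> \<le> 1" if "\<gamma> \<in> Ar" for \<gamma>
    using Re_kernel_diag_nonneg[OF k(2)[of n] that] k(5)[OF that, of n] abs_Re_le_cmod[of "k n (\<gamma>, \<gamma>)"]
    unfolding \<kappa>_def by linarith+
  obtain P B where P: "proper_kernel P B" "\<And>x. sym_matrix (Fb x) P"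
    "\<And>\<gamma> \<eta>. \<gamma> \<in> Ar \<Longrightarrow> \<eta> \<in> Fb (r \<gamma>) \<Longrightarrow> \<bar>(\<Sum>c\<in>B \<inter> Fb (s \<gamma>). P \<gamma> (\<gamma> \<odot> c) * P \<eta> (\<gamma> \<odot> c)) - Re (k n (\<gamma>, \<eta>))\<bar> \<le> \<delta>"
    using kernel_square_root[OF k(2,3,4,1) \<delta>(1), of n] by blast
  obtain C0 where C0: "compactin T C0" "\<And>z. z \<in> rprod G \<Longrightarrow> k n z \<noteq> 0 \<Longrightarrow> diff_map z \<in> C0"
    using k(4)[of n] unfolding supported_in_tube_iff by blast
  \<comment> \<open>The difference of (\<gamma>, \<gamma>) is \<open>s \<gamma>\<close>, so a
    nonzero diagonal value forces \<open>s \<gamma>\<close> into this compact set of units.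
    Restricting \<open>B\<close> to arrows with range there gives a compact set by
    properness.\<close>
  define L where "L = C0 \<inter> units G"
  have "compactin T (units G \<inter> C0)" by (intro closed_Int_compactin closedin_units C0(1))
  then have L: "compactin (unit_space G) L" by (simp add: L_def compactin_unit_space Int_commute)
  define C where "C = {c \<in> B. r c \<in> L}"
  have C: "compactin T C" using P(1) L by (simp add: C_def proper_kernel_def rproper_def)
  have supp: "s \<gamma> \<in> L" if "\<gamma> \<in> Ar" "\<kappa> \<gamma> \<gamma> \<noteq> 0" for \<gamma>
  proof -
    have "k n (\<gamma>, \<gamma>) \<noteq> 0" using that by (auto simp: \<kappa>_def)
    then have "diff_map (\<gamma>, \<gamma>) \<in> C0" using that by (intro C0(2)) auto
    then show ?thesis using that by (simp add: diff_map_def L_def)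
  qed
  \<comment> \<open>\<open>P\<close> contains a multiple of the identity, so its support in \<open>c\<close> contains all units; the factor
    \<open>\<kappa> \<gamma> \<gamma>\<close> makes the support compact.\<close>
  define a where "a \<gamma> c = \<kappa> \<gamma> \<gamma> * P \<gamma> (\<gamma> \<odot> c) / sqrt (1 + \<delta>)" for \<gamma> c
  have sq: "sqrt (1 + \<delta>) * sqrt (1 + \<delta>) = 1 + \<delta>" using \<delta> by simp
  have CB: "C \<inter> Fb (s \<gamma>) = B \<inter> Fb (s \<gamma>)" if "s \<gamma> \<in> L" for \<gamma>
    using that by (auto simp: C_def)
  have sum: "(\<Sum>c\<in>C \<inter> Fb (s \<gamma>). a \<gamma> c * a (\<gamma> \<odot> d) (iv d \<odot> c)) = 
      \<kappa> \<gamma> \<gamma> * \<kappa> (\<gamma> \<odot> d) (\<gamma> \<odot> d) * (\<Sum>c\<in>B \<inter> Fb (s \<gamma>). P \<gamma> (\<gamma> \<odot> c) * P (\<gamma> \<odot> d) (\<gamma> \<odot> c)) / (1 + \<delta>)"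
    if g: "\<gamma> \<in> Ar" "d \<in> Ar" "s \<gamma> = r d" for \<gamma> d
  proof (cases "\<kappa> \<gamma> \<gamma> = 0")
    case True
    then show ?thesis by (simp add: a_def)
  next
    case False
    have "(\<Sum>c\<in>C \<inter> Fb (s \<gamma>). a \<gamma> c * a (\<gamma> \<odot> d) (iv d \<odot> c)) = 
      (\<Sum>c\<in>B \<inter> Fb (s \<gamma>). \<kappa> \<gamma> \<gamma> * \<kappa> (\<gamma> \<odot> d) (\<gamma> \<odot> d) * (P \<gamma> (\<gamma> \<odot> c) * P (\<gamma> \<odot> d) (\<gamma> \<odot> c)) / (1 + \<delta>))"
      unfolding CB[OF supp[OF g(1) False]]
    proof (intro sum.cong refl)
      fix c assume c: "c \<in> B \<inter> Fb (s \<gamma>)"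
      then have "\<gamma> \<odot> d \<odot> (iv d \<odot> c) = \<gamma> \<odot> c" using g by (simp add: mul_assoc)
      then show "a \<gamma> c * a (\<gamma> \<odot> d) (iv d \<odot> c) = \<kappa> \<gamma> \<gamma> * \<kappa> (\<gamma> \<odot> d) (\<gamma> \<odot> d) * (P \<gamma> (\<gamma> \<odot> c) * P (\<gamma> \<odot> d) (\<gamma> \<odot> c)) / (1 + \<delta>)"
        using \<delta> by (simp add: a_def mult_ac)
    qed
    then show ?thesis by (simp add: sum_distrib_left sum_divide_distrib)
  qed
  have "almost_inv a C K \<epsilon>"
    unfolding almost_inv_def
  proof (intro conjI ballI impI C)
    have p1: "continuous_map CT T fst" and p2: "continuous_map CT T snd"
      by (rule continuous_map_fst_snd_subtopology)+
    have p3: "continuous_map CT T (\<lambda>w. fst w \<odot> snd w)" by (intro cont_mul' p1 p2) auto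
    have "continuous_map RT euclidean (\<lambda>z. Re (k n z))"
      using continuous_map_compose[OF k(3)[of n], of euclidean Re] by (simp add: o_def continuous_on_Re continuous_on_id)
    from cont_RT_apply[OF this p1 p1] have c1: "continuous_map CT euclidean (\<lambda>w. \<kappa> (fst w) (fst w))"
      by (simp add: \<kappa>_def)
    have "continuous_map RT euclidean (\<lambda>(\<gamma>, \<eta>). P \<gamma> \<eta>)" using P(1) by (simp add: proper_kernel_def)
    from cont_RT_apply[OF this p1 p3] have c2: "continuous_map CT euclidean (\<lambda>w. P (fst w) (fst w \<odot> snd w))" by auto
    have "continuous_map CT euclidean (\<lambda>w. \<kappa> (fst w) (fst w) * P (fst w) (fst w \<odot> snd w) * inverse (sqrt (1 + \<delta>)))"
      by (intro continuous_map_real_mult c1 c2) auto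
    then show "continuous_map CT euclidean (\<lambda>(\<gamma>, c). a \<gamma> c)"
      by (simp add: a_def case_prod_beta' divide_inverse)
  next
    fix \<gamma> c assume g: "\<gamma> \<in> Ar" "c \<in> Fb (s \<gamma>) - C"
    show "a \<gamma> c = 0"
    proof (cases "\<kappa> \<gamma> \<gamma> = 0")
      case False
      then have "c \<notin> B" using supp[OF g(1)] g by (auto simp: C_def)
      then have "P \<gamma> (\<gamma> \<odot> c) = 0" using proper_kernel_zero[OF P(1) g(1)] g by blast
      then show ?thesis by (simp add: a_def)
    qed (simp add: a_def)
  next
    fix \<gamma> assume g: "\<gamma> \<in> Ar"
    let ?Q = "\<Sum>c\<in>B \<inter> Fb (s \<gamma>). P \<gamma> (\<gamma> \<odot> c) * P \<gamma> (\<gamma> \<odot> c)"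
    have "(\<Sum>c\<in>C \<inter> Fb (s \<gamma>). (a \<gamma> c)\<^sup>2) = (\<Sum>c\<in>C \<inter> Fb (s \<gamma>). a \<gamma> c * a (\<gamma> \<odot> s \<gamma>) (iv (s \<gamma>) \<odot> c))"
      using g by (intro sum.cong refl) (auto simp: power2_eq_square)
    also have "\<dots> = \<kappa> \<gamma> \<gamma> * \<kappa> \<gamma> \<gamma> * ?Q / (1 + \<delta>)" using sum[OF g, of "s \<gamma>"] g by simp
    \<comment> \<open>A row of \<open>P\<close> has squared norm within \<delta> of a diagonal
      value, hence at most 1 + \<delta>; this is the origin of the divisor in
      \<open>a\<close>.\<close>
    also have "\<dots> \<le> 1 * (1 + \<delta>) / (1 + \<delta>)"
    proof (intro divide_right_mono mult_mono)
      show "?Q \<le> 1 + \<delta>" using P(3)[OF g, of \<gamma>] g diag(2)[OF g] unfolding \<kappa>_def by auto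
      show "\<kappa> \<gamma> \<gamma> * \<kappa> \<gamma> \<gamma> \<le> 1" using diag[OF g] by (simp add: mult_le_one)
      show "0 \<le> ?Q" by (intro sum_nonneg) simp
    qed (use \<delta> in auto)
    finally show "(\<Sum>c\<in>C \<inter> Fb (s \<gamma>). (a \<gamma> c)\<^sup>2) \<le> 1" using \<delta> by simp
  next
    fix \<gamma> d assume g: "\<gamma> \<in> Ar" "d \<in> K" "s \<gamma> = r d"
    then have d: "d \<in> Ar" using KA by blast
    let ?Q = "\<Sum>c\<in>B \<inter> Fb (s \<gamma>). P \<gamma> (\<gamma> \<odot> c) * P (\<gamma> \<odot> d) (\<gamma> \<odot> c)"
    have "(\<gamma>, \<gamma>) \<in> A" "(\<gamma> \<odot> d, \<gamma> \<odot> d) \<in> A" "(\<gamma>, \<gamma> \<odot> d) \<in> A"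
      using g d by (auto simp: A_def diff_map_def K'_def)
    then have n3: "1 - \<delta> \<le> \<kappa> \<gamma> \<gamma>" "1 - \<delta> \<le> \<kappa> (\<gamma> \<odot> d) (\<gamma> \<odot> d)" "1 - \<delta> \<le> \<kappa> \<gamma> (\<gamma> \<odot> d)"
      using near by blast+
    have Q: "1 - 2 * \<delta> \<le> ?Q" using P(3)[OF g(1), of "\<gamma> \<odot> d"] g d n3(3) unfolding \<kappa>_def by auto
    \<comment> \<open>The two diagonal factors each lose \<delta>, the inner product of the rows
      loses 2 \<delta>, and the divisor costs a factor 1 + \<delta>. The difference of the two sides
      is 10 \<delta>^2 - 2 \<delta>^3.\<close>
    have "(1 - 5 * \<delta>) * (1 + \<delta>) \<le> (1 - \<delta>) * (1 - \<delta>) * (1 - 2 * \<delta>)"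
    proof -
      have "\<delta> ^ 3 \<le> \<delta>\<^sup>2" using \<delta> by (intro power_decreasing) auto
      moreover have "\<delta>\<^sup>2 \<le> 5 * \<delta>\<^sup>2" by simp
      ultimately have "\<delta> ^ 3 \<le> 5 * \<delta>\<^sup>2" by linarith
      then show ?thesis by (simp add: algebra_simps power2_eq_square power3_eq_cube)
    qed
    also have "\<dots> \<le> \<kappa> \<gamma> \<gamma> * \<kappa> (\<gamma> \<odot> d) (\<gamma> \<odot> d) * ?Q"
      using n3 Q \<delta> by (intro mult_mono mult_nonneg_nonneg) auto
    finally have "1 - 5 * \<delta> \<le> \<kappa> \<gamma> \<gamma> * \<kappa> (\<gamma> \<odot> d) (\<gamma> \<odot> d) * ?Q / (1 + \<delta>)"
      using \<delta> by (simp add: pos_le_divide_eq)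
    then show "1 - \<epsilon> \<le> (\<Sum>c\<in>C \<inter> Fb (s \<gamma>). a \<gamma> c * a (\<gamma> \<odot> d) (iv d \<odot> c))"
      unfolding sum[OF g(1) d g(3)] using \<delta> by linarith
  qed
  then show "\<exists>a C. almost_inv a C K \<epsilon>" by blast
qed

end

section \<open>Amenable spaces give almost invariant functions\<close>

lemma integral_finite_support:
  fixes f :: "'a \<Rightarrow> 'b::{banach, second_countable_topology}"
  assumes M: "finite_measure M" and S: "finite S" "S \<subseteq> space M" "\<And>z. z \<in> S \<Longrightarrow> {z} \<in> sets M"
    and f: "\<And>z. z \<in> space M \<Longrightarrow> z \<notin> S \<Longrightarrow> f z = 0"
  shows "(\<integral>z. f z \<partial>M) = (\<Sum>z\<in>S. measure M {z} *\<^sub>R f z)"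
proof -
  interpret finite_measure M by (rule M)
  have "(\<integral>z. f z \<partial>M) = (\<integral>z. (\<Sum>w\<in>S. indicat_real {w} z *\<^sub>R f w) \<partial>M)"
  proof (rule Bochner_Integration.integral_cong[OF refl])
    fix z assume z: "z \<in> space M"
    have "(\<Sum>w\<in>S. indicat_real {w} z *\<^sub>R f w) = (\<Sum>w\<in>S. if w = z then f z else 0)"
      by (intro sum.cong refl) (auto simp: indicator_def)
    also have "\<dots> = f z" using S(1) f[OF z] by simp
    finally show "f z = (\<Sum>w\<in>S. indicat_real {w} z *\<^sub>R f w)" by simp
  qed
  also have "\<dots> = (\<Sum>w\<in>S. \<integral>z. indicat_real {w} z *\<^sub>R f w \<partial>M)"
    using S(3) by (intro Bochner_Integration.integral_sum integrable_scaleR_left integrable_real_indicator)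
      (auto simp: emeasure_eq_measure)
  also have "\<dots> = (\<Sum>z\<in>S. measure M {z} *\<^sub>R f z)"
  proof (intro sum.cong refl)
    fix w assume "w \<in> S"
    then have "{w} \<in> sets M" using S(3) by blast
    then show "(\<integral>z. indicat_real {w} z *\<^sub>R f w \<partial>M) = measure M {w} *\<^sub>R f w"
      by (simp add: emeasure_eq_measure)
  qed
  finally show ?thesis .
qed

lemma measure_finite_eq_sum:
  assumes "finite_measure M" "finite S" "\<And>z. z \<in> S \<Longrightarrow> {z} \<in> sets M"
  shows "measure M S = (\<Sum>z\<in>S. measure M {z})"
  using assms by (intro finite_measure.finite_measure_eq_sum_singleton) auto

text \<open>This makes the supremum in \<open>tv_dist\<close> one over a bounded set, so that single
  partitions give lower bounds for it.\<close>

lemma partition_sum_le: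
  assumes \<mu>: "prob_space \<mu>" and \<nu>: "prob_space \<nu>" "sets \<nu> = sets \<mu>"
    and P: "finite P" "P \<subseteq> sets \<mu>" "partition_on (space \<mu>) P"
  shows "(\<Sum>A\<in>P. \<bar>measure \<mu> A - measure \<nu> A\<bar>) \<le> 2"
proof -
  interpret \<mu>: prob_space \<mu> by (rule \<mu>)
  interpret \<nu>: prob_space \<nu> by (rule \<nu>(1))
  have dis: "disjoint_family_on (\<lambda>A. A) P" using P(3)
    by (auto simp: partition_on_def disjoint_family_on_def disjoint_def)
  have U: "\<Union>P = space \<mu>" using P(3) by (auto simp: partition_on_def)
  have sp: "space \<nu> = space \<mu>" using \<nu>(2) by (rule sets_eq_imp_space_eq)
  have "(\<Sum>A\<in>P. \<bar>measure \<mu> A - measure \<nu> A\<bar>) \<le> (\<Sum>A\<in>P. measure \<mu> A + measure \<nu> A)"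
  proof (rule sum_mono)
    fix A
    have "0 \<le> measure \<mu> A" "0 \<le> measure \<nu> A" by simp_all
    then show "\<bar>measure \<mu> A - measure \<nu> A\<bar> \<le> measure \<mu> A + measure \<nu> A" by linarith
  qed
  also have "\<dots> = measure \<mu> (\<Union>A\<in>P. A) + measure \<nu> (\<Union>A\<in>P. A)"
  proof -
    have "measure \<mu> (\<Union>A\<in>P. A) = (\<Sum>A\<in>P. measure \<mu> A)"
      using P dis by (intro \<mu>.finite_measure_finite_Union) auto
    moreover have "measure \<nu> (\<Union>A\<in>P. A) = (\<Sum>A\<in>P. measure \<nu> A)"
      using P dis \<nu>(2) by (intro \<nu>.finite_measure_finite_Union) auto
    ultimately show ?thesis by (simp add: sum.distrib)
  qed
  also have "\<dots> = 2" using U \<mu>.prob_space \<nu>.prob_space sp by simp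
  finally show ?thesis .
qed

lemma tv_dist_ge:
  assumes \<mu>: "prob_space \<mu>" and \<nu>: "prob_space \<nu>" "sets \<nu> = sets \<mu>"
    and S: "finite S" "S \<subseteq> space \<mu>" "\<And>z. z \<in> S \<Longrightarrow> {z} \<in> sets \<mu>"
  shows "(\<Sum>z\<in>S. \<bar>measure \<mu> {z} - measure \<nu> {z}\<bar>) \<le> tv_dist \<mu> \<nu>"
proof -
  \<comment> \<open>The singletons of \<open>S\<close> and the remainder; an empty remainder is
    dropped since blocks of a partition are nonempty.\<close>
  define P where "P = (\<lambda>z. {z}) ` S \<union> ({space \<mu> - S} - {{}})"
  have finP: "finite P" using S(1) by (simp add: P_def)
  have "S \<in> sets \<mu>"
  proof -
    have "S = (\<Union>z\<in>S. {z})" by auto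
    also have "\<dots> \<in> sets \<mu>" using S by (intro sets.finite_UN) auto
    finally show ?thesis .
  qed
  then have setsP: "P \<subseteq> sets \<mu>" using S by (auto simp: P_def)
  have part: "partition_on (space \<mu>) P"
    using S(2) unfolding partition_on_def disjoint_def P_def by auto
  have "(\<Sum>z\<in>S. \<bar>measure \<mu> {z} - measure \<nu> {z}\<bar>) = (\<Sum>A\<in>(\<lambda>z. {z}) ` S. \<bar>measure \<mu> A - measure \<nu> A\<bar>)"
    by (subst sum.reindex) (auto simp: inj_on_def)
  also have "\<dots> \<le> (\<Sum>A\<in>P. \<bar>measure \<mu> A - measure \<nu> A\<bar>)"
    using finP by (intro sum_mono2) (auto simp: P_def)
  also have "\<dots> \<le> tv_dist \<mu> \<nu>"
    unfolding tv_dist_def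
  proof (rule cSUP_upper)
    show "bdd_above ((\<lambda>P. \<Sum>A\<in>P. \<bar>measure \<mu> A - measure \<nu> A\<bar>) ` {P. finite P \<and> P \<subseteq> sets \<mu> \<and> partition_on (space \<mu>) P})"
      using partition_sum_le[OF \<mu> \<nu>] by (intro bdd_aboveI2[of _ _ 2]) auto
  qed (use finP setsP part in auto)
  finally show ?thesis .
qed

text \<open>Both measures are carried by the finite set \<open>S\<close>, and grouping atoms into
  blocks can only decrease the sum of absolute differences.\<close>

lemma tv_dist_le:
  assumes \<mu>: "prob_space \<mu>" and \<nu>: "prob_space \<nu>" "sets \<nu> = sets \<mu>"
    and S: "finite S" "\<And>A. A \<in> sets \<mu> \<Longrightarrow> measure \<mu> A = (\<Sum>z\<in>S \<inter> A. f z)"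
      "\<And>A. A \<in> sets \<mu> \<Longrightarrow> measure \<nu> A = (\<Sum>z\<in>S \<inter> A. g z)"
  shows "\<bar>tv_dist \<mu> \<nu>\<bar> \<le> (\<Sum>z\<in>S. \<bar>f z - g z\<bar>)"
proof -
  interpret \<mu>: prob_space \<mu> by (rule \<mu>)
  let ?D = "{P. finite P \<and> P \<subseteq> sets \<mu> \<and> partition_on (space \<mu>) P}"
  have "{space \<mu>} \<in> ?D" using \<mu>.not_empty by (auto simp: partition_on_def disjoint_def)
  have le: "(\<Sum>A\<in>P. \<bar>measure \<mu> A - measure \<nu> A\<bar>) \<le> (\<Sum>z\<in>S. \<bar>f z - g z\<bar>)" if P: "P \<in> ?D" for P
  proof -
    have "(\<Sum>A\<in>P. \<bar>measure \<mu> A - measure \<nu> A\<bar>) \<le> (\<Sum>A\<in>P. \<Sum>z\<in>S \<inter> A. \<bar>f z - g z\<bar>)"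
      using P S by (intro sum_mono) (auto simp: sum_subtractf[symmetric] subset_iff intro!: sum_abs)
    also have "\<dots> = (\<Sum>z\<in>(\<Union>A\<in>P. S \<inter> A). \<bar>f z - g z\<bar>)"
    proof (rule sum.UNION_disjoint[symmetric])
      show "\<forall>A\<in>P. \<forall>B\<in>P. A \<noteq> B \<longrightarrow> S \<inter> A \<inter> (S \<inter> B) = {}"
        using P unfolding partition_on_def disjoint_def by blast
    qed (use P S(1) in auto)
    also have "\<dots> \<le> (\<Sum>z\<in>S. \<bar>f z - g z\<bar>)" using S(1) by (intro sum_mono2) auto
    finally show ?thesis .
  qed
  have "tv_dist \<mu> \<nu> \<le> (\<Sum>z\<in>S. \<bar>f z - g z\<bar>)"
    unfolding tv_dist_def 
  proof (rule cSUP_least)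
    show "?D \<noteq> {}" using \<open>{space \<mu>} \<in> ?D\<close> by blast
  qed (rule le)
  moreover have "0 \<le> tv_dist \<mu> \<nu>"
    using tv_dist_ge[OF \<mu> \<nu>, of "{}"] by simp
  ultimately show ?thesis by simp
qed

section \<open>Systems of probability measures on the semidirect product\<close>

locale etale_space = etale G for G :: "'g groupoid" +
  fixes Y :: "'y topology" and p :: "'y \<Rightarrow> 'g" and act :: "'g \<Rightarrow> 'y \<Rightarrow> 'y"
  assumes gs: "gspace G Y p act"
begin

abbreviation "H \<equiv> semidirect G Y p act"
abbreviation "HT \<equiv> subtopology (prod_topology Y T) {(y, \<gamma>). p y = r \<gamma>}"

lemma Hausdorff_Y: "Hausdorff_space Y"
  using gs by (simp add: gspace_def is_fibre_space_def)

lemma cont_p_unit: "continuous_map Y (unit_space G) p"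
  using gs by (simp add: gspace_def is_fibre_space_def)

lemma cont_p: "continuous_map Y T p"
  using cont_p_unit by (simp add: cont_unit_space_iff)

lemma p_units [simp]: "y \<in> topspace Y \<Longrightarrow> p y \<in> units G"
  using cont_p_unit by (simp add: cont_unit_space_iff)

lemma p_Ar [simp]: "y \<in> topspace Y \<Longrightarrow> p y \<in> Ar"
  using p_units units_subset by blast

lemma anchor_unit [simp]: "y \<in> topspace Y \<Longrightarrow> r (p y) = p y" "y \<in> topspace Y \<Longrightarrow> s (p y) = p y"
  using p_units[of y] by (auto simp: units_eq')

lemma cont_act: "continuous_map (subtopology (prod_topology T Y) {(\<gamma>, y). s \<gamma> = p y}) Y (\<lambda>(\<gamma>, y). act \<gamma> y)"
  using gs by (simp add: gspace_def)

lemma cont_in_Y: "continuous_map Z Y f \<Longrightarrow> z \<in> topspace Z \<Longrightarrow> f z \<in> topspace Y"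
  using continuous_map_image_subset_topspace by fastforce

lemma cont_act':
  assumes "continuous_map Z T f" "continuous_map Z Y g" "\<And>z. z \<in> topspace Z \<Longrightarrow> s (f z) = p (g z)"
  shows "continuous_map Z Y (\<lambda>z. act (f z) (g z))"
proof -
  have "continuous_map Z (subtopology (prod_topology T Y) {(\<gamma>, y). s \<gamma> = p y}) (\<lambda>z. (f z, g z))"
    using assms by (auto simp: continuous_map_in_subtopology continuous_map_pairedI)
  from continuous_map_compose[OF this cont_act] show ?thesis by (simp add: o_def)
qed

lemma act_in [simp]:
  assumes "\<gamma> \<in> Ar" "y \<in> topspace Y" "s \<gamma> = p y"
  shows "act \<gamma> y \<in> topspace Y" "p (act \<gamma> y) = r \<gamma>"
proof -
  show "p (act \<gamma> y) = r \<gamma>" using gs assms by (simp add: gspace_def)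
  have "(\<gamma>, y) \<in> topspace (subtopology (prod_topology T Y) {(\<gamma>, y). s \<gamma> = p y})" using assms by simp
  then show "act \<gamma> y \<in> topspace Y"
    using continuous_map_image_subset_topspace[OF cont_act] by fastforce
qed

lemma act_unit [simp]: "y \<in> topspace Y \<Longrightarrow> act (p y) y = y"
  using gs by (simp add: gspace_def)

lemma act_mul:
  assumes "\<gamma> \<in> Ar" "\<eta> \<in> Ar" "s \<gamma> = r \<eta>" "y \<in> topspace Y" "s \<eta> = p y"
  shows "act (\<gamma> \<odot> \<eta>) y = act \<gamma> (act \<eta> y)"
  using gs assms by (simp add: gspace_def)

lemma gtop_H: "gtop H = HT" by (simp add: semidirect_def)

lemma grng_H: "grng H (y, \<gamma>) = (y, p y)" by (simp add: semidirect_def)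

lemma gsrc_H: "gsrc H (y, \<gamma>) = (act (iv \<gamma>) y, p (act (iv \<gamma>) y))" by (simp add: semidirect_def)

lemma gmult_H: "gmult H (y, \<gamma>) (z, \<eta>) = (y, \<gamma> \<odot> \<eta>)" by (simp add: semidirect_def)

lemma arrows_H: "arrows H = {(y, \<gamma>). y \<in> topspace Y \<and> \<gamma> \<in> Ar \<and> p y = r \<gamma>}"
  unfolding arrows_def[of H] gtop_H by auto

lemma units_H: "units H = (\<lambda>y. (y, p y)) ` topspace Y"
proof
  show "units H \<subseteq> (\<lambda>y. (y, p y)) ` topspace Y"
    by (auto simp: units_def arrows_H grng_H)
  show "(\<lambda>y. (y, p y)) ` topspace Y \<subseteq> units H"
  proof
    fix u assume "u \<in> (\<lambda>y. (y, p y)) ` topspace Y"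
    then obtain y where y: "y \<in> topspace Y" "u = (y, p y)" by blast
    then have "(y, p y) \<in> arrows H" by (simp add: arrows_H)
    then have "grng H (y, p y) \<in> units H" unfolding units_def by (rule imageI)
    then show "u \<in> units H" using y by (simp add: grng_H)
  qed
qed

lemma fibre_H: "y \<in> topspace Y \<Longrightarrow> fibre H (y, p y) = {y} \<times> Fb (p y)"
  by (auto simp: fibre_def[of H] arrows_H grng_H)

lemma unit_space_H: "unit_space H = subtopology HT (units H)"
  by (simp add: unit_space_def gtop_H)

lemma cont_HT_fst: "continuous_map HT Y fst" and cont_HT_snd: "continuous_map HT T snd"
  by (rule continuous_map_fst_snd_subtopology)+

lemma cont_into_HT:
  assumes "continuous_map Z Y f" "continuous_map Z T g" "\<And>z. z \<in> topspace Z \<Longrightarrow> p (f z) = r (g z)"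
  shows "continuous_map Z HT (\<lambda>z. (f z, g z))"
  using assms by (auto simp: continuous_map_in_subtopology continuous_map_pairedI)

lemma cont_into_units_H:
  assumes "continuous_map Z Y f"
  shows "continuous_map Z (unit_space H) (\<lambda>z. (f z, p (f z)))"
proof -
  have "continuous_map Z T (\<lambda>z. p (f z))"
    using continuous_map_compose[OF assms cont_p] by (simp add: o_def)
  then have "continuous_map Z HT (\<lambda>z. (f z, p (f z)))"
    using assms cont_in_Y[OF assms] by (intro cont_into_HT) auto
  then show ?thesis
    unfolding unit_space_H units_H using cont_in_Y[OF assms]
    by (auto simp: continuous_map_in_subtopology[of _ HT])
qed

text \<open>A neighbourhood of c on which r is injective meets the fibre in c alone. Hence every
  subset of a fibre is Borel and the compact subsets are the finite ones.\<close>

lemma fibre_space_H: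
  assumes y: "y \<in> topspace Y"
  shows "fibre_space H (y, p y) = discrete_topology ({y} \<times> Fb (p y))"
proof -
  have "openin (subtopology HT ({y} \<times> Fb (p y))) {z}" if z: "z \<in> {y} \<times> Fb (p y)" for z
  proof -
    obtain c where c: "z = (y, c)" "c \<in> Ar" "r c = p y" using z by auto
    obtain U where U: "openin T U" "c \<in> U" "inj_on r U" using etale_nbhd[OF c(2)] by metis
    have "openin (prod_topology Y T) (topspace Y \<times> U)" using U by (simp add: openin_prod_Times_iff)
    then have "openin HT ({(y, \<gamma>). p y = r \<gamma>} \<inter> topspace Y \<times> U)" by (rule openin_subtopology_Int2)
    then have "openin (subtopology HT ({y} \<times> Fb (p y))) (({y} \<times> Fb (p y)) \<inter> ({(y, \<gamma>). p y = r \<gamma>} \<inter> topspace Y \<times> U))"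
      by (rule openin_subtopology_Int2)
    moreover have "({y} \<times> Fb (p y)) \<inter> ({(y, \<gamma>). p y = r \<gamma>} \<inter> topspace Y \<times> U) = {z}"
    proof (intro subset_antisym subsetI)
      fix w assume "w \<in> ({y} \<times> Fb (p y)) \<inter> ({(y, \<gamma>). p y = r \<gamma>} \<inter> topspace Y \<times> U)"
      then obtain c' where "w = (y, c')" "c' \<in> U" "r c' = p y" by auto
      then show "w \<in> {z}" using inj_onD[OF U(3), of c' c] U(2) c by simp
    qed (use U(2) c y in auto)
    ultimately show ?thesis by simp
  qed
  moreover have "topspace (subtopology HT ({y} \<times> Fb (p y))) = {y} \<times> Fb (p y)" using y by auto
  ultimately have "discrete_topology ({y} \<times> Fb (p y)) = subtopology HT ({y} \<times> Fb (p y))"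
    by (subst discrete_topology_unique) blast
  then show ?thesis by (simp add: fibre_space_def gtop_H fibre_H y)
qed

lemma fibre_borel_H:
  assumes y: "y \<in> topspace Y"
  shows "sets (fibre_borel H (y, p y)) = Pow ({y} \<times> Fb (p y))" "space (fibre_borel H (y, p y)) = {y} \<times> Fb (p y)"
proof -
  let ?F = "{y} \<times> Fb (p y)"
  have eq: "fibre_borel H (y, p y) = sigma ?F (Pow ?F)"
    by (simp add: fibre_borel_def fibre_space_H[OF y] Pow_def)
  show "space (fibre_borel H (y, p y)) = ?F" unfolding eq by (simp add: space_measure_of_conv)
  have "sigma_sets ?F (Pow ?F) = Pow ?F"
    by (rule sigma_algebra.sigma_sets_eq[OF sigma_algebra_Pow])
  then show "sets (fibre_borel H (y, p y)) = Pow ?F" unfolding eq by simp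
qed

lemma closedin_HT: "closedin (prod_topology Y T) {z \<in> topspace Y \<times> Ar. p (fst z) = r (snd z)}"
proof -
  have "continuous_map (prod_topology Y T) T (\<lambda>z. p (fst z))"
    using continuous_map_compose[OF continuous_map_fst cont_p] by (simp add: o_def)
  moreover have "continuous_map (prod_topology Y T) T (\<lambda>z. r (snd z))"
    by (intro cont_r' continuous_map_snd)
  ultimately show ?thesis using closedin_continuous_maps_eq[OF Hausdorff_T] by fastforce
qed

lemma compactin_HT:
  assumes "compactin Y B" "compactin T K"
  shows "compactin HT {(y, \<gamma>). y \<in> B \<and> \<gamma> \<in> K \<and> p y = r \<gamma>}"
proof -
  have "compactin (prod_topology Y T) ({z \<in> topspace Y \<times> Ar. p (fst z) = r (snd z)} \<inter> (B \<times> K))"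
    using assms by (intro closed_Int_compactin closedin_HT) (simp add: compactin_Times)
  moreover have "{z \<in> topspace Y \<times> Ar. p (fst z) = r (snd z)} \<inter> (B \<times> K) = {(y, \<gamma>). y \<in> B \<and> \<gamma> \<in> K \<and> p y = r \<gamma>}"
    using compactin_subset_topspace[OF assms(1)] compactin_subset_topspace[OF assms(2)] by auto
  ultimately show ?thesis by (auto simp: compactin_subtopology)
qed

definition mass :: "('y \<times> 'g \<Rightarrow> ('y \<times> 'g) measure) \<Rightarrow> 'y \<Rightarrow> 'g \<Rightarrow> real" where
  "mass m y c = measure (m (y, p y)) {(y, c)}"

text \<open>The last claim is inner regularity on a discrete fibre: all but an arbitrarily small
  part of the mass sits on finitely many atoms.\<close>

lemma prob_system:
  assumes m: "m \<in> continuous_prob_systems H" and y: "y \<in> topspace Y"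
  shows "prob_space (m (y, p y))" "sets (m (y, p y)) = Pow ({y} \<times> Fb (p y))" "space (m (y, p y)) = {y} \<times> Fb (p y)"
    "\<And>e. e < 1 \<Longrightarrow> \<exists>J. finite J \<and> J \<subseteq> Fb (p y) \<and> e < (\<Sum>c\<in>J. mass m y c)"
proof -
  have "fibre_prob_measure H (y, p y) (m (y, p y))"
    using m y by (auto simp: continuous_prob_systems_def units_H)
  then have fp: "prob_space (m (y, p y))" "sets (m (y, p y)) = sets (fibre_borel H (y, p y))"
    "\<forall>A\<in>sets (m (y, p y)). emeasure (m (y, p y)) A = 
       (SUP K\<in>{K. compactin (fibre_space H (y, p y)) K \<and> K \<subseteq> A}. emeasure (m (y, p y)) K)"
    by (auto simp: fibre_prob_measure_def)
  then interpret prob_space "m (y, p y)" by blast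
  show "prob_space (m (y, p y))" by (rule fp)
  show sets: "sets (m (y, p y)) = Pow ({y} \<times> Fb (p y))" using fp(2) fibre_borel_H[OF y] by simp
  show space: "space (m (y, p y)) = {y} \<times> Fb (p y)"
    using sets_eq_imp_space_eq[OF fp(2)] fibre_borel_H[OF y] by simp
  fix e :: real assume e: "e < 1"
  have "ennreal e < emeasure (m (y, p y)) (space (m (y, p y)))"
    using e emeasure_space_1 by (simp add: ennreal_less_one_iff)
  also have "\<dots> = (SUP K\<in>{K. compactin (fibre_space H (y, p y)) K \<and> K \<subseteq> space (m (y, p y))}. emeasure (m (y, p y)) K)"
    using fp(3) by blast
  finally obtain K where K: "compactin (fibre_space H (y, p y)) K" "K \<subseteq> space (m (y, p y))" 
    "ennreal e < emeasure (m (y, p y)) K"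
    unfolding less_SUP_iff by blast
  have finK: "finite K" using K(1) by (simp add: fibre_space_H[OF y] compactin_discrete_topology)
  have "e < measure (m (y, p y)) K"
    using K(3) by (simp add: emeasure_eq_measure ennreal_less_iff) (meson ennreal_less_iff ennreal_leI leD le_less_linear measure_nonneg not_le)
  also have "measure (m (y, p y)) K = (\<Sum>z\<in>K. measure (m (y, p y)) {z})"
    using K(2) finK by (intro measure_finite_eq_sum finite_measure_axioms) (auto simp: sets space)
  also have "\<dots> = (\<Sum>z\<in>(\<lambda>c. (y, c)) ` (snd ` K). measure (m (y, p y)) {z})"
    using K(2) by (intro sum.cong refl) (force simp: space image_iff)
  also have "\<dots> = (\<Sum>c\<in>snd ` K. mass m y c)"
    by (subst sum.reindex) (auto simp: inj_on_def mass_def)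
  finally show "\<exists>J. finite J \<and> J \<subseteq> Fb (p y) \<and> e < (\<Sum>c\<in>J. mass m y c)"
    using finK K(2) by (intro exI[of _ "snd ` K"]) (auto simp: space)
qed

lemma mass_nonneg [simp]: "0 \<le> mass m y c"
  by (simp add: mass_def)

lemma mass_sum_le:
  assumes m: "m \<in> continuous_prob_systems H" and y: "y \<in> topspace Y" and J: "finite J" "J \<subseteq> Fb (p y)"
  shows "(\<Sum>c\<in>J. mass m y c) \<le> 1"
proof -
  note P = prob_system[OF m y]
  interpret prob_space "m (y, p y)" by (rule P)
  have "(\<Sum>c\<in>J. mass m y c) = (\<Sum>z\<in>(\<lambda>c. (y, c)) ` J. measure (m (y, p y)) {z})"
    by (subst sum.reindex) (auto simp: inj_on_def mass_def)
  also have "\<dots> = measure (m (y, p y)) ((\<lambda>c. (y, c)) ` J)"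
    using J by (intro measure_finite_eq_sum[symmetric] finite_measure_axioms) (auto simp: P(2))
  also have "\<dots> \<le> 1" by simp
  finally show ?thesis .
qed

lemma mass_integral:
  assumes m: "m \<in> continuous_prob_systems H" and y: "y \<in> topspace Y"
    and C: "rproper C" and f: "\<And>c. c \<in> Ar \<Longrightarrow> c \<notin> C \<Longrightarrow> f c = 0"
  shows "(\<integral>z. complex_of_real (f (snd z)) \<partial>(m (y, p y))) = complex_of_real (\<Sum>c\<in>C \<inter> Fb (p y). f c * mass m y c)"
proof -
  note P = prob_system[OF m y]
  interpret prob_space "m (y, p y)" by (rule P)
  let ?S = "(\<lambda>c. (y, c)) ` (C \<inter> Fb (p y))"
  have "(\<integral>z. complex_of_real (f (snd z)) \<partial>(m (y, p y))) = (\<Sum>z\<in>?S. measure (m (y, p y)) {z} *\<^sub>R complex_of_real (f (snd z)))"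
  proof (rule integral_finite_support[OF finite_measure_axioms])
    show "finite ?S" using finite_fibre_rproper[OF C] by blast
    show "complex_of_real (f (snd z)) = 0" if z: "z \<in> space (m (y, p y))" "z \<notin> ?S" for z
    proof -
      obtain c where c: "z = (y, c)" "c \<in> Fb (p y)" using z(1) unfolding P(3) by auto
      then have "c \<notin> C" using z(2) by blast
      then show ?thesis using f c by simp
    qed
  qed (auto simp: P(2,3))
  also have "\<dots> = (\<Sum>c\<in>C \<inter> Fb (p y). complex_of_real (f c * mass m y c))"
    by (subst sum.reindex) (auto simp: inj_on_def mass_def scaleR_conv_of_real mult.commute)
  finally show ?thesis by simp
qed

text \<open>Translation by (y, d) moves the atom \<open>iv d \<odot> c\<close> of the measure at
  \<open>y'\<close> to the position \<open>c\<close> over \<open>y\<close>, so the sum compares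
  atoms of two measures on one fibre and \<open>tv_dist_ge\<close> applies.\<close>

lemma mass_translate:
  assumes m: "m \<in> continuous_prob_systems H" and y: "y \<in> topspace Y" and d: "d \<in> Ar" "r d = p y"
    and J: "finite J" "J \<subseteq> Fb (p y)"
  defines "y' \<equiv> act (iv d) y"
  shows "(\<Sum>c\<in>J. \<bar>mass m y c - mass m y' (iv d \<odot> c)\<bar>) \<le> 
    tv_dist (translate_measure H (y, d) (m (gsrc H (y, d)))) (m (grng H (y, d)))"
proof -
  have y': "y' \<in> topspace Y" "p y' = s d" using y d by (auto simp: y'_def)
  note P = prob_system[OF m y]
  note P' = prob_system[OF m y'(1)]
  interpret P': prob_space "m (y', p y')" by (rule P')
  define \<nu> where "\<nu> = translate_measure H (y, d) (m (y', p y'))"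
  have \<nu>: "\<nu> = distr (m (y', p y')) (fibre_borel H (y, p y)) (gmult H (y, d))"
    unfolding \<nu>_def translate_measure_def grng_H ..
  have meas: "gmult H (y, d) \<in> measurable (m (y', p y')) (fibre_borel H (y, p y))"
  proof (rule measurableI)
    fix w assume "w \<in> space (m (y', p y'))"
    then obtain e where "w = (y', e)" "e \<in> Fb (p y')" unfolding P'(3) by auto
    then show "gmult H (y, d) w \<in> space (fibre_borel H (y, p y))"
      unfolding fibre_borel_H[OF y] using d y' by (simp add: gmult_H)
  qed (simp add: P'(2), simp add: P'(3) Int_commute)
  have prob\<nu>: "prob_space \<nu>" unfolding \<nu> by (rule P'.prob_space_distr[OF meas])
  have sets\<nu>: "sets \<nu> = Pow ({y} \<times> Fb (p y))" "space \<nu> = {y} \<times> Fb (p y)"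
    unfolding \<nu> by (simp_all add: fibre_borel_H[OF y])
  have \<nu>c: "measure \<nu> {(y, c)} = mass m y' (iv d \<odot> c)" if c: "c \<in> Fb (p y)" for c
  proof -
    have "measure \<nu> {(y, c)} = measure (m (y', p y')) (gmult H (y, d) -` {(y, c)} \<inter> space (m (y', p y')))"
      unfolding \<nu> using c by (intro measure_distr[OF meas]) (simp add: fibre_borel_H[OF y])
    also have "gmult H (y, d) -` {(y, c)} \<inter> space (m (y', p y')) = {(y', iv d \<odot> c)}"
    proof (intro subset_antisym subsetI)
      fix w assume "w \<in> gmult H (y, d) -` {(y, c)} \<inter> space (m (y', p y'))"
      then obtain e where e: "w = (y', e)" "e \<in> Fb (p y')" "d \<odot> e = c"
        unfolding P'(3) by (auto simp: gmult_H)
      then show "w \<in> {(y', iv d \<odot> c)}" using d y' by (auto simp flip: e(3))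
    qed (unfold P'(3), use c d y' in \<open>auto simp: gmult_H\<close>)
    finally show ?thesis by (simp add: mass_def)
  qed
  have "(\<Sum>c\<in>J. \<bar>mass m y c - mass m y' (iv d \<odot> c)\<bar>) = (\<Sum>c\<in>J. \<bar>measure \<nu> {(y, c)} - measure (m (y, p y)) {(y, c)}\<bar>)"
    using J by (intro sum.cong refl) (auto simp: \<nu>c subset_iff mass_def)
  also have "\<dots> = (\<Sum>z\<in>(\<lambda>c. (y, c)) ` J. \<bar>measure \<nu> {z} - measure (m (y, p y)) {z}\<bar>)"
    by (subst sum.reindex) (auto simp: inj_on_def)
  also have "\<dots> \<le> tv_dist \<nu> (m (y, p y))"
    by (rule tv_dist_ge) (use prob\<nu> P(1) J in \<open>auto simp: sets\<nu> P(2)\<close>)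
  finally show ?thesis unfolding \<nu>_def gsrc_H grng_H y'_def .
qed

text \<open>Fibrewise compactness enters here: only points y with \<open>p y\<close> in the compact
  image of \<open>C\<close> matter, and these form a compact set.\<close>

lemma Cc_snd:
  assumes fc: "fibrewise_compact (unit_space G) Y p"
    and f: "continuous_map T euclideanreal f" "compactin T C" "\<And>c. c \<in> Ar \<Longrightarrow> c \<notin> C \<Longrightarrow> f c = 0"
  shows "(\<lambda>z. complex_of_real (f (snd z))) \<in> Cc (gtop H)"
  unfolding Cc_def gtop_H
proof (intro CollectI conjI)
  have "continuous_map HT euclideanreal (\<lambda>z. f (snd z))"
    using continuous_map_compose[OF cont_HT_snd f(1)] by (simp add: o_def)
  from continuous_map_compose[OF this, of euclidean complex_of_real]
  show "continuous_map HT euclidean (\<lambda>z. complex_of_real (f (snd z)))"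
    by (simp add: o_def continuous_on_of_real continuous_on_id)
  have "compactin (unit_space G) (r ` C)" using f(2) cont_r_unit_space image_compactin by blast
  then have B: "compactin Y {y \<in> topspace Y. p y \<in> r ` C}" using fc by (simp add: fibrewise_compact_def)
  let ?D = "{(y, \<gamma>). y \<in> {y \<in> topspace Y. p y \<in> r ` C} \<and> \<gamma> \<in> C \<and> p y = r \<gamma>}"
  have D: "compactin HT ?D" by (rule compactin_HT[OF B f(2)])
  have "Hausdorff_space HT"
    using Hausdorff_T Hausdorff_Y by (intro Hausdorff_space_subtopology) (simp add: Hausdorff_space_prod_topology)
  then have cl: "closedin HT ?D" using D compactin_imp_closedin by blast
  have "HT closure_of {z \<in> topspace HT. complex_of_real (f (snd z)) \<noteq> 0} \<subseteq> ?D"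
  proof (rule closure_of_minimal[OF _ cl], rule)
    fix z assume "z \<in> {z \<in> topspace HT. complex_of_real (f (snd z)) \<noteq> 0}"
    then obtain y c where z: "z = (y, c)" "y \<in> topspace Y" "c \<in> Ar" "p y = r c" "f c \<noteq> 0" by auto
    then have "c \<in> C" using f(3) by blast
    then show "z \<in> ?D" using z by auto
  qed
  then show "compactin HT (HT closure_of {z \<in> topspace HT. complex_of_real (f (snd z)) \<noteq> 0})"
    using D by (meson closed_compactin closedin_closure_of)
qed

lemma mass_integral_continuous:
  assumes fc: "fibrewise_compact (unit_space G) Y p" and m: "m \<in> continuous_prob_systems H"
    and f: "continuous_map T euclideanreal f" "compactin T C" "\<And>c. c \<in> Ar \<Longrightarrow> c \<notin> C \<Longrightarrow> f c = 0"
  shows "continuous_map Y euclideanreal (\<lambda>y. \<Sum>c\<in>C \<inter> Fb (p y). f c * mass m y c)"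
proof -
  have "continuous_map (unit_space H) euclidean (\<lambda>u. \<integral>z. complex_of_real (f (snd z)) \<partial>(m u))"
    using m Cc_snd[OF fc f] unfolding continuous_prob_systems_def by blast
  from continuous_map_compose[OF cont_into_units_H[OF continuous_map_id] this]
  have "continuous_map Y euclidean (\<lambda>y. \<integral>z. complex_of_real (f (snd z)) \<partial>(m (y, p y)))" by (simp add: o_def)
  from continuous_map_compose[OF this, of euclidean Re]
  have "continuous_map Y euclideanreal (\<lambda>y. Re (\<integral>z. complex_of_real (f (snd z)) \<partial>(m (y, p y))))"
    by (simp add: o_def continuous_on_Re continuous_on_id)
  then show ?thesis
  proof (rule continuous_map_eq)
    fix y assume y: "y \<in> topspace Y"
    have "(\<integral>z. complex_of_real (f (snd z)) \<partial>(m (y, p y))) = complex_of_real (\<Sum>c\<in>C \<inter> Fb (p y). f c * mass m y c)"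
      using f(3) by (intro mass_integral[OF m y rproper_compact[OF f(2)]]) auto
    then show "Re (\<integral>z. complex_of_real (f (snd z)) \<partial>(m (y, p y))) = (\<Sum>c\<in>C \<inter> Fb (p y). f c * mass m y c)"
      by (simp only: Re_complex_of_real)
  qed
qed

text \<open>A cutoff equal to 1 near the given arrow and vanishing off a set where r is injective
  isolates a single atom in each nearby fibre, so the continuous integral of the cutoff is that
  atom.\<close>

lemma mass_continuous:
  assumes fc: "fibrewise_compact (unit_space G) Y p" and m: "m \<in> continuous_prob_systems H"
  shows "continuous_map HT euclideanreal (\<lambda>(y, c). mass m y c)"
proof (rule continuous_map_locally)
  fix z0 assume "z0 \<in> topspace HT"
  then obtain y0 c0 where z0: "z0 = (y0, c0)" "y0 \<in> topspace Y" "c0 \<in> Ar" "p y0 = r c0" by auto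
  obtain U where U: "openin T U" "c0 \<in> U" "inj_on r U" using etale_nbhd[OF z0(3)] by metis
  have "neighbourhood_base_of (compactin T) T"
    using lc_T Hausdorff_T locally_compact_space_neighbourhood_base by blast
  then obtain N L where N: "openin T N" "compactin T L" "c0 \<in> N" "N \<subseteq> L" "L \<subseteq> U"
    using U(1,2) unfolding neighbourhood_base_of by (elim allE[of _ U] allE[of _ c0]) auto
  obtain f :: "'g \<Rightarrow> real" and C where f: "continuous_map T euclideanreal f" "\<forall>c\<in>L. f c = 1" "compactin T C"
      "\<forall>c\<in>Ar. c \<notin> C \<or> c \<notin> U \<longrightarrow> f c = 0" "L \<subseteq> C"
    using compact_Urysohn_open[OF N(2) U(1) N(5)] by blast
  have c: "continuous_map Y euclideanreal (\<lambda>y. \<Sum>c\<in>C \<inter> Fb (p y). f c * mass m y c)"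
    using f by (intro mass_integral_continuous[OF fc m]) auto
  let ?N = "{z \<in> topspace HT. snd z \<in> N}"
  have o: "openin HT ?N" using cont_HT_snd N(1) by (rule openin_continuous_map_preimage)
  have "continuous_map (subtopology HT ?N) Y fst"
    using cont_HT_fst by (rule continuous_map_from_subtopology)
  from continuous_map_compose[OF this c]
  have "continuous_map (subtopology HT ?N) euclideanreal (\<lambda>z. \<Sum>c\<in>C \<inter> Fb (p (fst z)). f c * mass m (fst z) c)"
    by (simp add: o_def)
  moreover have "(\<Sum>c\<in>C \<inter> Fb (p (fst z)). f c * mass m (fst z) c) = (case z of (y, c) \<Rightarrow> mass m y c)"
    if "z \<in> topspace (subtopology HT ?N)" for z
  proof -
    obtain y c where z: "z = (y, c)" "y \<in> topspace Y" "c \<in> Ar" "p y = r c" "c \<in> N" using \<open>z \<in> _\<close> by auto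
    have "(\<Sum>c\<in>C \<inter> Fb (p y). f c * mass m y c) = (\<Sum>c'\<in>{c}. f c' * mass m y c')"
    proof (rule sum.mono_neutral_right)
      show "finite (C \<inter> Fb (p y))" using f by (intro finite_fibre_rproper rproper_compact)
      show "{c} \<subseteq> C \<inter> Fb (p y)" using z N f by auto
      show "\<forall>c'\<in>C \<inter> Fb (p y) - {c}. f c' * mass m y c' = 0"
      proof
        fix c' assume c': "c' \<in> C \<inter> Fb (p y) - {c}"
        then have "c' \<notin> U" using inj_onD[OF U(3), of c' c] z N by auto
        then show "f c' * mass m y c' = 0" using f(4) c' by auto
      qed
    qed
    also have "\<dots> = mass m y c" using f(2) z N by auto
    finally show ?thesis by (simp add: z)
  qed
  ultimately have "continuous_map (subtopology HT ?N) euclideanreal (\<lambda>(y, c). mass m y c)"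
    by (rule continuous_map_eq)
  moreover have "z0 \<in> ?N" using z0 N by simp
  ultimately show "\<exists>N. openin HT N \<and> z0 \<in> N \<and> continuous_map (subtopology HT N) euclideanreal (\<lambda>(y, c). mass m y c)"
    using o by blast
qed

text \<open>At one point finitely many atoms carry almost all mass. The integral of a cutoff that is
  1 on them depends continuously on y, so its support serves a whole neighbourhood; compactness of
  \<open>B\<close> gives a common set.\<close>

lemma mass_concentrated:
  assumes fc: "fibrewise_compact (unit_space G) Y p" and m: "m \<in> continuous_prob_systems H"
    and B: "compactin Y B" and e: "0 < \<epsilon>"
  shows "\<exists>L. compactin T L \<and> (\<forall>y\<in>B. 1 - \<epsilon> \<le> (\<Sum>c\<in>L \<inter> Fb (p y). mass m y c))"
proof -
  have BY: "B \<subseteq> topspace Y" using B by (rule compactin_subset_topspace)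
  have "\<exists>N C. openin Y N \<and> y0 \<in> N \<and> compactin T C \<and> (\<forall>y\<in>N. 1 - \<epsilon> \<le> (\<Sum>c\<in>C \<inter> Fb (p y). mass m y c))" if "y0 \<in> B" for y0
  proof -
    have y0: "y0 \<in> topspace Y" using BY \<open>y0 \<in> B\<close> by blast
    obtain J where J: "finite J" "J \<subseteq> Fb (p y0)" "1 - \<epsilon> < (\<Sum>c\<in>J. mass m y0 c)"
      using prob_system(4)[OF m y0, of "1 - \<epsilon>"] e by auto
    have "compactin T J" using J(1,2) by (intro finite_imp_compactin) (auto simp: subset_iff fibre_def)
    then obtain f :: "'g \<Rightarrow> real" and C where f: "continuous_map T euclideanreal f" "\<forall>c\<in>Ar. 0 \<le> f c \<and> f c \<le> 1"
      "\<forall>c\<in>J. f c = 1" "compactin T C" "\<forall>c\<in>Ar. c \<notin> C \<longrightarrow> f c = 0" "J \<subseteq> C"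
      using compact_Urysohn by metis
    let ?\<phi> = "\<lambda>y. \<Sum>c\<in>C \<inter> Fb (p y). f c * mass m y c"
    have cphi: "continuous_map Y euclideanreal ?\<phi>"
      using f by (intro mass_integral_continuous[OF fc m]) auto
    have fin: "finite (C \<inter> Fb (p y))" for y using f(4) by (intro finite_fibre_rproper rproper_compact)
    let ?N = "{y \<in> topspace Y. ?\<phi> y \<in> {1 - \<epsilon><..}}"
    have "openin Y ?N" using cphi by (rule openin_continuous_map_preimage) simp
    moreover have "y0 \<in> ?N"
    proof -
      have "(\<Sum>c\<in>J. mass m y0 c) = (\<Sum>c\<in>J. f c * mass m y0 c)" using f(3) by (intro sum.cong) auto
      also have "\<dots> \<le> ?\<phi> y0" using J f fin by (intro sum_mono2) auto
      finally show ?thesis using J(3) y0 by simp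
    qed
    moreover have "1 - \<epsilon> \<le> (\<Sum>c\<in>C \<inter> Fb (p y). mass m y c)" if "y \<in> ?N" for y
    proof -
      have "1 - \<epsilon> \<le> ?\<phi> y" using that by simp
      also have "\<dots> \<le> (\<Sum>c\<in>C \<inter> Fb (p y). mass m y c)"
        using f(2) by (intro sum_mono mult_left_le_one_le) auto
      finally show ?thesis .
    qed
    ultimately show ?thesis using f(4) by blast
  qed
  then obtain N C where NC: "\<And>y. y \<in> B \<Longrightarrow> openin Y (N y)" "\<And>y. y \<in> B \<Longrightarrow> y \<in> N y" "\<And>y. y \<in> B \<Longrightarrow> compactin T (C y)"
    "\<And>y0 y. y0 \<in> B \<Longrightarrow> y \<in> N y0 \<Longrightarrow> 1 - \<epsilon> \<le> (\<Sum>c\<in>C y0 \<inter> Fb (p y). mass m y c)"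
    by metis
  obtain J where J: "finite J" "J \<subseteq> B" "B \<subseteq> (\<Union>y\<in>J. N y)"
    using compactin_pointwise_cover[OF B NC(1,2)] by blast
  define L where "L = \<Union> (C ` J)"
  have L: "compactin T L" unfolding L_def using J NC(3) by (intro compactin_Union) auto
  have "1 - \<epsilon> \<le> (\<Sum>c\<in>L \<inter> Fb (p y). mass m y c)" if y: "y \<in> B" for y
  proof -
    obtain y0 where y0: "y0 \<in> J" "y \<in> N y0" using J y by blast
    have "1 - \<epsilon> \<le> (\<Sum>c\<in>C y0 \<inter> Fb (p y). mass m y c)" using NC(4) y0 J by blast
    also have "\<dots> \<le> (\<Sum>c\<in>L \<inter> Fb (p y). mass m y c)"
      using y0 by (intro sum_mono2 finite_fibre_rproper rproper_compact L) (auto simp: L_def)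
    finally show ?thesis .
  qed
  with L show ?thesis by blast
qed

theorem almost_inv_of_amenable:
  assumes am: "amenable_groupoid H" and fc: "fibrewise_compact (unit_space G) Y p"
    and \<sigma>: "continuous_map (unit_space G) Y \<sigma>" "\<And>x. x \<in> units G \<Longrightarrow> p (\<sigma> x) = x"
  shows almost_inv_families
  unfolding almost_inv_families_def
proof (intro allI impI)
  fix K and \<epsilon> :: real assume Ke: "compactin T K \<and> 0 < \<epsilon>"
  then have K: "compactin T K" and KA: "K \<subseteq> Ar" using compactin_subset_topspace[of T K] by simp_all
  \<comment> \<open>The two truncated total masses lose \<open>e\<close> each and the translation
    distance enters with half its size, so the loss is at most 5/2 \<open>e\<close>, below 4
    \<open>e\<close>.\<close>
  define e where "e = \<epsilon> / 4"
  have e: "0 < e" "4 * e = \<epsilon>" using Ke by (auto simp: e_def)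
  have cK: "compactin (unit_space G) (r ` K)" "compactin (unit_space G) (s ` K)"
    using K cont_r_unit_space cont_s_unit_space image_compactin by blast+
  \<comment> \<open>Both ranges and sources of \<open>K\<close> are included so that a point and its
    translate by the inverse of an arrow of \<open>K\<close> both belong to
    \<open>B\<close>.\<close>
  define B where "B = {y \<in> topspace Y. p y \<in> r ` K \<union> s ` K}"
  have B: "compactin Y B"
    using fc compactin_Un[OF cK] unfolding fibrewise_compact_def B_def by blast
  define K' where "K' = {(y, \<gamma>). y \<in> B \<and> \<gamma> \<in> K \<and> p y = r \<gamma>}"
  have K': "compactin (gtop H) K'" unfolding gtop_H K'_def by (rule compactin_HT[OF B K])
  obtain F where F: "F \<noteq> bot" "F \<le> principal (continuous_prob_systems H)"
    "uniform_limit K' (\<lambda>m \<gamma>. tv_dist (translate_measure H \<gamma> (m (gsrc H \<gamma>))) (m (grng H \<gamma>))) (\<lambda>_. 0) F"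
    using am K' unfolding amenable_groupoid_def by blast
  have "\<forall>\<^sub>F m in F. m \<in> continuous_prob_systems H" using F(2) by (simp add: le_principal)
  moreover have "\<forall>\<^sub>F m in F. \<forall>\<gamma>\<in>K'. dist (tv_dist (translate_measure H \<gamma> (m (gsrc H \<gamma>))) (m (grng H \<gamma>))) 0 < e"
    using F(3) e(1) by (simp add: uniform_limit_iff)
  ultimately have "\<forall>\<^sub>F m in F. m \<in> continuous_prob_systems H \<and>
    (\<forall>\<gamma>\<in>K'. dist (tv_dist (translate_measure H \<gamma> (m (gsrc H \<gamma>))) (m (grng H \<gamma>))) 0 < e)"
    by (rule eventually_conj)
  then have "\<exists>m. m \<in> continuous_prob_systems H \<and>
    (\<forall>\<gamma>\<in>K'. dist (tv_dist (translate_measure H \<gamma> (m (gsrc H \<gamma>))) (m (grng H \<gamma>))) 0 < e)"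
    by (rule eventually_happens'[OF F(1)])
  then obtain m where m: "m \<in> continuous_prob_systems H"
    and tv: "\<And>\<gamma>. \<gamma> \<in> K' \<Longrightarrow> \<bar>tv_dist (translate_measure H \<gamma> (m (gsrc H \<gamma>))) (m (grng H \<gamma>))\<bar> < e"
    by (auto simp: dist_real_def)
  obtain L where L: "compactin T L" "\<And>y. y \<in> B \<Longrightarrow> 1 - e \<le> (\<Sum>c\<in>L \<inter> Fb (p y). mass m y c)"
    using mass_concentrated[OF fc m B e(1)] by blast
  obtain f :: "'g \<Rightarrow> real" and C where f: "continuous_map T euclideanreal f" "\<forall>c\<in>Ar. 0 \<le> f c \<and> f c \<le> 1"
      "\<forall>c\<in>L. f c = 1" "compactin T C" "\<forall>c\<in>Ar. c \<notin> C \<longrightarrow> f c = 0" "L \<subseteq> C"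
    using compact_Urysohn[OF L(1)] by (elim exE conjE)
  have fin: "finite (C \<inter> Fb x)" for x using f(4) by (intro finite_fibre_rproper rproper_compact)
  define w where "w y c = f c * mass m y c" for y c
  have w0: "0 \<le> w y c" "w y c \<le> mass m y c" if "c \<in> Ar" for y c
    using f(2) that by (auto simp: w_def intro: mult_left_le_one_le)
  have wsum: "1 - e \<le> (\<Sum>c\<in>C \<inter> Fb (p y). w y c)" if y: "y \<in> B" for y
  proof -
    have "1 - e \<le> (\<Sum>c\<in>L \<inter> Fb (p y). mass m y c)" using L(2) y by blast
    also have "\<dots> = (\<Sum>c\<in>L \<inter> Fb (p y). w y c)" using f(3) by (intro sum.cong) (auto simp: w_def)
    also have "\<dots> \<le> (\<Sum>c\<in>C \<inter> Fb (p y). w y c)" using fin f(6) w0 by (intro sum_mono2) auto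
    finally show ?thesis .
  qed
  define b where "b \<gamma> = act (iv \<gamma>) (\<sigma> (r \<gamma>))" for \<gamma>
  have \<sigma>Y: "\<sigma> x \<in> topspace Y" if "x \<in> units G" for x using cont_in_Y[OF \<sigma>(1)] that by simp
  have b: "b \<gamma> \<in> topspace Y" "p (b \<gamma>) = s \<gamma>" if "\<gamma> \<in> Ar" for \<gamma>
    using that \<sigma>Y[of "r \<gamma>"] \<sigma>(2)[of "r \<gamma>"] by (auto simp: b_def)
  \<comment> \<open>Passing from \<gamma> to \<gamma> d translates the point of Y by the inverse of
    d; thus the two rows to be compared come from measures at the two ends of the arrow (b \<gamma>,
    d).\<close>
  have b_mul: "b (\<gamma> \<odot> d) = act (iv d) (b \<gamma>)" if "\<gamma> \<in> Ar" "d \<in> Ar" "s \<gamma> = r d" for \<gamma> d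
    using that \<sigma>Y[of "r \<gamma>"] \<sigma>(2)[of "r \<gamma>"] by (simp add: b_def inv_mul act_mul)
  have cb: "continuous_map T Y b"
  proof -
    have "continuous_map T Y (\<lambda>\<gamma>. \<sigma> (r \<gamma>))"
      using continuous_map_compose[OF cont_r_unit_space \<sigma>(1)] by (simp add: o_def)
    then show ?thesis unfolding b_def[abs_def]
      using \<sigma>(2) by (intro cont_act' cont_iv) auto
  qed
  define a where "a \<gamma> c = sqrt (w (b \<gamma>) c)" for \<gamma> c
  have "almost_inv a C K \<epsilon>"
    unfolding almost_inv_def
  proof (intro conjI ballI impI f(4))
    have p1: "continuous_map CT T fst" and p2: "continuous_map CT T snd"
      by (rule continuous_map_fst_snd_subtopology)+
    have "continuous_map CT Y (\<lambda>v. b (fst v))"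
      using continuous_map_compose[OF p1 cb] by (simp add: o_def)
    then have "continuous_map CT HT (\<lambda>v. (b (fst v), snd v))"
      by (intro cont_into_HT p2) (auto simp: b)
    from continuous_map_compose[OF this mass_continuous[OF fc m]]
    have "continuous_map CT euclideanreal (\<lambda>v. mass m (b (fst v)) (snd v))" by (simp add: o_def)
    moreover have "continuous_map CT euclideanreal (\<lambda>v. f (snd v))"
      using continuous_map_compose[OF p2 f(1)] by (simp add: o_def)
    ultimately have "continuous_map CT euclideanreal (\<lambda>v. sqrt (f (snd v) * mass m (b (fst v)) (snd v)))"
      by (intro continuous_map_sqrt continuous_map_real_mult)
    then show "continuous_map CT euclidean (\<lambda>(\<gamma>, c). a \<gamma> c)"
      by (simp add: a_def w_def case_prod_beta')
  next
    fix \<gamma> c assume "\<gamma> \<in> Ar" "c \<in> Fb (s \<gamma>) - C"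
    then show "a \<gamma> c = 0" using f(5) by (auto simp: a_def w_def)
  next
    fix \<gamma> assume g: "\<gamma> \<in> Ar"
    have "(\<Sum>c\<in>C \<inter> Fb (s \<gamma>). (a \<gamma> c)\<^sup>2) = (\<Sum>c\<in>C \<inter> Fb (s \<gamma>). w (b \<gamma>) c)"
      using w0 by (intro sum.cong) (auto simp: a_def)
    also have "\<dots> \<le> (\<Sum>c\<in>C \<inter> Fb (s \<gamma>). mass m (b \<gamma>) c)" using w0 by (intro sum_mono) auto
    also have "\<dots> \<le> 1" using mass_sum_le[OF m b(1)[OF g] fin] b(2)[OF g] by auto
    finally show "(\<Sum>c\<in>C \<inter> Fb (s \<gamma>). (a \<gamma> c)\<^sup>2) \<le> 1" .
  next
    fix \<gamma> d assume g: "\<gamma> \<in> Ar" "d \<in> K" "s \<gamma> = r d"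
    then have d: "d \<in> Ar" using KA by blast
    define y where "y = b \<gamma>"
    define y' where "y' = act (iv d) y"
    have y: "y \<in> topspace Y" "p y = r d" using b[OF g(1)] g(3) by (auto simp: y_def)
    have y': "y' \<in> topspace Y" "p y' = s d" using y d by (auto simp: y'_def)
    have yB: "y \<in> B" "y' \<in> B" using y y' g by (auto simp: B_def)
    have by': "b (\<gamma> \<odot> d) = y'" using b_mul[OF g(1) d g(3)] by (simp add: y'_def y_def)
    \<comment> \<open>The supports of both rows, brought to the fibre over
      \<open>r d\<close>.\<close>
    define J where "J = (C \<inter> Fb (r d)) \<union> (\<lambda>c. d \<odot> c) ` (C \<inter> Fb (s d))"
    have J: "finite J" "J \<subseteq> Fb (r d)" using fin d by (auto simp: J_def)
    have JA: "c \<in> Ar" "iv d \<odot> c \<in> Ar" "r c = r d" if "c \<in> J" for c using that J(2) d by auto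
    define A where "A c = w y c" for c
    define A' where "A' c = w y' (iv d \<odot> c)" for c
    have zero: "w y c = 0" if "c \<in> Ar" "c \<notin> C" for y c using f(5) that by (auto simp: w_def)
    have sA: "1 - e \<le> (\<Sum>c\<in>J. A c)"
    proof -
      have "(\<Sum>c\<in>C \<inter> Fb (p y). w y c) = (\<Sum>c\<in>J. A c)"
        unfolding A_def
      proof (rule sum.mono_neutral_left[OF J(1)])
        show "C \<inter> Fb (p y) \<subseteq> J" unfolding y(2) J_def by blast
        show "\<forall>c\<in>J - C \<inter> Fb (p y). w y c = 0" 
        proof
          fix c assume "c \<in> J - C \<inter> Fb (p y)"
          then show "w y c = 0" using JA(1,3)[of c] y(2) zero[of c] by auto
        qed
      qed
      then show ?thesis using wsum[OF yB(1)] by simp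
    qed
    have sA': "1 - e \<le> (\<Sum>c\<in>J. A' c)"
    proof -
      have "(\<Sum>c\<in>C \<inter> Fb (s d). w y' c) = (\<Sum>c\<in>C \<inter> Fb (s d). A' (d \<odot> c))"
        using d by (intro sum.cong) (auto simp: A'_def)
      also have "\<dots> = (\<Sum>c\<in>J. A' c)"
        using d by (intro sum_translate J) (auto simp: J_def A'_def intro: zero)
      finally show ?thesis using wsum[OF yB(2)] y' by simp
    qed
    have m1: "(\<Sum>c\<in>J. mass m y c) \<le> 1" using mass_sum_le[OF m y(1) J(1)] J(2) y(2) by simp
    have m2: "(\<Sum>c\<in>J. mass m y' (iv d \<odot> c)) \<le> 1"
    proof -
      have "(\<Sum>c\<in>J. mass m y' (iv d \<odot> c)) = (\<Sum>c\<in>(\<lambda>c. iv d \<odot> c) ` J. mass m y' c)"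
      proof (subst sum.reindex)
        show "inj_on (\<lambda>c. iv d \<odot> c) J"
          using bij_betw_imp_inj_on[OF bij_translate[of "iv d"]] d J(2) by (auto intro: inj_on_subset)
      qed simp
      also have "\<dots> \<le> 1" using J d y' by (intro mass_sum_le[OF m y'(1)]) auto
      finally show ?thesis .
    qed
    have m3: "(\<Sum>c\<in>J. \<bar>mass m y c - mass m y' (iv d \<odot> c)\<bar>) \<le> e"
    proof -
      have "(\<Sum>c\<in>J. \<bar>mass m y c - mass m y' (iv d \<odot> c)\<bar>) \<le> 
          tv_dist (translate_measure H (y, d) (m (gsrc H (y, d)))) (m (grng H (y, d)))"
        unfolding y'_def using J d y by (intro mass_translate[OF m]) auto
      also have "\<dots> \<le> e" using tv[of "(y, d)"] yB g y by (simp add: K'_def)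
      finally show ?thesis .
    qed
    \<comment> \<open>The product of the roots is at least min(A, A') = A + A' - max(A, A'), and
      this maximum is at most the maximum of the untruncated masses, which is half of their sum plus
      the absolute difference.\<close>
    have pt: "sqrt (A c) * sqrt (A' c) \<ge> A c + A' c - (mass m y c + mass m y' (iv d \<odot> c) + \<bar>mass m y c - mass m y' (iv d \<odot> c)\<bar>) / 2"
      if c: "c \<in> J" for c
    proof -
      have 1: "0 \<le> A c" "A c \<le> mass m y c" "0 \<le> A' c" "A' c \<le> mass m y' (iv d \<odot> c)"
        using w0 JA[OF c] by (auto simp: A_def A'_def)
      have "min (A c) (A' c) = sqrt (min (A c) (A' c) * min (A c) (A' c))" using 1 by simp
      also have "\<dots> \<le> sqrt (A c * A' c)" using 1 by (intro real_sqrt_le_mono mult_mono) auto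
      finally have "min (A c) (A' c) \<le> sqrt (A c) * sqrt (A' c)" by (simp add: real_sqrt_mult)
      then show ?thesis using 1 by (auto simp: min_def abs_if split: if_splits)
    qed
    have "1 - \<epsilon> \<le> (\<Sum>c\<in>J. A c) + (\<Sum>c\<in>J. A' c) - ((\<Sum>c\<in>J. mass m y c) + (\<Sum>c\<in>J. mass m y' (iv d \<odot> c)) + (\<Sum>c\<in>J. \<bar>mass m y c - mass m y' (iv d \<odot> c)\<bar>)) / 2"
      using sA sA' m1 m2 m3 e by argo
    also have "\<dots> = (\<Sum>c\<in>J. A c + A' c - (mass m y c + mass m y' (iv d \<odot> c) + \<bar>mass m y c - mass m y' (iv d \<odot> c)\<bar>) / 2)"
      by (simp add: sum.distrib sum_subtractf flip: sum_divide_distrib)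
    also have "\<dots> \<le> (\<Sum>c\<in>J. sqrt (A c) * sqrt (A' c))" using pt by (intro sum_mono) auto
    also have "\<dots> = (\<Sum>c\<in>C \<inter> Fb (s \<gamma>). a \<gamma> c * a (\<gamma> \<odot> d) (iv d \<odot> c))"
      unfolding g(3)
    proof (rule sum.mono_neutral_cong_right[OF J(1)])
      show "C \<inter> Fb (r d) \<subseteq> J" unfolding J_def by blast
      show "\<forall>c\<in>J - C \<inter> Fb (r d). sqrt (A c) * sqrt (A' c) = 0" 
      proof
        fix c assume "c \<in> J - C \<inter> Fb (r d)"
        then show "sqrt (A c) * sqrt (A' c) = 0" using JA(1,3)[of c] zero[of c] by (auto simp: A_def)
      qed
    qed (simp add: a_def A_def A'_def by' y_def)
    finally show "1 - \<epsilon> \<le> (\<Sum>c\<in>C \<inter> Fb (s \<gamma>). a \<gamma> c * a (\<gamma> \<odot> d) (iv d \<odot> c))" .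
  qed
  then show "\<exists>a C. almost_inv a C K \<epsilon>" by blast
qed

end

section \<open>The space of kernels on range fibres\<close>

context etale
begin

abbreviation "ET \<equiv> prod_topology (discrete_topology (UNIV :: nat set)) CT"

lemma openin_Ar: "openin T Ar"
  using openin_topspace[of T] by simp

lemma openin_CT_composable: "openin CT (composable G)"
  using openin_topspace[of CT] by (simp only: topspace_CT)

text \<open>A triple (n, \<gamma>, c) lies over the range of \<gamma>, so a function on a fibre of
  this map is a sequence of kernels on one range fibre, written in the coordinates (\<gamma>, c).
  The discrete factor puts all indices n into one bundle.\<close>

definition rE :: "nat \<times> 'g \<times> 'g \<Rightarrow> 'g" where "rE w = r (fst (snd w))"

text \<open>In a product neighbourhood, restrict the first arrow to those whose source is the range
  of some admissible second arrow; this is an open condition because r is open, and r is open again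
  on the restricted set.\<close>

lemma open_map_CT: "open_map CT (unit_space G) (\<lambda>w. r (fst w))"
  unfolding open_map_def
proof (intro allI impI)
  fix W assume W: "openin CT W"
  show "openin (unit_space G) ((\<lambda>w. r (fst w)) ` W)"
  proof (subst openin_subopen, clarify)
    fix \<gamma> c assume gc: "(\<gamma>, c) \<in> W"
    obtain R where R: "openin (prod_topology T T) R" "W = R \<inter> composable G"
      using W by (auto simp: openin_subtopology)
    have "(\<gamma>, c) \<in> R" using gc R by blast
    then obtain U V where UV: "openin T U" "openin T V" "\<gamma> \<in> U" "c \<in> V" "U \<times> V \<subseteq> R"
      using openin_prod_topologyD[OF R(1)] by metis
    let ?U = "U \<inter> {\<gamma> \<in> topspace T. s \<gamma> \<in> r ` V}"
    have "openin (unit_space G) (r ` V)" using open_map_r UV(2) by (simp add: open_map_def)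
    then have "openin T ?U" using UV(1) cont_s_unit_space by (intro openin_Int openin_continuous_map_preimage)
    then have o: "openin (unit_space G) (r ` ?U)" using open_map_r by (simp add: open_map_def)
    have "r \<gamma> \<in> r ` ?U" using gc R(2) UV by auto
    moreover have "r ` ?U \<subseteq> (\<lambda>w. r (fst w)) ` W"
    proof
      fix x assume "x \<in> r ` ?U"
      then obtain \<eta> d where e: "x = r \<eta>" "\<eta> \<in> U" "\<eta> \<in> Ar" "d \<in> V" "s \<eta> = r d" by auto
      then have "d \<in> Ar" using openin_subset[OF UV(2)] by auto
      then have "(\<eta>, d) \<in> W" using e UV(5) R(2) by auto
      then show "x \<in> (\<lambda>w. r (fst w)) ` W" using e(1) by (auto intro!: image_eqI[of _ _ "(\<eta>, d)"])
    qed
    ultimately show "\<exists>S. openin (unit_space G) S \<and> r (fst (\<gamma>, c)) \<in> S \<and> S \<subseteq> (\<lambda>w. r (fst w)) ` W"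
      using o by auto
  qed
qed

lemma cont_CT_fst: "continuous_map CT T fst" and cont_CT_snd: "continuous_map CT T snd"
  by (rule continuous_map_fst_snd_subtopology)+

lemma cont_rE: "continuous_map ET (unit_space G) rE"
proof -
  have "continuous_map ET T (\<lambda>w. fst (snd w))"
    using continuous_map_compose[OF continuous_map_snd cont_CT_fst] by (simp add: o_def)
  from continuous_map_compose[OF this cont_r_unit_space] show ?thesis
    by (simp add: o_def rE_def[abs_def])
qed

lemma open_map_rE: "open_map ET (unit_space G) rE"
proof -
  have "open_map ET (unit_space G) ((\<lambda>w. r (fst w)) \<circ> snd)"
    by (rule open_map_compose[OF open_map_snd open_map_CT])
  then show ?thesis by (simp add: rE_def[abs_def] o_def)
qed

text \<open>On small sets the range determines \<gamma>, hence \<open>s \<gamma>\<close>, which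
  equals \<open>r c\<close> and so determines c.\<close>

lemma locally_inj_rE:
  assumes "w \<in> topspace ET" shows "\<exists>W. openin ET W \<and> w \<in> W \<and> inj_on rE W"
proof -
  obtain n \<gamma> c where w: "w = (n, \<gamma>, c)" "\<gamma> \<in> Ar" "c \<in> Ar" "s \<gamma> = r c" using assms by auto
  obtain U where U: "openin T U" "\<gamma> \<in> U" "inj_on r U" using etale_nbhd[OF w(2)] by metis
  obtain V where V: "openin T V" "c \<in> V" "inj_on r V" using etale_nbhd[OF w(3)] by metis
  have "openin CT (composable G \<inter> U \<times> V)"
    using U V by (intro openin_subtopology_Int2) (simp add: openin_prod_Times_iff)
  then have "openin ET ({n} \<times> (composable G \<inter> U \<times> V))" by (simp add: openin_prod_Times_iff)
  moreover have "w \<in> {n} \<times> (composable G \<inter> U \<times> V)" using w U V by auto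
  moreover have "inj_on rE ({n} \<times> (composable G \<inter> U \<times> V))"
  proof (rule inj_onI)
    fix v v' assume v: "v \<in> {n} \<times> (composable G \<inter> U \<times> V)" "v' \<in> {n} \<times> (composable G \<inter> U \<times> V)" "rE v = rE v'"
    obtain \<eta> d \<eta>' d' where e: "v = (n, \<eta>, d)" "v' = (n, \<eta>', d')" using v by (cases v, cases v') auto
    have "\<eta> = \<eta>'" using v e U(3) by (auto simp: inj_on_def rE_def)
    then have "r d = r d'" using v e by (metis IntD1 SigmaD2 composable_iff)
    then have "d = d'" using v e V(3) by (auto simp: inj_on_def)
    then show "v = v'" using e \<open>\<eta> = \<eta>'\<close> by simp
  qed
  ultimately show ?thesis by blast
qed

lemma cont_into_ET:
  assumes "continuous_map Z T f" "continuous_map Z T g" "\<And>z. z \<in> topspace Z \<Longrightarrow> s (f z) = r (g z)"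
  shows "continuous_map Z ET (\<lambda>z. (n, f z, g z))"
  using cont_into_CT[OF assms] by (intro continuous_map_pairedI) auto

lemma cont_from_ET:
  assumes "\<And>n. continuous_map CT V (f n)"
  shows "continuous_map ET V (\<lambda>(n, w). f n w)"
proof (rule continuous_map_locally)
  fix z assume z: "z \<in> topspace ET"
  obtain n w where nw: "z = (n, w)" by (cases z)
  let ?N = "{n} \<times> composable G"
  have N: "openin ET ?N" using openin_CT_composable by (simp add: openin_prod_Times_iff)
  have "continuous_map (subtopology ET ?N) CT snd"
    by (rule continuous_map_from_subtopology) (rule continuous_map_snd)
  from continuous_map_compose[OF this assms[of n]]
  have "continuous_map (subtopology ET ?N) V (\<lambda>z. f n (snd z))" by (simp add: o_def)
  then have "continuous_map (subtopology ET ?N) V (\<lambda>(n, w). f n w)"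
    by (rule continuous_map_eq) auto
  then show "\<exists>N. openin ET N \<and> z \<in> N \<and> continuous_map (subtopology ET N) V (\<lambda>(n, w). f n w)"
    using N z nw by (intro exI[of _ ?N]) auto
qed

end

section \<open>The space Y of sequences of kernels satisfying the given estimates\<close>

text \<open>The functions \<open>a n\<close> satisfy their estimate on \<open>K n\<close>, but in Y
  it is imposed for arrows in the open set \<open>U n\<close> only: openness makes the condition
  closed, and \<open>cover\<close> makes it reach every compact set eventually.\<close>

locale inv_bundle = etale G for G :: "'g groupoid" +
  fixes a :: "nat \<Rightarrow> 'g \<Rightarrow> 'g \<Rightarrow> real" and C K U :: "nat \<Rightarrow> 'g set" and e :: "nat \<Rightarrow> real"
    and enc :: "'g \<times> (nat \<times> 'g \<times> 'g \<Rightarrow> real) \<Rightarrow> 'y"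
  assumes ai: "\<And>n. almost_inv (a n) (C n) (K n) (e n)"
    and U: "\<And>n. openin T (U n)" "\<And>n. U n \<subseteq> K n"
    and cover: "\<And>L. compactin T L \<Longrightarrow> \<exists>n0. \<forall>n\<ge>n0. L \<subseteq> U n"
    and e: "\<And>n. 0 < e n" "e \<longlonglongrightarrow> 0"
    and inj: "inj enc"
begin

sublocale fun_bundle ET "unit_space G" rE enc
  by unfold_locales (use cont_rE open_map_rE locally_inj_rE Hausdorff_unit_space lc_unit_space inj in auto)

lemma C: "compactin T (C n)" using ai by (simp add: almost_inv_def)

lemma rproper_C: "rproper (C n)" using C by (rule rproper_compact)

definition inner :: "'y \<Rightarrow> nat \<Rightarrow> 'g \<Rightarrow> 'g \<Rightarrow> real" where
  "inner y n \<gamma> d = (\<Sum>c\<in>C n \<inter> Fb (s \<gamma>). kv y (n, \<gamma>, c) * kv y (n, \<gamma> \<odot> d, iv d \<odot> c))"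

text \<open>The support condition comes first because \<open>inner\<close>, a sum over
  \<open>C n\<close>, is shown to depend continuously on y only among kernels vanishing off
  \<open>C n\<close>.\<close>

definition Y1 :: "'y set" where
  "Y1 = {y \<in> D. \<forall>n. \<forall>w\<in>{w \<in> composable G. snd w \<notin> C n}. r (fst w) = px y \<longrightarrow> kv y (n, fst w, snd w) \<in> {0}}"

definition Y2 :: "'y set" where
  "Y2 = {y \<in> Y1. (\<forall>n. \<forall>\<gamma>\<in>Ar. r \<gamma> = px y \<longrightarrow> inner y n \<gamma> (s \<gamma>) \<in> {..1}) \<and>
    (\<forall>n. \<forall>w\<in>{w \<in> composable G. snd w \<in> U n}. r (fst w) = px y \<longrightarrow> inner y n (fst w) (snd w) \<in> {1 - e n..})}"

definition YT :: "'y topology" where "YT = subtopology BT Y2"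

lemma Y1_zero: "y \<in> Y1 \<Longrightarrow> \<gamma> \<in> Ar \<Longrightarrow> c \<in> Fb (s \<gamma>) \<Longrightarrow> r \<gamma> = px y \<Longrightarrow> c \<notin> C n \<Longrightarrow> kv y (n, \<gamma>, c) = 0"
  by (auto simp: Y1_def)

lemma Y1_D: "y \<in> Y1 \<Longrightarrow> y \<in> D" by (simp add: Y1_def)

lemma Y2_Y1: "y \<in> Y2 \<Longrightarrow> y \<in> Y1" by (simp add: Y2_def)

lemma Y2_D: "y \<in> Y2 \<Longrightarrow> y \<in> D" using Y2_Y1 Y1_D by blast

lemma Y2_le: "y \<in> Y2 \<Longrightarrow> \<gamma> \<in> Ar \<Longrightarrow> r \<gamma> = px y \<Longrightarrow> inner y n \<gamma> (s \<gamma>) \<le> 1"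
  by (auto simp: Y2_def)

lemma Y2_ge: "y \<in> Y2 \<Longrightarrow> \<gamma> \<in> Ar \<Longrightarrow> d \<in> U n \<Longrightarrow> s \<gamma> = r d \<Longrightarrow> r \<gamma> = px y \<Longrightarrow> 1 - e n \<le> inner y n \<gamma> d"
  using openin_subset[OF U(1)[of n]] by (force simp: Y2_def)

lemma Y2I:
  assumes "y \<in> D" "\<And>n \<gamma> c. \<gamma> \<in> Ar \<Longrightarrow> c \<in> Fb (s \<gamma>) \<Longrightarrow> r \<gamma> = px y \<Longrightarrow> c \<notin> C n \<Longrightarrow> kv y (n, \<gamma>, c) = 0"
    "\<And>n \<gamma>. \<gamma> \<in> Ar \<Longrightarrow> r \<gamma> = px y \<Longrightarrow> inner y n \<gamma> (s \<gamma>) \<le> 1"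
    "\<And>n \<gamma> d. \<gamma> \<in> Ar \<Longrightarrow> d \<in> Ar \<Longrightarrow> d \<in> U n \<Longrightarrow> s \<gamma> = r d \<Longrightarrow> r \<gamma> = px y \<Longrightarrow> 1 - e n \<le> inner y n \<gamma> d"
  shows "y \<in> Y2"
  unfolding Y2_def Y1_def using assms by auto

lemma topspace_YT [simp]: "topspace YT = Y2"
  using Y2_D by (auto simp: YT_def)

lemma cont_kv:
  assumes f: "continuous_map Z BT f" and g: "continuous_map Z T g" and h: "continuous_map Z T h"
    and "\<And>z. z \<in> topspace Z \<Longrightarrow> s (g z) = r (h z)" "\<And>z. z \<in> topspace Z \<Longrightarrow> px (f z) = r (g z)"
  shows "continuous_map Z euclideanreal (\<lambda>z. kv (f z) (n, g z, h z))"
proof -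
  have "continuous_map Z (subtopology (prod_topology BT ET) {(y, w). px y = rE w}) (\<lambda>z. (f z, (n, g z, h z)))"
    using assms cont_in_Ar[OF g] cont_in_Ar[OF h]
    by (auto simp: continuous_map_in_subtopology rE_def intro!: continuous_map_pairedI cont_into_ET)
  from continuous_map_compose[OF this cont_eval] show ?thesis by (simp add: o_def)
qed

lemma closedin_Y1: "closedin BT Y1"
proof -
  have "closedin BT {y \<in> topspace BT. \<forall>w\<in>{w \<in> topspace CT. snd w \<in> topspace T - C n}. r (fst w) = px y \<longrightarrow> kv y (n, fst w, snd w) \<in> {0}}" for n
  proof (rule closedin_forall_open_map[OF cont_px open_map_CT])
    let ?S = "subtopology (prod_topology BT CT) {(y, w). px y = r (fst w)}"
    have c: "continuous_map ?S BT fst" "continuous_map ?S T (\<lambda>v. fst (snd v))" "continuous_map ?S T (\<lambda>v. snd (snd v))"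
      using continuous_map_compose[OF _ cont_CT_fst, of ?S snd] continuous_map_compose[OF _ cont_CT_snd, of ?S snd]
      by (auto simp: o_def intro: continuous_map_fst_snd_subtopology)
    have "continuous_map ?S euclideanreal (\<lambda>v. kv (fst v) (n, fst (snd v), snd (snd v)))"
      by (intro cont_kv c) (auto simp: composable_def)
    then show "continuous_map ?S euclideanreal (\<lambda>(y, w). kv y (n, fst w, snd w))" by (simp add: case_prod_beta')
    show "openin CT {w \<in> topspace CT. snd w \<in> topspace T - C n}"
      by (intro openin_continuous_map_preimage[OF cont_CT_snd] openin_diff openin_topspace compactin_closedin_T[OF C])
  qed auto
  then have "closedin BT (\<Inter>n. {y \<in> topspace BT. \<forall>w\<in>{w \<in> topspace CT. snd w \<in> topspace T - C n}. r (fst w) = px y \<longrightarrow> kv y (n, fst w, snd w) \<in> {0}})"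
    by (intro closedin_INT) auto
  moreover have "(\<Inter>n. {y \<in> topspace BT. \<forall>w\<in>{w \<in> topspace CT. snd w \<in> topspace T - C n}. r (fst w) = px y \<longrightarrow> kv y (n, fst w, snd w) \<in> {0}}) = Y1"
    unfolding Y1_def topspace_BT topspace_CT topspace_T using composable_subset by fastforce
  ultimately show ?thesis by simp
qed

lemma inner_continuous:
  assumes f: "continuous_map Z BT f" "\<And>z. z \<in> topspace Z \<Longrightarrow> f z \<in> Y1" and g: "continuous_map Z T g" and h: "continuous_map Z T h"
    and sr: "\<And>z. z \<in> topspace Z \<Longrightarrow> s (g z) = r (h z)" "\<And>z. z \<in> topspace Z \<Longrightarrow> px (f z) = r (g z)"
  shows "continuous_map Z euclideanreal (\<lambda>z. inner (f z) n (g z) (h z))"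
  unfolding inner_def
proof (rule fibre_sum_continuous[OF rproper_C])
  show "continuous_map Z (unit_space G) (\<lambda>z. s (g z))"
    using continuous_map_compose[OF g cont_s_unit_space] by (simp add: o_def)
  let ?S = "subtopology (prod_topology Z T) {(z, c). s (g z) = r c}"
  have p1: "continuous_map ?S Z fst" and p2: "continuous_map ?S T snd" by (rule continuous_map_fst_snd_subtopology)+
  have c: "continuous_map ?S BT (\<lambda>v. f (fst v))" "continuous_map ?S T (\<lambda>v. g (fst v))" "continuous_map ?S T (\<lambda>v. h (fst v))"
    using continuous_map_compose[OF p1 f(1)] continuous_map_compose[OF p1 g] continuous_map_compose[OF p1 h]
    by (simp_all add: o_def)
  have gA: "g z \<in> Ar" "h z \<in> Ar" if "z \<in> topspace Z" for z using cont_in_Ar[OF g that] cont_in_Ar[OF h that] by auto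
  have c2: "continuous_map ?S T (\<lambda>v. g (fst v) \<odot> h (fst v))" by (intro cont_mul' c) (use sr in auto)
  have c3: "continuous_map ?S T (\<lambda>v. iv (h (fst v)) \<odot> snd v)" by (intro cont_mul' cont_iv' c p2) (use sr gA in auto)
  have "continuous_map ?S euclideanreal (\<lambda>v. kv (f (fst v)) (n, g (fst v), snd v) * 
     kv (f (fst v)) (n, g (fst v) \<odot> h (fst v), iv (h (fst v)) \<odot> snd v))"
    by (intro continuous_map_real_mult cont_kv c c2 c3 p2) (use sr gA in auto)
  then show "continuous_map ?S euclideanreal (\<lambda>(z, c). kv (f z) (n, g z, c) * kv (f z) (n, g z \<odot> h z, iv (h z) \<odot> c))"
    by (simp add: case_prod_beta')
  fix z c assume "z \<in> topspace Z" "c \<in> Fb (s (g z))" "c \<notin> C n"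
  then show "kv (f z) (n, g z, c) * kv (f z) (n, g z \<odot> h z, iv (h z) \<odot> c) = 0"
    using Y1_zero[OF f(2)[of z], of "g z" c n] gA sr by auto
qed

text \<open>Closedness is proved relative to \<open>Y1\<close>, where \<open>inner\<close> is
  continuous, and transferred since \<open>Y1\<close> is closed.\<close>

lemma closedin_Y2: "closedin BT Y2"
proof -
  let ?Z = "subtopology BT Y1"
  have topZ: "topspace ?Z = Y1" using Y1_D by auto
  have cpx: "continuous_map ?Z (unit_space G) px" using cont_px by (rule continuous_map_from_subtopology)
  have cid: "continuous_map ?Z BT id" by (rule continuous_map_id_subt)
  have 1: "closedin ?Z {y \<in> topspace ?Z. \<forall>\<gamma>\<in>topspace T. r \<gamma> = px y \<longrightarrow> inner y n \<gamma> (s \<gamma>) \<in> {..1}}" for n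
  proof (rule closedin_forall_open_map[OF cpx open_map_r])
    let ?S = "subtopology (prod_topology ?Z T) {(y, \<gamma>). px y = r \<gamma>}"
    have p1: "continuous_map ?S ?Z fst" and p2: "continuous_map ?S T snd" by (rule continuous_map_fst_snd_subtopology)+
    have "continuous_map ?S BT fst" using continuous_map_compose[OF p1 cid] by simp
    then have "continuous_map ?S euclideanreal (\<lambda>v. inner (fst v) n (snd v) (s (snd v)))"
      by (intro inner_continuous p2 cont_s') auto
    then show "continuous_map ?S euclideanreal (\<lambda>(y, \<gamma>). inner y n \<gamma> (s \<gamma>))" by (simp add: case_prod_beta')
  qed (auto simp: openin_Ar)
  have 2: "closedin ?Z {y \<in> topspace ?Z. \<forall>w\<in>{w \<in> topspace CT. snd w \<in> U n}. r (fst w) = px y \<longrightarrow> inner y n (fst w) (snd w) \<in> {1 - e n..}}" for n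
  proof (rule closedin_forall_open_map[OF cpx open_map_CT])
    let ?S = "subtopology (prod_topology ?Z CT) {(y, w). px y = r (fst w)}"
    have p1: "continuous_map ?S ?Z fst" and p2: "continuous_map ?S CT snd" by (rule continuous_map_fst_snd_subtopology)+
    have "continuous_map ?S BT fst" using continuous_map_compose[OF p1 cid] by simp
    then have "continuous_map ?S euclideanreal (\<lambda>v. inner (fst v) n (fst (snd v)) (snd (snd v)))"
      using continuous_map_compose[OF p2 cont_CT_fst] continuous_map_compose[OF p2 cont_CT_snd]
      by (intro inner_continuous) (auto simp: o_def composable_def)
    then show "continuous_map ?S euclideanreal (\<lambda>(y, w). inner y n (fst w) (snd w))" by (simp add: case_prod_beta')
    show "openin CT {w \<in> topspace CT. snd w \<in> U n}"
      using cont_CT_snd U(1) by (rule openin_continuous_map_preimage)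
  qed auto
  have "closedin ?Z ((\<Inter>n. {y \<in> topspace ?Z. \<forall>\<gamma>\<in>topspace T. r \<gamma> = px y \<longrightarrow> inner y n \<gamma> (s \<gamma>) \<in> {..1}}) \<inter>
    (\<Inter>n. {y \<in> topspace ?Z. \<forall>w\<in>{w \<in> topspace CT. snd w \<in> U n}. r (fst w) = px y \<longrightarrow> inner y n (fst w) (snd w) \<in> {1 - e n..}}))"
    using 1 2 by (intro closedin_Int closedin_INT) auto
  moreover have "((\<Inter>n. {y \<in> topspace ?Z. \<forall>\<gamma>\<in>topspace T. r \<gamma> = px y \<longrightarrow> inner y n \<gamma> (s \<gamma>) \<in> {..1}}) \<inter>
    (\<Inter>n. {y \<in> topspace ?Z. \<forall>w\<in>{w \<in> topspace CT. snd w \<in> U n}. r (fst w) = px y \<longrightarrow> inner y n (fst w) (snd w) \<in> {1 - e n..}})) = Y2"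
    unfolding topZ Y2_def topspace_T topspace_CT by blast
  ultimately have "closedin ?Z Y2" by simp
  then show ?thesis using closedin_Y1 closedin_trans_full by blast
qed

text \<open>Left translation of both arguments of a kernel leaves the difference coordinate c fixed.
  The supports and inequalities are stated in terms of c and d, hence are preserved.\<close>

definition act :: "'g \<Rightarrow> 'y \<Rightarrow> 'y" where
  "act \<gamma> y = mk (r \<gamma>) (\<lambda>(n, \<eta>, c). kv y (n, iv \<gamma> \<odot> \<eta>, c))"

definition \<sigma> :: "'g \<Rightarrow> 'y" where
  "\<sigma> x = mk x (\<lambda>(n, \<gamma>, c). a n \<gamma> c)"

lemma px_act [simp]: "px (act \<gamma> y) = r \<gamma>" by (simp add: act_def)

lemma px_\<sigma> [simp]: "px (\<sigma> x) = x" by (simp add: \<sigma>_def)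

lemma act_in_D: "\<gamma> \<in> Ar \<Longrightarrow> y \<in> D \<Longrightarrow> act \<gamma> y \<in> D"
  unfolding act_def by (intro mk_in_D) (auto intro: kv_le)

lemma kv_act:
  assumes "\<eta> \<in> Ar" "c \<in> Fb (s \<eta>)" "r \<eta> = r \<gamma>"
  shows "kv (act \<gamma> y) (n, \<eta>, c) = kv y (n, iv \<gamma> \<odot> \<eta>, c)"
  using assms by (auto simp: act_def kv_mk rE_def)

lemma kv_\<sigma>:
  assumes "\<eta> \<in> Ar" "c \<in> Fb (s \<eta>)" "r \<eta> = x"
  shows "kv (\<sigma> x) (n, \<eta>, c) = a n \<eta> c"
  using assms by (auto simp: \<sigma>_def kv_mk rE_def)

lemma inner_act:
  assumes g: "\<gamma> \<in> Ar" "\<eta> \<in> Ar" "d \<in> Ar" "r \<eta> = r \<gamma>" "s \<eta> = r d"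
  shows "inner (act \<gamma> y) n \<eta> d = inner y n (iv \<gamma> \<odot> \<eta>) d"
proof -
  have "s (iv \<gamma> \<odot> \<eta>) = s \<eta>" using g by simp
  moreover have "iv \<gamma> \<odot> \<eta> \<odot> d = iv \<gamma> \<odot> (\<eta> \<odot> d)" using g by (simp add: mul_assoc)
  ultimately show ?thesis unfolding inner_def using g by (intro sum.cong) (auto simp: kv_act)
qed

lemma inner_\<sigma>:
  assumes g: "\<eta> \<in> Ar" "d \<in> Ar" "r \<eta> = x" "s \<eta> = r d"
  shows "inner (\<sigma> x) n \<eta> d = (\<Sum>c\<in>C n \<inter> Fb (s \<eta>). a n \<eta> c * a n (\<eta> \<odot> d) (iv d \<odot> c))"
  unfolding inner_def using g by (intro sum.cong) (auto simp: kv_\<sigma>)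

lemma act_in_Y2:
  assumes g: "\<gamma> \<in> Ar" "y \<in> Y2" "s \<gamma> = px y"
  shows "act \<gamma> y \<in> Y2"
proof (rule Y2I)
  show "act \<gamma> y \<in> D" using g by (intro act_in_D Y2_D)
  show "kv (act \<gamma> y) (n, \<eta>, c) = 0" if "\<eta> \<in> Ar" "c \<in> Fb (s \<eta>)" "r \<eta> = px (act \<gamma> y)" "c \<notin> C n" for n \<eta> c
    using Y1_zero[OF Y2_Y1[OF g(2)], of "iv \<gamma> \<odot> \<eta>" c n] that g by (simp add: kv_act)
  show "inner (act \<gamma> y) n \<eta> (s \<eta>) \<le> 1" if "\<eta> \<in> Ar" "r \<eta> = px (act \<gamma> y)" for n \<eta>
    using Y2_le[OF g(2), of "iv \<gamma> \<odot> \<eta>" n] that g by (simp add: inner_act)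
  show "1 - e n \<le> inner (act \<gamma> y) n \<eta> d" if "\<eta> \<in> Ar" "d \<in> Ar" "d \<in> U n" "s \<eta> = r d" "r \<eta> = px (act \<gamma> y)" for n \<eta> d
    using Y2_ge[OF g(2), of "iv \<gamma> \<odot> \<eta>" d n] that g by (simp add: inner_act)
qed

lemma a_le: assumes "\<gamma> \<in> Ar" "c \<in> Fb (s \<gamma>)" shows "\<bar>a n \<gamma> c\<bar> \<le> 1"
proof (cases "c \<in> C n")
  case True
  have "(a n \<gamma> c)\<^sup>2 \<le> (\<Sum>c\<in>C n \<inter> Fb (s \<gamma>). (a n \<gamma> c)\<^sup>2)"
    using True assms by (intro member_le_sum finite_fibre_rproper rproper_C) auto
  also have "\<dots> \<le> 1" using ai[of n] assms by (auto simp: almost_inv_def)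
  finally show ?thesis by (simp add: abs_square_le_1)
next
  case False
  then show ?thesis using almost_inv_zero[OF ai assms] by simp
qed

lemma \<sigma>_in_Y2:
  assumes x: "x \<in> units G" shows "\<sigma> x \<in> Y2"
proof (rule Y2I)
  show "\<sigma> x \<in> D" unfolding \<sigma>_def using x a_le by (intro mk_in_D) auto
  show "kv (\<sigma> x) (n, \<eta>, c) = 0" if "\<eta> \<in> Ar" "c \<in> Fb (s \<eta>)" "r \<eta> = px (\<sigma> x)" "c \<notin> C n" for n \<eta> c
    using almost_inv_zero[OF ai that(1,2,4)] that by (simp add: kv_\<sigma>)
  show "inner (\<sigma> x) n \<eta> (s \<eta>) \<le> 1" if "\<eta> \<in> Ar" "r \<eta> = px (\<sigma> x)" for n \<eta>
  proof -
    have "inner (\<sigma> x) n \<eta> (s \<eta>) = (\<Sum>c\<in>C n \<inter> Fb (s \<eta>). (a n \<eta> c)\<^sup>2)"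
      using that by (subst inner_\<sigma>) (auto simp: power2_eq_square intro!: sum.cong)
    then show ?thesis using ai[of n] that by (auto simp: almost_inv_def)
  qed
  show "1 - e n \<le> inner (\<sigma> x) n \<eta> d" if "\<eta> \<in> Ar" "d \<in> Ar" "d \<in> U n" "s \<eta> = r d" "r \<eta> = px (\<sigma> x)" for n \<eta> d
    using almost_inv_ge[OF ai that(1), of d n] that U(2) by (auto simp: inner_\<sigma>)
qed

lemma cont_into_YT: "continuous_map Z BT f \<Longrightarrow> (\<And>z. z \<in> topspace Z \<Longrightarrow> f z \<in> Y2) \<Longrightarrow> continuous_map Z YT f"
  by (auto simp: YT_def continuous_map_in_subtopology)

lemma cont_YT_BT: "continuous_map YT BT id"
  unfolding YT_def by (rule continuous_map_id_subt)

lemma cont_\<sigma>: "continuous_map (unit_space G) YT \<sigma>"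
proof (rule cont_into_YT[OF cont_into_BT])
  show "\<sigma> \<in> topspace (unit_space G) \<rightarrow> D" using \<sigma>_in_Y2 Y2_D by auto
  show "continuous_map (unit_space G) (unit_space G) (\<lambda>z. px (\<sigma> z))" using continuous_map_id by (simp add: id_def)
  let ?S = "subtopology (prod_topology (unit_space G) ET) {(z, w). px (\<sigma> z) = rE w}"
  have "continuous_map ET euclideanreal (\<lambda>(n, w). (case w of (\<gamma>, c) \<Rightarrow> a n \<gamma> c))"
    using ai by (intro cont_from_ET) (simp add: almost_inv_def)
  from continuous_map_compose[OF continuous_map_fst_snd_subtopology(2) this]
  have "continuous_map ?S euclideanreal (\<lambda>v. case snd v of (n, w) \<Rightarrow> (case w of (\<gamma>, c) \<Rightarrow> a n \<gamma> c))" by (simp add: o_def)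
  then show "continuous_map ?S euclideanreal (\<lambda>(z, w). kv (\<sigma> z) w)"
    by (rule continuous_map_eq) (auto simp: rE_def kv_\<sigma> split: prod.splits)
qed (use \<sigma>_in_Y2 in auto)

lemma cont_act: 
  "continuous_map (subtopology (prod_topology T YT) {(\<gamma>, y). s \<gamma> = px y}) YT (\<lambda>(\<gamma>, y). act \<gamma> y)"
proof (rule cont_into_YT[OF cont_into_BT])
  let ?Z = "subtopology (prod_topology T YT) {(\<gamma>, y). s \<gamma> = px y}"
  show "(\<lambda>(\<gamma>, y). act \<gamma> y) \<in> topspace ?Z \<rightarrow> D" using act_in_Y2 Y2_D by auto
  have p1: "continuous_map ?Z T fst" and p2: "continuous_map ?Z YT snd" by (rule continuous_map_fst_snd_subtopology)+
  have p3: "continuous_map ?Z BT snd" using continuous_map_compose[OF p2 cont_YT_BT] by simp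
  show "continuous_map ?Z (unit_space G) (\<lambda>z. px (case z of (\<gamma>, y) \<Rightarrow> act \<gamma> y))"
    using continuous_map_compose[OF p1 cont_r_unit_space] by (simp add: case_prod_beta' o_def)
  let ?S = "subtopology (prod_topology ?Z ET) {(z, w). px (case z of (\<gamma>, y) \<Rightarrow> act \<gamma> y) = rE w}"
  have z: "continuous_map ?S ?Z fst" and w: "continuous_map ?S ET snd" by (rule continuous_map_fst_snd_subtopology)+
  have q1: "continuous_map ?S T (\<lambda>v. fst (fst v))" using continuous_map_compose[OF z p1] by (simp add: o_def)
  have q2: "continuous_map ?S BT (\<lambda>v. snd (fst v))" using continuous_map_compose[OF z p3] by (simp add: o_def)
  have w1: "continuous_map ?S CT (\<lambda>v. snd (snd v))" using continuous_map_compose[OF w continuous_map_snd] by (simp add: o_def)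
  have w0: "continuous_map ?S (discrete_topology UNIV) (\<lambda>v. fst (snd v))" using continuous_map_compose[OF w continuous_map_fst] by (simp add: o_def)
  have w2: "continuous_map ?S T (\<lambda>v. fst (snd (snd v)))" "continuous_map ?S T (\<lambda>v. snd (snd (snd v)))"
    using continuous_map_compose[OF w1 cont_CT_fst] continuous_map_compose[OF w1 cont_CT_snd] by (simp_all add: o_def)
  have m: "continuous_map ?S T (\<lambda>v. iv (fst (fst v)) \<odot> fst (snd (snd v)))"
    by (intro cont_mul' cont_iv' q1 w2) (auto simp: rE_def)
  have "continuous_map ?S CT (\<lambda>v. (iv (fst (fst v)) \<odot> fst (snd (snd v)), snd (snd (snd v))))"
    by (intro cont_into_CT m w2) (auto simp: rE_def)
  then have "continuous_map ?S ET (\<lambda>v. (fst (snd v), iv (fst (fst v)) \<odot> fst (snd (snd v)), snd (snd (snd v))))"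
    by (intro continuous_map_pairedI w0)
  then have "continuous_map ?S (subtopology (prod_topology BT ET) {(y, w). px y = rE w}) 
    (\<lambda>v. (snd (fst v), (fst (snd v), iv (fst (fst v)) \<odot> fst (snd (snd v)), snd (snd (snd v)))))"
    using q2 by (auto simp: continuous_map_in_subtopology rE_def intro!: continuous_map_pairedI)
  from continuous_map_compose[OF this cont_eval]
  have "continuous_map ?S euclideanreal (\<lambda>v. kv (snd (fst v)) (fst (snd v), iv (fst (fst v)) \<odot> fst (snd (snd v)), snd (snd (snd v))))"
    by (simp add: o_def)
  then show "continuous_map ?S euclideanreal (\<lambda>(z, w). kv (case z of (\<gamma>, y) \<Rightarrow> act \<gamma> y) w)"
    by (rule continuous_map_eq) (auto simp: rE_def kv_act)
qed (use act_in_Y2 in auto)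

lemma gspace_YT: "gspace G YT px act"
  unfolding gspace_def is_fibre_space_def
proof (intro conjI ballI allI impI cont_act)
  show "locally_compact_space YT" unfolding YT_def
    using lc_BT closedin_Y2 by (rule locally_compact_space_closed_subset)
  show "Hausdorff_space YT" unfolding YT_def using Hausdorff_BT by (rule Hausdorff_space_subtopology)
  show cpx: "continuous_map YT (unit_space G) px"
    unfolding YT_def using cont_px by (rule continuous_map_from_subtopology)
  show "px ` topspace YT = topspace (unit_space G)"
  proof
    show "px ` topspace YT \<subseteq> topspace (unit_space G)" using continuous_map_image_subset_topspace[OF cpx] .
    show "topspace (unit_space G) \<subseteq> px ` topspace YT"
      using \<sigma>_in_Y2 by (auto intro!: image_eqI[of _ px "\<sigma> _"])
  qed
next
  fix y assume "y \<in> topspace YT"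
  then have y: "y \<in> D" "px y \<in> units G" using Y2_D px_in by auto
  then have pA: "px y \<in> Ar" "r (px y) = px y" using units_eq by auto
  show "act (px y) y = y"
    using y pA by (intro D_eqI act_in_D) (auto simp: rE_def kv_act)
next
  fix \<gamma>2 \<gamma>1 y assume y: "y \<in> topspace YT" and g: "(\<gamma>2, \<gamma>1) \<in> composable G \<and> s \<gamma>1 = px y"
  then have yD: "y \<in> D" using Y2_D by simp
  show "act (\<gamma>2 \<odot> \<gamma>1) y = act \<gamma>2 (act \<gamma>1 y)"
    using yD g by (intro D_eqI act_in_D) (auto simp: rE_def kv_act inv_mul mul_assoc)
qed auto

lemma fibrewise_compact_YT: "fibrewise_compact (unit_space G) YT px"
  unfolding fibrewise_compact_def
proof (intro allI impI)
  fix L assume "compactin (unit_space G) L"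
  then have "compactin BT (Y2 \<inter> {y \<in> D. px y \<in> L})" 
    using closedin_Y2 compactin_px by (intro closed_Int_compactin)
  moreover have "Y2 \<inter> {y \<in> D. px y \<in> L} = {y \<in> topspace YT. px y \<in> L}" using Y2_D by auto
  ultimately show "compactin YT {y \<in> topspace YT. px y \<in> L}"
    unfolding YT_def compactin_subtopology by auto
qed

end

text \<open>Two vectors of norm at most 1 with inner product at least 1 - e satisfy |B - A|^2 \<le>
  2 e and |B + A| \<le> 2. Factoring the difference of squares and applying Cauchy-Schwarz compares
  the associated weights.\<close>

lemma sum_square_diff_le:
  fixes A B :: "'a \<Rightarrow> real"
  assumes J: "finite J" and A: "(\<Sum>c\<in>J. (A c)\<^sup>2) \<le> 1" and B: "(\<Sum>c\<in>J. (B c)\<^sup>2) \<le> 1"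
    and AB: "1 - e \<le> (\<Sum>c\<in>J. A c * B c)"
  shows "1 - 2 * e \<le> (\<Sum>c\<in>J. (A c)\<^sup>2)" "1 - 2 * e \<le> (\<Sum>c\<in>J. (B c)\<^sup>2)"
    "(\<Sum>c\<in>J. \<bar>(B c)\<^sup>2 - (A c)\<^sup>2\<bar>) \<le> sqrt (2 * e) * 2"
proof -
  have minus: "(\<Sum>c\<in>J. (B c - A c)\<^sup>2) = (\<Sum>c\<in>J. (A c)\<^sup>2) + (\<Sum>c\<in>J. (B c)\<^sup>2) - 2 * (\<Sum>c\<in>J. A c * B c)"
    by (simp add: power2_diff sum.distrib sum_subtractf sum_distrib_left mult_ac)
  have plus: "(\<Sum>c\<in>J. (B c + A c)\<^sup>2) = (\<Sum>c\<in>J. (A c)\<^sup>2) + (\<Sum>c\<in>J. (B c)\<^sup>2) + 2 * (\<Sum>c\<in>J. A c * B c)"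
    by (simp add: power2_sum sum.distrib sum_distrib_left mult_ac)
  have nonneg: "0 \<le> (\<Sum>c\<in>J. (B c - A c)\<^sup>2)" by (intro sum_nonneg) simp
  show "1 - 2 * e \<le> (\<Sum>c\<in>J. (A c)\<^sup>2)" "1 - 2 * e \<le> (\<Sum>c\<in>J. (B c)\<^sup>2)"
    using nonneg A B AB unfolding minus by argo+
  have "(\<Sum>c\<in>J. \<bar>(B c)\<^sup>2 - (A c)\<^sup>2\<bar>) = (\<Sum>c\<in>J. \<bar>B c - A c\<bar> * \<bar>B c + A c\<bar>)"
    by (intro sum.cong refl) (simp add: power2_eq_square square_diff_square_factored mult.commute flip: abs_mult)
  also have "\<dots> \<le> L2_set (\<lambda>c. B c - A c) J * L2_set (\<lambda>c. B c + A c) J"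
    by (rule L2_set_mult_ineq)
  also have "\<dots> \<le> sqrt (2 * e) * sqrt (2\<^sup>2)"
  proof (intro mult_mono)
    show "L2_set (\<lambda>c. B c - A c) J \<le> sqrt (2 * e)"
      unfolding L2_set_def minus using A B AB by (intro real_sqrt_le_mono) argo
    have "(\<Sum>c\<in>J. A c * B c) \<le> 1" using nonneg A B unfolding minus by argo
    then show "L2_set (\<lambda>c. B c + A c) J \<le> sqrt (2\<^sup>2)"
      unfolding L2_set_def plus using A B by (intro real_sqrt_le_mono) simp
    show "0 \<le> sqrt (2 * e)" using nonneg A B AB unfolding minus by simp
  qed simp
  finally show "(\<Sum>c\<in>J. \<bar>(B c)\<^sup>2 - (A c)\<^sup>2\<bar>) \<le> sqrt (2 * e) * 2" by simp
qed

lemma continuous_map_scaleR: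
  fixes g :: "'z \<Rightarrow> 'b::real_normed_vector"
  assumes "continuous_map Z euclideanreal f" "continuous_map Z euclidean g"
  shows "continuous_map Z euclidean (\<lambda>z. f z *\<^sub>R g z)"
proof -
  have "continuous_map Z euclidean (\<lambda>z. (f z, g z))"
    using continuous_map_pairedI[OF assms] by simp
  moreover have "continuous_map euclidean euclidean (\<lambda>w :: real \<times> 'b. fst w *\<^sub>R snd w)"
    by (simp add: continuous_intros)
  ultimately have "continuous_map Z euclidean ((\<lambda>w. fst w *\<^sub>R snd w) \<circ> (\<lambda>z. (f z, g z)))"
    by (rule continuous_map_compose)
  then show ?thesis by (simp add: o_def)
qed

section \<open>Probability measures attached to the points of Y, and their almost invariance\<close>

context inv_bundle
begin

sublocale sp: etale_space G YT px act
  by unfold_locales (rule gspace_YT)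

text \<open>The mass missing to a probability measure is put on the unit.\<close>

definition wt :: "nat \<Rightarrow> 'y \<Rightarrow> 'g \<Rightarrow> real" where
  "wt n y c = (kv y (n, px y, c))\<^sup>2 + (if c = px y then 1 - inner y n (px y) (px y) else 0)"

definition msys :: "nat \<Rightarrow> 'y \<times> 'g \<Rightarrow> ('y \<times> 'g) measure" where
  "msys n u = density (count_space ({fst u} \<times> Fb (snd u))) (\<lambda>z. ennreal (wt n (fst u) (snd z)))"

text \<open>The unit is included because it receives the missing mass, even when it lies outside
  \<open>C n\<close>.\<close>

definition msupp :: "nat \<Rightarrow> 'y \<Rightarrow> 'g set" where
  "msupp n y = (C n \<union> units G) \<inter> Fb (px y)"

lemma px_facts:
  assumes "y \<in> Y2" shows "px y \<in> units G" "px y \<in> Ar" "r (px y) = px y" "s (px y) = px y"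
  using px_in[OF Y2_D[OF assms]] by (auto simp: units_eq')

lemma finite_msupp: "finite (msupp n y)"
  unfolding msupp_def by (intro finite_fibre_rproper rproper_Un rproper_C rproper_units)

lemma inner_px:
  assumes "y \<in> Y2" shows "inner y n (px y) (px y) = (\<Sum>c\<in>C n \<inter> Fb (px y). (kv y (n, px y, c))\<^sup>2)"
  unfolding inner_def using px_facts[OF assms] by (intro sum.cong) (auto simp: power2_eq_square)

lemma wt_nonneg: assumes "y \<in> Y2" shows "0 \<le> wt n y c"
  using Y2_le[OF assms px_facts(2,3)[OF assms], of n] px_facts(4)[OF assms] by (auto simp: wt_def)

lemma wt_zero: assumes "y \<in> Y2" "c \<in> Fb (px y)" "c \<notin> msupp n y" shows "wt n y c = 0"
proof -
  have "c \<noteq> px y" using assms px_facts[OF assms(1)] by (auto simp: msupp_def)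
  moreover have "kv y (n, px y, c) = 0"
    using Y1_zero[OF Y2_Y1[OF assms(1)], of "px y" c n] assms px_facts[OF assms(1)] by (auto simp: msupp_def)
  ultimately show ?thesis by (simp add: wt_def)
qed

text \<open>With f = 1 this gives the total mass, with f a test function the integral. The
  correction at the unit is split off so that the remaining sum runs over \<open>C n\<close> and
  \<open>fibre_sum_continuous\<close> applies to it.\<close>

lemma wt_sum:
  fixes f :: "'g \<Rightarrow> 'b::real_normed_vector"
  assumes y: "y \<in> Y2" and J: "finite J" "msupp n y \<subseteq> J" "J \<subseteq> Fb (px y)"
  shows "(\<Sum>c\<in>J. wt n y c *\<^sub>R f c) = (\<Sum>c\<in>C n \<inter> Fb (px y). (kv y (n, px y, c))\<^sup>2 *\<^sub>R f c) + 
    (1 - inner y n (px y) (px y)) *\<^sub>R f (px y)"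
proof -
  note p = px_facts[OF y]
  have pJ: "px y \<in> J" using J(2) p by (auto simp: msupp_def)
  have CJ: "C n \<inter> Fb (px y) \<subseteq> J" using J(2) by (auto simp: msupp_def)
  have "(\<Sum>c\<in>J. wt n y c *\<^sub>R f c) = (\<Sum>c\<in>J. (kv y (n, px y, c))\<^sup>2 *\<^sub>R f c + (if c = px y then (1 - inner y n (px y) (px y)) *\<^sub>R f (px y) else 0))"
    by (intro sum.cong refl) (auto simp: wt_def scaleR_add_left)
  also have "\<dots> = (\<Sum>c\<in>J. (kv y (n, px y, c))\<^sup>2 *\<^sub>R f c) + (1 - inner y n (px y) (px y)) *\<^sub>R f (px y)"
    using J(1) pJ by (simp add: sum.distrib)
  also have "(\<Sum>c\<in>J. (kv y (n, px y, c))\<^sup>2 *\<^sub>R f c) = (\<Sum>c\<in>C n \<inter> Fb (px y). (kv y (n, px y, c))\<^sup>2 *\<^sub>R f c)"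
  proof (rule sum.mono_neutral_right[OF J(1) CJ], rule)
    fix c assume c: "c \<in> J - C n \<inter> Fb (px y)"
    then have "c \<in> Fb (px y)" "c \<notin> C n" using J(3) by auto
    then show "(kv y (n, px y, c))\<^sup>2 *\<^sub>R f c = 0" using Y1_zero[OF Y2_Y1[OF y], of "px y" c n] p by simp
  qed
  finally show ?thesis .
qed

lemma wt_total:
  assumes "y \<in> Y2" "finite J" "msupp n y \<subseteq> J" "J \<subseteq> Fb (px y)"
  shows "(\<Sum>c\<in>J. wt n y c) = 1"
  using wt_sum[OF assms, of "\<lambda>_. 1::real"] inner_px[OF assms(1), of n] by simp

lemma sets_msys: "sets (msys n (y, x)) = Pow ({y} \<times> Fb x)" "space (msys n (y, x)) = {y} \<times> Fb x"
  by (simp_all add: msys_def)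

text \<open>The set \<open>J\<close> may be larger than the support, so that two measures can be
  evaluated over one index set.\<close>

lemma emeasure_msys:
  assumes y: "y \<in> Y2" and J: "finite J" "msupp n y \<subseteq> J" "J \<subseteq> Fb (px y)" and A: "A \<subseteq> {y} \<times> Fb (px y)"
  shows "emeasure (msys n (y, px y)) A = ennreal (\<Sum>z\<in>Pair y ` J \<inter> A. wt n y (snd z))"
proof -
  have "emeasure (msys n (y, px y)) A = (\<integral>\<^sup>+z. ennreal (wt n y (snd z)) * indicator A z \<partial>count_space ({y} \<times> Fb (px y)))"
    unfolding msys_def fst_conv snd_conv using A by (intro emeasure_density) auto
  also have "\<dots> = (\<Sum>z\<in>Pair y ` J \<inter> A. ennreal (wt n y (snd z)) * indicator A z)"
  proof (rule nn_integral_count_space')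
    show "finite (Pair y ` J \<inter> A)" using J(1) by blast
    show "Pair y ` J \<inter> A \<subseteq> {y} \<times> Fb (px y)" using A by blast
    fix z assume z: "z \<in> {y} \<times> Fb (px y)" "z \<notin> Pair y ` J \<inter> A"
    show "ennreal (wt n y (snd z)) * indicator A z = 0"
    proof (cases "z \<in> A")
      case True
      obtain c where c: "z = (y, c)" "c \<in> Fb (px y)" using z(1) by blast
      then have "c \<notin> msupp n y" using z(2) True J(2) by blast
      then show ?thesis using wt_zero[OF y c(2)] c by simp
    qed simp
  qed
  also have "\<dots> = (\<Sum>z\<in>Pair y ` J \<inter> A. ennreal (wt n y (snd z)))" by (intro sum.cong) auto
  also have "\<dots> = ennreal (\<Sum>z\<in>Pair y ` J \<inter> A. wt n y (snd z))"
    using wt_nonneg[OF y] by (intro sum_ennreal) auto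
  finally show ?thesis .
qed

lemma measure_msys:
  assumes y: "y \<in> Y2" and J: "finite J" "msupp n y \<subseteq> J" "J \<subseteq> Fb (px y)" and A: "A \<subseteq> {y} \<times> Fb (px y)"
  shows "measure (msys n (y, px y)) A = (\<Sum>z\<in>Pair y ` J \<inter> A. wt n y (snd z))"
  using emeasure_msys[OF assms] wt_nonneg[OF y] by (simp add: measure_def sum_nonneg)

lemma msupp_Fb: "msupp n y \<subseteq> Fb (px y)" by (simp add: msupp_def)

lemma prob_space_msys:
  assumes y: "y \<in> Y2" shows "prob_space (msys n (y, px y))"
proof (rule prob_spaceI)
  have "emeasure (msys n (y, px y)) ({y} \<times> Fb (px y)) = ennreal (\<Sum>z\<in>Pair y ` msupp n y \<inter> {y} \<times> Fb (px y). wt n y (snd z))"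
    by (rule emeasure_msys[OF y finite_msupp subset_refl msupp_Fb subset_refl])
  also have "Pair y ` msupp n y \<inter> {y} \<times> Fb (px y) = Pair y ` msupp n y" using msupp_Fb by blast
  also have "(\<Sum>z\<in>Pair y ` msupp n y. wt n y (snd z)) = (\<Sum>c\<in>msupp n y. wt n y c)"
    by (subst sum.reindex) (auto simp: inj_on_def)
  also have "\<dots> = 1" by (rule wt_total[OF y finite_msupp subset_refl msupp_Fb])
  finally show "emeasure (msys n (y, px y)) (space (msys n (y, px y))) = 1" by (simp add: sets_msys)
qed

lemma fibre_prob_msys:
  assumes y: "y \<in> Y2" shows "fibre_prob_measure sp.H (y, px y) (msys n (y, px y))"
  unfolding fibre_prob_measure_def
proof (intro conjI ballI prob_space_msys[OF y])
  have yY: "y \<in> topspace YT" using y by simp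
  show "sets (msys n (y, px y)) = sets (fibre_borel sp.H (y, px y))"
    by (simp add: sets_msys sp.fibre_borel_H[OF yY])
  fix A assume "A \<in> sets (msys n (y, px y))"
  then have A: "A \<subseteq> {y} \<times> Fb (px y)" by (simp add: sets_msys)
  let ?M = "msys n (y, px y)" and ?Ks = "{K. compactin (fibre_space sp.H (y, px y)) K \<and> K \<subseteq> A}"
  let ?K = "Pair y ` msupp n y \<inter> A"
  have K: "?K \<in> ?Ks" using A finite_msupp[of n y]
    by (auto simp: sp.fibre_space_H[OF yY] compactin_discrete_topology)
  have "emeasure ?M A = emeasure ?M ?K"
    using emeasure_msys[OF y finite_msupp subset_refl msupp_Fb A] 
      emeasure_msys[OF y finite_msupp subset_refl msupp_Fb, of ?K n] A by (simp add: le_infI2)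
  also have "\<dots> \<le> (SUP K\<in>?Ks. emeasure ?M K)" by (rule SUP_upper[OF K])
  finally have "emeasure ?M A \<le> (SUP K\<in>?Ks. emeasure ?M K)" .
  moreover have "(SUP K\<in>?Ks. emeasure ?M K) \<le> emeasure ?M A"
    using A by (intro SUP_least emeasure_mono) (auto simp: sets_msys)
  ultimately show "emeasure ?M A = (SUP K\<in>?Ks. emeasure ?M K)" by (rule antisym)
qed

text \<open>The integral at y is the finite expression \<Phi> y: a fibre sum of squared kernel
  entries against f, plus the deficit at the unit times the value of f there. Both parts are
  continuous in y.\<close>

lemma msys_system: "msys n \<in> continuous_prob_systems sp.H"
  unfolding continuous_prob_systems_def
proof (intro CollectI conjI ballI)
  fix u assume "u \<in> units sp.H"
  then show "fibre_prob_measure sp.H u (msys n u)" using fibre_prob_msys by (auto simp: sp.units_H)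
next
  fix f assume "f \<in> Cc (gtop sp.H)"
  then have f: "continuous_map sp.HT euclidean f" by (simp add: Cc_def sp.gtop_H)
  have cBT: "continuous_map YT BT id" by (rule cont_YT_BT)
  define \<Phi> where "\<Phi> y = (\<Sum>c\<in>C n \<inter> Fb (px y). (kv y (n, px y, c))\<^sup>2 *\<^sub>R f (y, c)) + (1 - inner y n (px y) (px y)) *\<^sub>R f (y, px y)" for y
  have "continuous_map YT euclidean \<Phi>"
    unfolding \<Phi>_def
  proof (intro continuous_map_add)
    have cinner: "continuous_map YT euclideanreal (\<lambda>y. inner (id y) n (px y) (px y))"
      by (intro inner_continuous cBT sp.cont_p) (auto simp: Y2_Y1 px_facts)
    have "continuous_map YT sp.HT (\<lambda>y. (y, px y))"
      using continuous_map_id[of YT] sp.cont_p by (intro sp.cont_into_HT) (auto simp: id_def px_facts)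
    from continuous_map_compose[OF this f]
    have fpx: "continuous_map YT euclidean (\<lambda>y. f (y, px y))" by (simp add: o_def)
    have "continuous_map YT euclidean (\<lambda>y. (1 - inner (id y) n (px y) (px y)) *\<^sub>R f (y, px y))"
      by (intro continuous_map_scaleR continuous_map_diff cinner fpx) auto
    then show "continuous_map YT euclidean (\<lambda>y. (1 - inner y n (px y) (px y)) *\<^sub>R f (y, px y))" by simp
    let ?S = "subtopology (prod_topology YT T) {(y, c). px y = r c}"
    have p1: "continuous_map ?S YT fst" and p2: "continuous_map ?S T snd" by (rule continuous_map_fst_snd_subtopology)+
    have p3: "continuous_map ?S T (\<lambda>v. px (fst v))" using continuous_map_compose[OF p1 sp.cont_p] by (simp add: o_def)
    have p4: "continuous_map ?S BT (\<lambda>v. fst v)" using continuous_map_compose[OF p1 cBT] by (simp add: o_def)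
    have "continuous_map ?S euclideanreal (\<lambda>v. kv (fst v) (n, px (fst v), snd v))"
      by (intro cont_kv p4 p3 p2) (auto simp: px_facts)
    then have ck: "continuous_map ?S euclideanreal (\<lambda>v. (kv (fst v) (n, px (fst v), snd v))\<^sup>2)"
      by (intro continuous_map_real_pow)
    have "continuous_map ?S sp.HT (\<lambda>v. (fst v, snd v))" by (intro sp.cont_into_HT p1 p2) auto
    from continuous_map_compose[OF this f] have cf: "continuous_map ?S euclidean (\<lambda>v. f (fst v, snd v))" by (simp add: o_def)
    have "continuous_map ?S euclidean (\<lambda>v. (kv (fst v) (n, px (fst v), snd v))\<^sup>2 *\<^sub>R f (fst v, snd v))"
      by (intro continuous_map_scaleR ck cf)
    then show "continuous_map YT euclidean (\<lambda>y. \<Sum>c\<in>C n \<inter> Fb (px y). (kv y (n, px y, c))\<^sup>2 *\<^sub>R f (y, c))"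
    proof (intro fibre_sum_continuous rproper_C sp.cont_p_unit, simp_all only: case_prod_beta' fst_conv snd_conv)
      fix y c assume "y \<in> topspace YT" "c \<in> Fb (px y)" "c \<notin> C n"
      then have "kv y (n, px y, c) = 0"
        using Y1_zero[OF Y2_Y1, of y "px y" c n] px_facts[of y] by simp
      then show "(kv y (n, px y, c))\<^sup>2 *\<^sub>R f (y, c) = 0" by simp
    qed
  qed
  moreover have "continuous_map (unit_space sp.H) YT fst"
    unfolding sp.unit_space_H by (intro continuous_map_from_subtopology sp.cont_HT_fst)
  ultimately have "continuous_map (unit_space sp.H) euclidean (\<Phi> \<circ> fst)"
    using continuous_map_compose by blast
  then show "continuous_map (unit_space sp.H) euclidean (\<lambda>u. \<integral>z. f z \<partial>msys n u)"
  proof (rule continuous_map_eq)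
    fix u assume "u \<in> topspace (unit_space sp.H)"
    then have "u \<in> units sp.H" by (auto simp: sp.unit_space_H)
    then obtain y where u: "u = (y, px y)" "y \<in> Y2" by (auto simp: sp.units_H)
    note y = u(2)
    let ?\<Omega> = "{y} \<times> Fb (px y)" and ?g = "\<lambda>z. wt n y (snd z) *\<^sub>R f z" and ?S = "Pair y ` msupp n y"
    have "(\<integral>z. f z \<partial>msys n (y, px y)) = (\<integral>z. ?g z \<partial>count_space ?\<Omega>)"
      unfolding msys_def fst_conv snd_conv using wt_nonneg[OF y] by (intro integral_density) auto
    also have "\<dots> = (\<Sum>z | z \<in> ?\<Omega> \<and> ?g z \<noteq> 0. ?g z)"
    proof (rule lebesgue_integral_count_space_finite_support)
      have "{z \<in> ?\<Omega>. ?g z \<noteq> 0} \<subseteq> ?S" using wt_zero[OF y, of _ n] by fastforce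
      then show "finite {z \<in> ?\<Omega>. ?g z \<noteq> 0}" using finite_msupp finite_subset by blast
    qed
    also have "\<dots> = (\<Sum>z\<in>?S. ?g z)"
    proof (rule sum.mono_neutral_left)
      show "finite ?S" using finite_msupp by blast
      show "{z. z \<in> ?\<Omega> \<and> ?g z \<noteq> 0} \<subseteq> ?S" using wt_zero[OF y, of _ n] by fastforce
      show "\<forall>z\<in>?S - {z. z \<in> ?\<Omega> \<and> ?g z \<noteq> 0}. ?g z = 0" using msupp_Fb[of n y] by blast
    qed
    also have "\<dots> = (\<Sum>c\<in>msupp n y. wt n y c *\<^sub>R f (y, c))"
      by (subst sum.reindex) (auto simp: inj_on_def)
    also have "\<dots> = \<Phi> y"
      unfolding \<Phi>_def by (rule wt_sum[OF y finite_msupp subset_refl msupp_Fb])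
    finally show "(\<Phi> \<circ> fst) u = (\<integral>z. f z \<partial>msys n u)" by (simp add: u(1))
  qed
qed

text \<open>The measure at y comes from the row of the unit, the translated one from the row of
  \<open>d\<close> in the same kernel, and membership in Y bounds the inner product of these rows
  below. The first summand of the bound compares the squares; the second covers the two deficits, at
  most 2 \<open>e n\<close> each.\<close>

lemma tv_msys:
  assumes y: "y \<in> Y2" and d: "d \<in> Ar" "d \<in> U n" "r d = px y"
  shows "\<bar>tv_dist (translate_measure sp.H (y, d) (msys n (gsrc sp.H (y, d)))) (msys n (grng sp.H (y, d)))\<bar>
    \<le> sqrt (2 * e n) * 2 + 4 * e n"
proof -
  note p = px_facts[OF y]
  define y' where "y' = act (iv d) y"
  have y': "y' \<in> Y2" "px y' = s d" unfolding y'_def using y d by (auto intro!: act_in_Y2)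
  have yY: "y \<in> topspace YT" using y by simp
  define \<mu> where "\<mu> = msys n (y, px y)"
  define \<nu> where "\<nu> = translate_measure sp.H (y, d) (msys n (y', px y'))"
  have \<nu>: "\<nu> = distr (msys n (y', px y')) (fibre_borel sp.H (y, px y)) (gmult sp.H (y, d))"
    unfolding \<nu>_def translate_measure_def sp.grng_H ..
  have meas: "gmult sp.H (y, d) \<in> measurable (msys n (y', px y')) (fibre_borel sp.H (y, px y))"
  proof (rule measurableI)
    fix w assume "w \<in> space (msys n (y', px y'))"
    then obtain c where "w = (y', c)" "c \<in> Fb (px y')" unfolding sets_msys by auto
    then show "gmult sp.H (y, d) w \<in> space (fibre_borel sp.H (y, px y))"
      unfolding sp.fibre_borel_H[OF yY] using d y' by (simp add: sp.gmult_H)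
  qed (simp add: sets_msys Int_commute)
  interpret \<mu>: prob_space \<mu> unfolding \<mu>_def by (rule prob_space_msys[OF y])
  interpret \<mu>': prob_space "msys n (y', px y')" by (rule prob_space_msys[OF y'(1)])
  have prob\<nu>: "prob_space \<nu>" unfolding \<nu> by (rule \<mu>'.prob_space_distr[OF meas])
  have sets: "sets \<mu> = Pow ({y} \<times> Fb (px y))" "sets \<nu> = Pow ({y} \<times> Fb (px y))"
    unfolding \<mu>_def \<nu> by (simp_all add: sets_msys sp.fibre_borel_H[OF yY])
  \<comment> \<open>A set carrying both the measure at y and the translate of the one at
    \<open>y'\<close>; \<open>J'\<close> is its preimage under that translation.\<close>
  define J where "J = msupp n y \<union> (\<lambda>c. d \<odot> c) ` msupp n y'"
  have J: "finite J" "msupp n y \<subseteq> J" unfolding J_def using finite_msupp by auto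
  have JF: "J \<subseteq> Fb (px y)" unfolding J_def using msupp_Fb[of n y] d y' by (auto simp: msupp_def)
  have JA: "c \<in> Ar" "r c = r d" "c \<in> Fb (px y)" if "c \<in> J" for c using JF that d(3) by auto
  define J' where "J' = (\<lambda>c. iv d \<odot> c) ` J"
  have J': "finite J'" "J' \<subseteq> Fb (px y')" 
  proof -
    show "finite J'" unfolding J'_def using J(1) by blast
    show "J' \<subseteq> Fb (px y')"
    proof
      fix c' assume "c' \<in> J'"
      then obtain c where c: "c \<in> J" "c' = iv d \<odot> c" unfolding J'_def by blast
      then show "c' \<in> Fb (px y')" using JA(1,2)[OF c(1)] d(1) y'(2) by simp
    qed
  qed
  have J'2: "msupp n y' \<subseteq> J'"
  proof
    fix c assume c: "c \<in> msupp n y'"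
    then have "c \<in> Fb (s d)" using msupp_Fb[of n y'] unfolding y'(2) by (rule rev_subsetD)
    then have "iv d \<odot> (d \<odot> c) = c" using d(1) by simp
    then show "c \<in> J'" unfolding J'_def J_def using c by (intro image_eqI[of _ _ "d \<odot> c"]) auto
  qed
  have m\<mu>: "measure \<mu> A = (\<Sum>z\<in>Pair y ` J \<inter> A. wt n y (snd z))" if "A \<in> sets \<mu>" for A
    unfolding \<mu>_def using that by (intro measure_msys y J JF) (simp add: sets)
  have m\<nu>: "measure \<nu> A = (\<Sum>z\<in>Pair y ` J \<inter> A. wt n y' (iv d \<odot> snd z))" if A: "A \<in> sets \<mu>" for A
  proof -
    let ?A' = "gmult sp.H (y, d) -` A \<inter> space (msys n (y', px y'))"
    have "measure \<nu> A = measure (msys n (y', px y')) ?A'"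
      unfolding \<nu> using A by (intro measure_distr[OF meas]) (simp add: sp.fibre_borel_H[OF yY] sets)
    also have "\<dots> = (\<Sum>z\<in>Pair y' ` J' \<inter> ?A'. wt n y' (snd z))"
      by (rule measure_msys[OF y'(1) J'(1) J'2 J'(2)]) (auto simp: sets_msys)
    also have "\<dots> = (\<Sum>z\<in>Pair y ` J \<inter> A. wt n y' (iv d \<odot> snd z))"
    proof (rule sum.reindex_bij_witness[of _ "\<lambda>z. (y', iv d \<odot> snd z)" "\<lambda>z. (y, d \<odot> snd z)"])
      fix z assume "z \<in> Pair y' ` J' \<inter> ?A'"
      then obtain c where c: "c \<in> J" "z = (y', iv d \<odot> c)" "gmult sp.H (y, d) z \<in> A" by (auto simp: J'_def)
      have dc: "d \<odot> (iv d \<odot> c) = c" using JA[OF c(1)] d(1) by simp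
      show "(y', iv d \<odot> snd (y, d \<odot> snd z)) = z" using c dc by simp
      show "(y, d \<odot> snd z) \<in> Pair y ` J \<inter> A" using c dc by (auto simp: sp.gmult_H)
      show "wt n y' (iv d \<odot> snd (y, d \<odot> snd z)) = wt n y' (snd z)" using c dc by simp
    next
      fix z assume "z \<in> Pair y ` J \<inter> A"
      then obtain c where c: "c \<in> J" "z = (y, c)" "z \<in> A" by auto
      have dc: "d \<odot> (iv d \<odot> c) = c" using JA[OF c(1)] d(1) by simp
      show "(y, d \<odot> snd (y', iv d \<odot> snd z)) = z" using c dc by simp
      have "iv d \<odot> c \<in> J'" using c by (auto simp: J'_def)
      then show "(y', iv d \<odot> snd z) \<in> Pair y' ` J' \<inter> ?A'"
        using c dc J'(2) by (auto simp: sp.gmult_H sets_msys)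
    qed
    finally show ?thesis .
  qed
  \<comment> \<open>\<open>A\<close> is the row of the unit and \<open>B\<close> the row of
    \<open>d\<close>, both indexed by the fibre over \<open>px y\<close>. The unit row of the
    translated point \<open>y'\<close> is the row of \<open>d\<close> in \<open>y\<close>.\<close>
  define A where "A c = kv y (n, px y, c)" for c
  define B where "B c = kv y (n, d, iv d \<odot> c)" for c
  define qA where "qA = inner y n (px y) (px y)"
  define qB where "qB = inner y' n (px y') (px y')"
  have Azero: "A c = 0" if "c \<in> Fb (px y)" "c \<notin> C n" for c
    unfolding A_def using Y1_zero[OF Y2_Y1[OF y], of "px y" c n] that p by simp
  have Bzero: "B c = 0" if "c \<in> Fb (px y)" "iv d \<odot> c \<notin> C n" for c
    unfolding B_def using Y1_zero[OF Y2_Y1[OF y], of d "iv d \<odot> c" n] that d by simp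
  have CJ: "C n \<inter> Fb (px y) \<subseteq> J" using J(2) by (auto simp: msupp_def)
  have sumA: "(\<Sum>c\<in>J. (A c)\<^sup>2) = qA"
    unfolding qA_def inner_px[OF y] A_def[symmetric]
  proof (rule sum.mono_neutral_right[OF J(1) CJ], rule)
    fix c assume "c \<in> J - C n \<inter> Fb (px y)"
    then show "(A c)\<^sup>2 = 0" using JA(3)[of c] Azero[of c] by auto
  qed
  have sumAB: "(\<Sum>c\<in>J. A c * B c) = inner y n (px y) d"
  proof -
    have "inner y n (px y) d = (\<Sum>c\<in>C n \<inter> Fb (px y). A c * B c)"
      unfolding inner_def A_def B_def using p d by (intro sum.cong) auto
    also have "\<dots> = (\<Sum>c\<in>J. A c * B c)"
    proof (rule sum.mono_neutral_left[OF J(1) CJ], rule)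
      fix c assume "c \<in> J - C n \<inter> Fb (px y)"
      then show "A c * B c = 0" using JA(3)[of c] Azero[of c] by auto
    qed
    finally show ?thesis by simp
  qed
  have kvy': "kv y' (n, s d, c) = kv y (n, d, c)" if "c \<in> Fb (s d)" for c
    unfolding y'_def using that d(1) by (subst kv_act) auto
  have sumB: "(\<Sum>c\<in>J. (B c)\<^sup>2) = qB"
  proof -
    have "qB = (\<Sum>c\<in>C n \<inter> Fb (s d). (B (d \<odot> c))\<^sup>2)"
      unfolding qB_def inner_px[OF y'(1)] using d(1) y'(2)
      by (intro sum.cong) (auto simp: kvy' B_def)
    also have "\<dots> = (\<Sum>c\<in>J. (B c)\<^sup>2)"
    proof (rule sum_translate[OF d(1) J(1)])
      show "J \<subseteq> Fb (r d)" using JF d(3) by simp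
      show "(\<lambda>c. d \<odot> c) ` (C n \<inter> Fb (s d)) \<subseteq> J"
        unfolding J_def msupp_def y'(2) by blast
      show "(B (d \<odot> c))\<^sup>2 = 0" if "c \<in> Fb (s d)" "c \<notin> C n" for c
        using Bzero[of "d \<odot> c"] that d by simp
    qed
    finally show ?thesis by simp
  qed
  have le1: "qA \<le> 1" "qB \<le> 1" unfolding qA_def qB_def
    using Y2_le[OF y p(2,3), of n] Y2_le[OF y'(1) px_facts(2,3)[OF y'(1)], of n] p px_facts(4)[OF y'(1)] by simp_all
  have ge: "1 - e n \<le> inner y n (px y) d" using Y2_ge[OF y p(2) d(2)] p d by simp
  note S = sum_square_diff_le[OF J(1), of A B "e n", unfolded sumA sumB sumAB, OF le1 ge]
  \<comment> \<open>The deficit at the unit of \<open>y'\<close> is carried by the translation to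
    the position \<open>d\<close>.\<close>
  have wB: "wt n y' (iv d \<odot> c) = (B c)\<^sup>2 + (if c = d then 1 - qB else 0)" if c: "c \<in> J" for c
  proof -
    have "iv d \<odot> c = px y' \<longleftrightarrow> c = d"
    proof
      assume "iv d \<odot> c = px y'"
      then have "d \<odot> (iv d \<odot> c) = d \<odot> s d" using y'(2) by simp
      then show "c = d" using JA[OF c] d(1) by simp
    qed (use d y' in simp)
    then show ?thesis unfolding wt_def qB_def[symmetric] using JA[OF c] d(1) y'(2) by (simp add: kvy' B_def)
  qed
  have "\<bar>tv_dist \<nu> \<mu>\<bar> \<le> (\<Sum>z\<in>Pair y ` J. \<bar>wt n y' (iv d \<odot> snd z) - wt n y (snd z)\<bar>)"
    using J(1) m\<mu> m\<nu> sets by (intro tv_dist_le prob\<nu> \<mu>.prob_space_axioms) auto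
  also have "\<dots> = (\<Sum>c\<in>J. \<bar>wt n y' (iv d \<odot> c) - wt n y c\<bar>)"
    by (subst sum.reindex) (auto simp: inj_on_def)
  also have "\<dots> \<le> (\<Sum>c\<in>J. \<bar>(B c)\<^sup>2 - (A c)\<^sup>2\<bar> + (if c = d then 1 - qB else 0) + (if c = px y then 1 - qA else 0))"
  proof (rule sum_mono)
    fix c assume c: "c \<in> J"
    have gen: "\<bar>b + t - (a' + u)\<bar> \<le> \<bar>b - a'\<bar> + t + u" if "0 \<le> t" "0 \<le> u" for a' b t u :: real
      using that by linarith
    have wA: "wt n y c = (A c)\<^sup>2 + (if c = px y then 1 - qA else 0)" by (simp add: wt_def A_def qA_def)
    show "\<bar>wt n y' (iv d \<odot> c) - wt n y c\<bar> \<le> \<bar>(B c)\<^sup>2 - (A c)\<^sup>2\<bar> + (if c = d then 1 - qB else 0) + (if c = px y then 1 - qA else 0)"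
      unfolding wA wB[OF c] by (rule gen) (use le1 in auto)
  qed
  also have "\<dots> \<le> (\<Sum>c\<in>J. \<bar>(B c)\<^sup>2 - (A c)\<^sup>2\<bar>) + (1 - qB) + (1 - qA)"
    using J(1) le1 by (simp add: sum.distrib)
  also have "\<dots> \<le> sqrt (2 * e n) * 2 + 4 * e n" using S by simp
  finally show ?thesis
    unfolding \<nu>_def \<mu>_def sp.gsrc_H sp.grng_H y'_def .
qed

text \<open>The net is the sequence \<open>msys\<close> itself, through its filter of tails. The
  arrow components of a compact set form a compact set, which lies in \<open>U n\<close> for all
  large n.\<close>

lemma amenable_YT: "amenable_groupoid sp.H"
  unfolding amenable_groupoid_def
proof (intro exI conjI allI impI)
  let ?F = "filtermap msys sequentially"
  show "?F \<noteq> bot" by (simp add: filtermap_bot_iff)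
  show "?F \<le> principal (continuous_prob_systems sp.H)"
    by (simp add: le_principal eventually_filtermap msys_system)
  fix K assume "compactin (gtop sp.H) K"
  then have K: "compactin sp.HT K" by (simp add: sp.gtop_H)
  have "compactin T (snd ` K)" using K sp.cont_HT_snd image_compactin by blast
  then obtain n0 where n0: "\<And>n. n \<ge> n0 \<Longrightarrow> snd ` K \<subseteq> U n" using cover by blast
  show "uniform_limit K (\<lambda>m \<gamma>. tv_dist (translate_measure sp.H \<gamma> (m (gsrc sp.H \<gamma>))) (m (grng sp.H \<gamma>))) (\<lambda>_. 0) ?F"
  proof (rule uniform_limitI)
    fix \<epsilon> :: real assume \<epsilon>: "0 < \<epsilon>"
    have "(\<lambda>n. sqrt (2 * e n) * 2 + 4 * e n) \<longlonglongrightarrow> sqrt (2 * 0) * 2 + 4 * 0"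
      by (intro tendsto_intros e)
    then have "\<forall>\<^sub>F n in sequentially. sqrt (2 * e n) * 2 + 4 * e n < \<epsilon>"
      using \<epsilon> by (intro order_tendstoD(2)) auto
    moreover have "\<forall>\<^sub>F n in sequentially. n \<ge> n0" by (rule eventually_ge_at_top)
    ultimately show "\<forall>\<^sub>F m in ?F. \<forall>\<gamma>\<in>K. dist (tv_dist (translate_measure sp.H \<gamma> (m (gsrc sp.H \<gamma>))) (m (grng sp.H \<gamma>))) 0 < \<epsilon>"
      unfolding eventually_filtermap
    proof eventually_elim
      case (elim n)
      show ?case
      proof
        fix \<gamma> assume g: "\<gamma> \<in> K"
        then have "\<gamma> \<in> topspace sp.HT" using compactin_subset_topspace[OF K] by blast
        then obtain y d where yd: "\<gamma> = (y, d)" "y \<in> Y2" "d \<in> Ar" "r d = px y" by auto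
        have "d \<in> U n" using n0[OF elim(2)] g yd(1) by force
        then show "dist (tv_dist (translate_measure sp.H \<gamma> (msys n (gsrc sp.H \<gamma>))) (msys n (grng sp.H \<gamma>))) 0 < \<epsilon>"
          using tv_msys[OF yd(2,3) _ yd(4), of n] elim(1) unfolding yd(1) by (simp add: dist_real_def)
      qed
    qed
  qed
qed

theorem strongly_amenable_YT: "strongly_amenable_at_infinity TYPE('y) G"
  unfolding strongly_amenable_at_infinity_def amenable_gspace_def
  using gspace_YT amenable_YT fibrewise_compact_YT cont_\<sigma> px_\<sigma> by blast

end

section \<open>The type of the points of Y, and the equivalence\<close>

lemma (in etale) almost_inv_of_strongly_amenable:
  assumes "strongly_amenable_at_infinity TYPE('y) G" shows almost_inv_families
proof -
  obtain Y :: "'y topology" and p act \<sigma> where Y: "amenable_gspace G Y p act" "fibrewise_compact (unit_space G) Y p"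
    "continuous_map (unit_space G) Y \<sigma>" "\<forall>x\<in>units G. p (\<sigma> x) = x"
    using assms unfolding strongly_amenable_at_infinity_def by blast
  interpret etale_space G Y p act
    by unfold_locales (use Y(1) in \<open>simp add: amenable_gspace_def\<close>)
  show ?thesis
    using Y by (intro almost_inv_of_amenable) (auto simp: amenable_gspace_def)
qed

text \<open>
  The value modulo \<open>4\<close> at \<open>z\<close> tells whether \<open>z\<close> is the second and whether it is the third component of
  the triple. Points are coded by negative functions to keep the two ranges disjoint.
\<close>

definition triple_code :: "nat \<times> 'g \<times> 'g \<Rightarrow> 'g \<Rightarrow> real" where
  "triple_code w z = real (4 * fst w + (if z = fst (snd w) then 1 else 0) + (if z = snd (snd w) then 2 else 0))"

definition point_code :: "'g \<Rightarrow> 'g \<Rightarrow> real" where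
  "point_code x z = - 1 - (if z = x then 1 else 0)"

lemma inj_triple_code: "inj triple_code"
proof (rule injI)
  fix w w' :: "nat \<times> 'g \<times> 'g" assume eq: "triple_code w = triple_code w'"
  obtain n \<gamma> c n' \<gamma>' c' where w: "w = (n, \<gamma>, c)" "w' = (n', \<gamma>', c')" by (cases w, cases w')
  have *: "4 * n + (if z = \<gamma> then 1 else 0) + (if z = c then 2 else 0) =
      4 * n' + (if z = \<gamma>' then 1 else 0) + (if z = c' then 2 else 0)" for z
    using fun_cong[OF eq, of z] unfolding triple_code_def w by (simp only: of_nat_eq_iff fst_conv snd_conv)
  have "n = n'" using *[of \<gamma>] by (auto split: if_splits) presburger+
  moreover have "\<gamma> = \<gamma>'" using *[of \<gamma>] \<open>n = n'\<close> by (auto split: if_splits)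
  moreover have "c = c'" using *[of c] \<open>n = n'\<close> \<open>\<gamma> = \<gamma>'\<close> by (auto split: if_splits)
  ultimately show "w = w'" by (simp add: w)
qed

text \<open>The pair of x and \<kappa> becomes a function on codes: at the code of a triple it takes
  the value of \<kappa>, at the code of a point it tells whether that point is x. Disjoint ranges of
  the codes keep the two parts apart.\<close>

lemma exists_encoding:
  "\<exists>enc :: 'g \<times> (nat \<times> 'g \<times> 'g \<Rightarrow> real) \<Rightarrow> ('g \<Rightarrow> real) \<Rightarrow> real. inj enc"
proof -
  define enc :: "'g \<times> (nat \<times> 'g \<times> 'g \<Rightarrow> real) \<Rightarrow> ('g \<Rightarrow> real) \<Rightarrow> real" where
    "enc v F = (if F \<in> range triple_code then snd v (inv triple_code F) else if F = point_code (fst v) then 1 else 0)" for v F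
  have range: "point_code x \<notin> range triple_code" for x :: 'g
  proof
    assume "point_code x \<in> range triple_code"
    then obtain w where "point_code x = triple_code w" by blast
    from fun_cong[OF this, of x] show False by (simp add: point_code_def triple_code_def split: if_splits)
  qed
  have "inj enc"
  proof (rule injI)
    fix v v' assume eq: "enc v = enc v'"
    have "snd v w = snd v' w" for w
      using fun_cong[OF eq, of "triple_code w"] by (simp add: enc_def inv_f_f[OF inj_triple_code])
    moreover have "fst v = fst v'"
    proof (rule ccontr)
      assume ne: "fst v \<noteq> fst v'"
      have "point_code (fst v) \<noteq> point_code (fst v')"
        using ne by (auto simp: point_code_def fun_eq_iff dest: spec[of _ "fst v"])
      then show False using fun_cong[OF eq, of "point_code (fst v)"] range by (simp add: enc_def)
    qed
    ultimately show "v = v'" by (intro prod_eqI ext)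
  qed
  then show ?thesis by blast
qed

lemma (in etale) strongly_amenable_of_almost_inv:
  assumes sc: "second_countable T" and fam: almost_inv_families
  shows "strongly_amenable_at_infinity TYPE(('g \<Rightarrow> real) \<Rightarrow> real) G"
proof -
  obtain K :: "nat \<Rightarrow> 'g set" where K: "\<forall>n. compactin T (K n)" "\<forall>L. compactin T L \<longrightarrow> (\<exists>n0. \<forall>n\<ge>n0. L \<subseteq> K n)"
    "\<forall>n. \<exists>U. openin T U \<and> K n \<subseteq> U \<and> U \<subseteq> K (Suc n)"
    using compact_exhaustion[OF sc] by (elim exE conjE) (rule that)
  then obtain U where U: "\<And>n. openin T (U n)" "\<And>n. K n \<subseteq> U n" "\<And>n. U n \<subseteq> K (Suc n)" by metis
  define e where "e n = inverse (real (Suc n))" for n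
  \<comment> \<open>The index is shifted because the open set \<open>U n\<close> lies between
    \<open>K n\<close> and \<open>K (Suc n)\<close>, and the estimate is needed on all of
    \<open>U n\<close>.\<close>
  have "\<exists>a C. almost_inv a C (K (Suc n)) (e n)" for n
    using fam K(1) unfolding almost_inv_families_def e_def by simp
  then obtain a C where a: "\<And>n. almost_inv (a n) (C n) (K (Suc n)) (e n)" by metis
  obtain enc :: "'g \<times> (nat \<times> 'g \<times> 'g \<Rightarrow> real) \<Rightarrow> ('g \<Rightarrow> real) \<Rightarrow> real" where enc: "inj enc"
    using exists_encoding by blast
  interpret inv_bundle G a C "\<lambda>n. K (Suc n)" U e enc
  proof unfold_locales
    show "\<exists>n0. \<forall>n\<ge>n0. L \<subseteq> U n" if "compactin T L" for L
      using K(2) U(2) that by (meson subset_trans)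
    show "e \<longlonglongrightarrow> 0" unfolding e_def by (rule LIMSEQ_inverse_real_of_nat)
  qed (use a U enc in \<open>auto simp: e_def\<close>)
  show ?thesis by (rule strongly_amenable_YT)
qed

text \<open>The last conjunct shows that the choice of point type loses nothing: a suitable Y over
  any type yields \<open>almost_inv_families\<close>, from which one is rebuilt over the fixed
  type.\<close>

theorem theorem4p10:
  fixes G :: "'g groupoid"
  assumes "etale_groupoid G" and "second_countable (gtop G)"
  shows "(strongly_amenable_at_infinity TYPE(('g \<Rightarrow> real) \<Rightarrow> real) G \<longleftrightarrow>
            (\<exists>k :: nat \<Rightarrow> 'g \<times> 'g \<Rightarrow> complex.
               (\<forall>n. bounded (k n ` rprod G) \<and> positive_definite_kernel G (k n) \<and>
                    continuous_map (rprod_space G) euclidean (k n) \<and> supported_in_tube G (k n)) \<and>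
               (\<forall>n. \<forall>\<gamma>\<in>arrows G. norm (k n (\<gamma>, \<gamma>)) \<le> 1) \<and>
               (\<forall>A. tube G A \<longrightarrow> uniform_limit A k (\<lambda>_. 1) sequentially)))
       \<and> (strongly_amenable_at_infinity TYPE('y) G \<longrightarrow>
            strongly_amenable_at_infinity TYPE(('g \<Rightarrow> real) \<Rightarrow> real) G)"
    (is "(?S \<longleftrightarrow> (\<exists>k. ?P k)) \<and> _")
proof -
  interpret etale G by unfold_locales (rule assms(1))
  have 1: "\<exists>k. ?P k" if ?S
    by (rule kernels_of_almost_inv[OF assms(2) almost_inv_of_strongly_amenable[OF that]])
  have 2: ?S if "?P k" for k
  proof (rule strongly_amenable_of_almost_inv[OF assms(2)])
    show almost_inv_families using that by (intro almost_inv_of_kernels[of k]) auto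
  qed
  have 3: "strongly_amenable_at_infinity TYPE('y) G \<Longrightarrow> ?S"
    by (rule strongly_amenable_of_almost_inv[OF assms(2) almost_inv_of_strongly_amenable])
  show ?thesis using 1 2 3 by blast
qed

end
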